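(* Let $P$ be a finite poset, $P^*\subseteq P$ a subset containing all minimal and all maximal elements of $P$, and $\lambda:P^*\to\mathbb R$ order-preserving; let $n=\dim(P,\lambda)$. For $0\le i\le n$ let $C^i(P,\lambda)$ be the $\mathbb Z_2$-vector space with basis the $\lambda$-admissible chains of order ideals of $P$ of dimension $i$, and define the linear map $\delta:C^i(P,\lambda)\to C^{i+1}(P,\lambda)$ on basis elements by $\delta(L)=\Sigma_1(L)+\dots+\Sigma_m(L)$ for $L=(\emptyset=I_0\subsetneq I_1\subsetneq\cdots\subsetneq I_m=P)$, where $\Sigma_k(L)$ is the formal sum of all $I_k$-densifications of $L$ which possess an $I_k$-conjugate. Then $C^*(P,\lambda)=(C^0(P,\lambda)\xrightarrow{\delta}\cdots\xrightarrow{\delta}C^n(P,\lambda))$ is a cochain complex (i.e. $\delta\circ\delta=0$), and it is isomorphic to the cochain complex $C^*_{\mathcal K_{P,\lambda}}$.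
   Context: An order ideal of $P$ is a subset $I$ such that $x\in I$, $y\preceq x$ imply $y\in I$. A chain of order ideals $L=(\emptyset=I_0\subsetneq\cdots\subsetneq I_m=P)$ is $\lambda$-admissible if for every $i$ the set $\lambda((I_i\setminus I_{i-1})\cap P^* )$ is either empty or a singleton $\{t_i\}$, and $t_i<t_j$ whenever $i<j$ and both are defined. Its dimension $\dim L$ is the number of $i$ with $(I_i\setminus I_{i-1})\cap P^*=\emptyset$; $\dim(P,\lambda)$ is the maximum of $\dim L$ over all $\lambda$-admissible chains. An $I_k$-densification of $L$ is a $\lambda$-admissible chain obtained from $L$ by inserting a single order ideal $J$ with $I_{k-1}\subsetneq J\subsetneq I_k$. Two $I_k$-densifications of $L$, obtained by inserting $J'$ and $J''$ respectively, are $I_k$-conjugate if $I_k\setminus J'=J''\setminus I_{k-1}$ and $J'\setminus I_{k-1}=I_k\setminus J''$. The marked order polytope $O(P,\lambda)$ is the set of $x\in\mathbb R^P$ with $x_p\le x_q$ whenever $p\preceq q$ and $x_a=\lambda(a)$ for $a\in P^*$. For a $\lambda$-admissible chain $L$, $F_L\subseteq\mathbb R^P$ is the set of $x$ with $x|_{P^*}=\lambda$, $x$ constant on each $I_i\setminus I_{i-1}$, and $x(I_1)\le x(I_2\setminus I_1)\le\cdots\le x(I_m\setminus I_{m-1})$. The family $\mathcal K_{P,\lambda}=\{F_L\}$ ($L$ ranging over $\lambda$-admissible chains) is a polyhedral subdivision of $O(P,\lambda)$. For a subdivision $\mathcal K$ of a convex polytope $M$, $C^*_{\mathcal K}=\bigoplus_A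 C^*(\mathcal A',\partial\mathcal A';\mathbb Z_2)$, the sum over all nonempty faces $A$ of $M$, where $\mathcal A'$ is the set of polytopes of $\mathcal K$ contained in $A$, $\partial\mathcal A'$ the set of those contained in the relative boundary of $A$, and $C^*(\mathcal A',\partial\mathcal A';\mathbb Z_2)$ is the cellular cochain complex over $\mathbb Z_2$ of the CW pair whose open cells are relative interiors of these polytopes. *)

theory Defs
  imports "HOL-Analysis.Analysis" "HOL-Homology.Homology" "HOL-Library.Z2"
begin

section \<open>Cochain complexes over the field with two elements\<close>

text \<open>All vector spaces below are spaces of functions with values in the field \<^typ>\<open>bit\<close>, with
  pointwise operations. A graded space is a family of such spaces indexed by the degree.\<close>

definition z2_subspace :: "('x \<Rightarrow> bit) set \<Rightarrow> bool" where
  "z2_subspace V \<longleftrightarrow> (\<lambda>x. 0) \<in> V \<and>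
     (\<forall>f\<in>V. \<forall>g\<in>V. (\<lambda>x. f x + g x) \<in> V) \<and>
     (\<forall>a. \<forall>f\<in>V. (\<lambda>x. a * f x) \<in> V)"

definition z2_linear :: "('x \<Rightarrow> bit) set \<Rightarrow> ('y \<Rightarrow> bit) set \<Rightarrow> (('x \<Rightarrow> bit) \<Rightarrow> ('y \<Rightarrow> bit)) \<Rightarrow> bool" where
  "z2_linear V W T \<longleftrightarrow> T \<in> V \<rightarrow> W \<and>
     (\<forall>f\<in>V. \<forall>g\<in>V. T (\<lambda>x. f x + g x) = (\<lambda>y. T f y + T g y)) \<and>
     (\<forall>a. \<forall>f\<in>V. T (\<lambda>x. a * f x) = (\<lambda>y. a * T f y))"

definition z2_cochain_complex ::
    "(nat \<Rightarrow> ('x \<Rightarrow> bit) set) \<Rightarrow> (nat \<Rightarrow> ('x \<Rightarrow> bit) \<Rightarrow> ('x \<Rightarrow> bit)) \<Rightarrow> bool" where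
  "z2_cochain_complex C d \<longleftrightarrow>
     (\<forall>i. z2_subspace (C i)) \<and>
     (\<forall>i. z2_linear (C i) (C (Suc i)) (d i)) \<and>
     (\<forall>i. \<forall>c\<in>C i. d (Suc i) (d i c) = (\<lambda>x. 0))"

definition z2_cochain_isomorphic ::
    "(nat \<Rightarrow> ('x \<Rightarrow> bit) set) \<Rightarrow> (nat \<Rightarrow> ('x \<Rightarrow> bit) \<Rightarrow> ('x \<Rightarrow> bit)) \<Rightarrow>
     (nat \<Rightarrow> ('y \<Rightarrow> bit) set) \<Rightarrow> (nat \<Rightarrow> ('y \<Rightarrow> bit) \<Rightarrow> ('y \<Rightarrow> bit)) \<Rightarrow> bool" where
  "z2_cochain_isomorphic C d D e \<longleftrightarrow>
     (\<exists>\<phi>. \<forall>i. z2_linear (C i) (D i) (\<phi> i) \<and> bij_betw (\<phi> i) (C i) (D i) \<and>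
        (\<forall>c\<in>C i. \<phi> (Suc i) (d i c) = e i (\<phi> i c)))"


section \<open>Admissible chains of order ideals of a marked poset\<close>

text \<open>The poset \<open>P\<close> is the type \<^typ>\<open>'p\<close>, its set of marked elements is \<open>Ps\<close>, and the marking
  \<open>lam\<close> is only ever evaluated on \<open>Ps\<close>. A chain \<open>I\<^sub>0 \<subset> \<dots> \<subset> I\<^sub>m\<close> is the list \<open>[I\<^sub>0, \<dots>, I\<^sub>m]\<close>.\<close>

definition order_ideal :: "'p::order set \<Rightarrow> bool" where
  "order_ideal I \<longleftrightarrow> (\<forall>x\<in>I. \<forall>y. y \<le> x \<longrightarrow> y \<in> I)"

definition chain_length :: "'p set list \<Rightarrow> nat" where
  "chain_length L = length L - 1"

definition block :: "'p set list \<Rightarrow> nat \<Rightarrow> 'p set" where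
  "block L i = L ! i - L ! (i - 1)"

definition ideal_chain :: "'p::order set list \<Rightarrow> bool" where
  "ideal_chain L \<longleftrightarrow> L \<noteq> [] \<and> hd L = {} \<and> last L = UNIV \<and>
     (\<forall>I\<in>set L. order_ideal I) \<and>
     (\<forall>i\<in>{1..chain_length L}. L ! (i - 1) \<subset> L ! i)"

definition admissible_chains :: "'p::order set \<Rightarrow> ('p \<Rightarrow> real) \<Rightarrow> 'p set list set" where
  "admissible_chains Ps lam = {L. ideal_chain L \<and>
     (\<forall>i\<in>{1..chain_length L}.
        lam ` (block L i \<inter> Ps) = {} \<or> (\<exists>t. lam ` (block L i \<inter> Ps) = {t})) \<and>
     (\<forall>i\<in>{1..chain_length L}. \<forall>j\<in>{1..chain_length L}. \<forall>s t.
        i < j \<and> lam ` (block L i \<inter> Ps) = {s} \<and> lam ` (block L j \<inter> Ps) = {t} \<longrightarrow> s < t)}"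

definition chain_dim :: "'p set \<Rightarrow> 'p set list \<Rightarrow> nat" where
  "chain_dim Ps L = card {i\<in>{1..chain_length L}. block L i \<inter> Ps = {}}"

definition marked_dim :: "'p::order set \<Rightarrow> ('p \<Rightarrow> real) \<Rightarrow> nat" where
  "marked_dim Ps lam = Max (chain_dim Ps ` admissible_chains Ps lam)"

lemma finite_admissible_chains:
  "finite (admissible_chains Ps (lam :: 'p::{finite,order} \<Rightarrow> real))"
proof -
  have "distinct L" if "L \<in> admissible_chains Ps lam" for L
  proof -
    have "L ! (i - 1) \<subset> L ! i" if "i \<in> {1..chain_length L}" for i
      using that \<open>L \<in> _\<close> by (auto simp: admissible_chains_def ideal_chain_def)
    then have "L ! i \<subset> L ! Suc i" if "Suc i < length L" for i
      using that by (force simp: chain_length_def)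
    then have "sorted_wrt (\<subset>) L"
      by (subst sorted_wrt_iff_nth_Suc_transp) (auto intro: transpI)
    then show ?thesis
      by (auto simp: distinct_conv_nth sorted_wrt_iff_nth_less)
         (metis nat_neq_iff psubset_eq)
  qed
  then have "admissible_chains Ps lam \<subseteq> {L. set L \<subseteq> UNIV \<and> distinct L}"
    by auto
  moreover have "finite {L. set L \<subseteq> (UNIV :: 'p set set) \<and> distinct L}"
    by (rule finite_subset_distinct) simp
  ultimately show ?thesis
    by (rule finite_subset)
qed

definition insert_ideal :: "'p set list \<Rightarrow> nat \<Rightarrow> 'p set \<Rightarrow> 'p set list" where
  "insert_ideal L k J = take k L @ J # drop k L"

text \<open>\<open>densifying Ps lam L k J\<close>: inserting \<open>J\<close> just below \<open>I\<^sub>k\<close> yields an \<open>I\<^sub>k\<close>-densification of \<open>L\<close>.\<close>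

definition densifying ::
    "'p::order set \<Rightarrow> ('p \<Rightarrow> real) \<Rightarrow> 'p set list \<Rightarrow> nat \<Rightarrow> 'p set \<Rightarrow> bool" where
  "densifying Ps lam L k J \<longleftrightarrow>
     L ! (k - 1) \<subset> J \<and> J \<subset> L ! k \<and> insert_ideal L k J \<in> admissible_chains Ps lam"

definition conjugate_ideals :: "'p set list \<Rightarrow> nat \<Rightarrow> 'p set \<Rightarrow> 'p set \<Rightarrow> bool" where
  "conjugate_ideals L k J' J'' \<longleftrightarrow>
     L ! k - J' = J'' - L ! (k - 1) \<and> J' - L ! (k - 1) = L ! k - J''"

definition conjugated_densifications ::
    "'p::order set \<Rightarrow> ('p \<Rightarrow> real) \<Rightarrow> 'p set list \<Rightarrow> nat \<Rightarrow> 'p set list set" where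
  "conjugated_densifications Ps lam L k =
     {insert_ideal L k J' | J'. densifying Ps lam L k J' \<and>
        (\<exists>J''. densifying Ps lam L k J'' \<and> conjugate_ideals L k J' J'')}"

text \<open>Formal linear combinations of chains are represented by their coefficient functions; there
  are only finitely many admissible chains.\<close>

definition Sigma_sum ::
    "'p::order set \<Rightarrow> ('p \<Rightarrow> real) \<Rightarrow> 'p set list \<Rightarrow> nat \<Rightarrow> 'p set list \<Rightarrow> bit" where
  "Sigma_sum Ps lam L k = (\<lambda>L'. if L' \<in> conjugated_densifications Ps lam L k then 1 else 0)"

definition marked_cochains ::
    "'p::order set \<Rightarrow> ('p \<Rightarrow> real) \<Rightarrow> nat \<Rightarrow> ('p set list \<Rightarrow> bit) set" where
  "marked_cochains Ps lam i =
     (if i \<le> marked_dim Ps lam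
      then {c. \<forall>L. c L \<noteq> 0 \<longrightarrow> L \<in> admissible_chains Ps lam \<and> chain_dim Ps L = i}
      else {\<lambda>L. 0})"

text \<open>The linear extension of \<open>L \<mapsto> \<Sigma>\<^sub>1(L) + \<dots> + \<Sigma>\<^sub>m(L)\<close>.\<close>

definition marked_coboundary ::
    "'p::order set \<Rightarrow> ('p \<Rightarrow> real) \<Rightarrow> nat \<Rightarrow> ('p set list \<Rightarrow> bit) \<Rightarrow> ('p set list \<Rightarrow> bit)" where
  "marked_coboundary Ps lam i c =
     (\<lambda>L'. \<Sum>L | L \<in> admissible_chains Ps lam \<and> chain_dim Ps L = i.
        c L * (\<Sum>k = 1..chain_length L. Sigma_sum Ps lam L k L'))"


section \<open>The marked order polytope and its subdivision\<close>

definition marked_order_polytope ::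
    "'p::{finite,order} set \<Rightarrow> ('p \<Rightarrow> real) \<Rightarrow> (real, 'p) vec set" where
  "marked_order_polytope Ps lam =
     {x. (\<forall>p q. p \<le> q \<longrightarrow> x $ p \<le> x $ q) \<and> (\<forall>a\<in>Ps. x $ a = lam a)}"

definition chain_polytope ::
    "'p::{finite,order} set \<Rightarrow> ('p \<Rightarrow> real) \<Rightarrow> 'p set list \<Rightarrow> (real, 'p) vec set" where
  "chain_polytope Ps lam L =
     {x. (\<forall>a\<in>Ps. x $ a = lam a) \<and>
         (\<forall>i\<in>{1..chain_length L}. \<forall>p\<in>block L i. \<forall>q\<in>block L i. x $ p = x $ q) \<and>
         (\<forall>i\<in>{1..<chain_length L}. \<forall>p\<in>block L i. \<forall>q\<in>block L (Suc i). x $ p \<le> x $ q)}"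

definition marked_subdivision ::
    "'p::{finite,order} set \<Rightarrow> ('p \<Rightarrow> real) \<Rightarrow> (real, 'p) vec set set" where
  "marked_subdivision Ps lam = chain_polytope Ps lam ` admissible_chains Ps lam"


section \<open>Cellular cochains of polytopal pairs and of subdivisions\<close>

text \<open>Let \<open>X\<close> be a finite polytopal complex with a subcomplex \<open>B\<close>, both given as sets of polytopes.
  \<open>pair_skeleton X B n\<close> is the union of the \<open>n\<close>-skeleton of \<open>X\<close> with the space underlying \<open>B\<close>; thus the
  cellular chain group \<open>C\<^sub>n(X, B)\<close> is \<open>H\<^sub>n(X\<^sup>n \<union> B, X\<^sup>n\<^sup>-\<^sup>1 \<union> B)\<close> in singular homology, the cellular boundary
  is the connecting map of the triple \<open>(X\<^sup>n \<union> B, X\<^sup>n\<^sup>-\<^sup>1 \<union> B, X\<^sup>n\<^sup>-\<^sup>2 \<union> B)\<close>, and the cellular cochain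
  complex over the two-element field is obtained by applying \<open>Hom(_, \<int>\<^sub>2)\<close>.\<close>

definition pair_skeleton :: "'a::euclidean_space set set \<Rightarrow> 'a set set \<Rightarrow> int \<Rightarrow> 'a set" where
  "pair_skeleton X B n = \<Union>{F\<in>X. aff_dim F \<le> n} \<union> \<Union>B"

definition cellular_chain_group ::
    "'a::euclidean_space set set \<Rightarrow> 'a set set \<Rightarrow> int \<Rightarrow> 'a chain set monoid" where
  "cellular_chain_group X B n =
     relative_homology_group n (top_of_set (pair_skeleton X B n)) (pair_skeleton X B (n - 1))"

definition cellular_boundary ::
    "'a::euclidean_space set set \<Rightarrow> 'a set set \<Rightarrow> int \<Rightarrow> 'a chain set \<Rightarrow> 'a chain set" where
  "cellular_boundary X B n =
     hom_relboundary n (top_of_set (pair_skeleton X B n))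
       (pair_skeleton X B (n - 1)) (pair_skeleton X B (n - 2))"

text \<open>Homomorphisms to \<^typ>\<open>bit\<close> are normalized to vanish outside the chain group, so that they form
  a function space under pointwise addition.\<close>

definition cellular_cochains ::
    "'a::euclidean_space set set \<Rightarrow> 'a set set \<Rightarrow> nat \<Rightarrow> ('a chain set \<Rightarrow> bit) set" where
  "cellular_cochains X B i =
     {f. (\<forall>z \<in> carrier (cellular_chain_group X B (int i)).
          \<forall>w \<in> carrier (cellular_chain_group X B (int i)).
            f (z \<otimes>\<^bsub>cellular_chain_group X B (int i)\<^esub> w) = f z + f w) \<and>
         (\<forall>z. z \<notin> carrier (cellular_chain_group X B (int i)) \<longrightarrow> f z = 0)}"

definition cellular_coboundary ::
    "'a::euclidean_space set set \<Rightarrow> 'a set set \<Rightarrow> nat \<Rightarrow> ('a chain set \<Rightarrow> bit) \<Rightarrow> ('a chain set \<Rightarrow> bit)" where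
  "cellular_coboundary X B i f =
     (\<lambda>z. if z \<in> carrier (cellular_chain_group X B (int (Suc i)))
          then f (cellular_boundary X B (int (Suc i)) z) else 0)"

definition cells_in_face :: "'a::euclidean_space set set \<Rightarrow> 'a set \<Rightarrow> 'a set set" where
  "cells_in_face K A = {F\<in>K. F \<subseteq> A}"

definition cells_in_boundary :: "'a::euclidean_space set set \<Rightarrow> 'a set \<Rightarrow> 'a set set" where
  "cells_in_boundary K A = {F\<in>K. F \<subseteq> rel_frontier A}"

text \<open>An element of the direct sum over the nonempty faces \<open>A\<close> of \<open>M\<close> (\<open>M\<close> itself included) is a function
  on pairs \<open>(A, z)\<close> whose \<open>A\<close>-component is \<open>\<lambda>z. c (A, z)\<close>. A polytope has only finitely many faces, so the
  direct sum is the full product.\<close>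

definition subdivision_cochains ::
    "'a::euclidean_space set \<Rightarrow> 'a set set \<Rightarrow> nat \<Rightarrow> ('a set \<times> 'a chain set \<Rightarrow> bit) set" where
  "subdivision_cochains M K i =
     {c. \<forall>A. if A face_of M \<and> A \<noteq> {}
             then (\<lambda>z. c (A, z)) \<in> cellular_cochains (cells_in_face K A) (cells_in_boundary K A) i
             else (\<forall>z. c (A, z) = 0)}"

definition subdivision_coboundary ::
    "'a::euclidean_space set \<Rightarrow> 'a set set \<Rightarrow> nat \<Rightarrow>
     ('a set \<times> 'a chain set \<Rightarrow> bit) \<Rightarrow> ('a set \<times> 'a chain set \<Rightarrow> bit)" where
  "subdivision_coboundary M K i c =
     (\<lambda>(A, z). if A face_of M \<and> A \<noteq> {}
               then cellular_coboundary (cells_in_face K A) (cells_in_boundary K A) i (\<lambda>w. c (A, w)) z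
               else 0)"

end

theory Submission
  imports Defs
begin

text \<open>
  A point \<open>x\<close> of the marked order polytope lies in the relative interior of exactly one cell, that of the
  chain of sublevel sets of \<open>x\<close>; so the cells of dimension \<open>i\<close> are indexed by the chains of dimension \<open>i\<close>.
  Each open cell lies in the relative interior of exactly one face, hence contributes one basis element
  to exactly one summand of the cellular complex, and there the coboundary of a cell \<open>G\<close> is the sum of the
  cells \<open>F\<close> containing \<open>G\<close> as a facet and belonging to the same face. Passing from \<open>L\<close> to \<open>F\<^sub>L\<close>, facet
  inclusions are densifications, and a densification stays in the same face iff from a relative interior
  point of the small cell one can move not only into the large cell but also a little in the opposite
  direction without leaving the polytope, which says that the conjugate set is an order ideal.

  The cellular homology is computed from the axioms. For a cell \<open>F\<close> with boundary \<open>\<partial>F\<close> and an interior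
  point \<open>x\<close>, excision identifies the homology of \<open>(F, \<partial>F)\<close> with the local homology at \<open>x\<close> of any skeleton
  in which \<open>F\<close> is a top-dimensional cell. Since \<open>\<partial>F\<close> minus a point is contractible, the connecting map
  from \<open>(F, \<partial>F)\<close> to the local homology of \<open>\<partial>F\<close> at a point of a facet is an isomorphism, so modulo two
  every incidence number of a facet is one.
\<close>

section \<open>Homology of pairs of subspaces\<close>

text \<open>The relative chain group is never split into a direct sum over cells. Two facts identify
  its dual: an additive map that vanishes on the images of all cell groups is zero, and the local
  homology at a center of a cell yields a functional that reads the coefficient of this cell and
  ignores the other cells of that dimension. All groups are compared by maps induced by inclusions
  or by connecting maps, so compatibility is functoriality and naturality, and neither orientations
  nor generators have to be matched. On the combinatorial side a chain is replaced by the total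
  preorder whose down-sets are its ideals. Refinement, admissibility and membership in a cell or in
  its relative interior then become comparisons between this preorder, the order of the marks and
  the order of the coordinates of a point.\<close>

text \<open>In an infinite cyclic group this is the parity of the exponent. Phrased through squares it needs no
  choice of a generator and is visibly invariant under isomorphisms.\<close>

definition Z2_parity :: "('g, 'm) monoid_scheme \<Rightarrow> 'g \<Rightarrow> bit" where
  "Z2_parity G z = (if \<exists>w\<in>carrier G. z = w \<otimes>\<^bsub>G\<^esub> w then 0 else 1)"

definition Z2_additive :: "('g, 'm) monoid_scheme \<Rightarrow> ('g \<Rightarrow> bit) \<Rightarrow> bool" where
  "Z2_additive G f \<longleftrightarrow> (\<forall>z\<in>carrier G. \<forall>w\<in>carrier G. f (z \<otimes>\<^bsub>G\<^esub> w) = f z + f w)"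

section \<open>Additive maps to the two-element field and parity\<close>

lemma bit_add_self [simp]: "(a::bit) + a = 0"
  by (cases a) auto

lemma Z2_additive_one:
  assumes "group G" "Z2_additive G f" shows "f \<one>\<^bsub>G\<^esub> = 0"
proof -
  interpret group G by fact
  have "f (\<one>\<^bsub>G\<^esub> \<otimes>\<^bsub>G\<^esub> \<one>\<^bsub>G\<^esub>) = f \<one>\<^bsub>G\<^esub> + f \<one>\<^bsub>G\<^esub>"
    using assms(2) unfolding Z2_additive_def by blast
  then show ?thesis by simp
qed

lemma Z2_additive_compose:
  assumes "Z2_additive K f" "h \<in> hom G K" shows "Z2_additive G (f \<circ> h)"
  using assms unfolding Z2_additive_def by (auto simp: hom_def Pi_iff)

lemma Z2_parity_one [simp]: "group G \<Longrightarrow> Z2_parity G \<one>\<^bsub>G\<^esub> = 0"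
  unfolding Z2_parity_def by (metis group.is_monoid monoid.l_one monoid.one_closed)

lemma Z2_parity_iso:
  assumes "group G" "group K" "h \<in> iso G K" "z \<in> carrier G"
  shows "Z2_parity K (h z) = Z2_parity G z"
proof -
  interpret group G by fact
  have h: "h \<in> hom G K" and bij: "bij_betw h (carrier G) (carrier K)"
    using assms(3) by (auto simp: iso_def)
  have "(\<exists>w\<in>carrier K. h z = w \<otimes>\<^bsub>K\<^esub> w) \<longleftrightarrow> (\<exists>w\<in>carrier G. z = w \<otimes>\<^bsub>G\<^esub> w)" (is "?l \<longleftrightarrow> ?r")
  proof
    assume ?l
    then obtain w where w: "w \<in> carrier K" "h z = w \<otimes>\<^bsub>K\<^esub> w" by blast
    then obtain v where v: "v \<in> carrier G" "w = h v"
      using bij by (auto simp: bij_betw_def)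
    then have "h z = h (v \<otimes>\<^bsub>G\<^esub> v)" using w h by (simp add: hom_mult)
    then have "z = v \<otimes>\<^bsub>G\<^esub> v"
      using bij v assms(4) by (auto simp: bij_betw_def inj_on_def)
    then show ?r using v by blast
  next
    assume ?r
    then show ?l using h by (metis hom_in_carrier hom_mult)
  qed
  then show ?thesis by (simp add: Z2_parity_def)
qed

lemma integer_group_parity:
  "Z2_parity integer_group k = of_bool (odd k)"
  by (auto simp: Z2_parity_def integer_group_def elim!: evenE)

lemma Z2_parity_additive:
  assumes "group G" "G \<cong> integer_group"
  shows "Z2_additive G (Z2_parity G)"
proof -
  obtain h where h: "h \<in> iso G integer_group" using assms by (auto simp: is_iso_def)
  have eq: "Z2_parity G z = of_bool (odd (h z))" if "z \<in> carrier G" for z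
    using Z2_parity_iso[OF assms(1) _ h that] by (simp add: integer_group_parity)
  show ?thesis
    unfolding Z2_additive_def
  proof (intro ballI)
    fix z w assume zw: "z \<in> carrier G" "w \<in> carrier G"
    then have "h (z \<otimes>\<^bsub>G\<^esub> w) = h z + h w"
      using h by (auto simp: iso_def hom_def)
    then show "Z2_parity G (z \<otimes>\<^bsub>G\<^esub> w) = Z2_parity G z + Z2_parity G w"
      using zw assms(1) by (simp add: eq group.is_monoid monoid.m_closed)
  qed
qed

text \<open>Additive maps to \<open>bit\<close> kill doubles, so on an infinite cyclic group they
  form a line spanned by the parity. This is why a cochain carries exactly one bit per cell.\<close>

lemma infinite_cyclic_generator:
  assumes "group G" "G \<cong> integer_group"
  obtains g where "g \<in> carrier G" "Z2_parity G g = 1"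
    "\<And>f z. Z2_additive G f \<Longrightarrow> z \<in> carrier G \<Longrightarrow> f z = f g * Z2_parity G z"
proof -
  interpret group G by fact
  obtain h where h: "h \<in> iso integer_group G"
    using assms iso_set_sym by (auto simp: is_iso_def)
  have hm: "h (a + b) = h a \<otimes>\<^bsub>G\<^esub> h b" for a b
    using h by (auto simp: iso_def hom_def)
  have hc: "h a \<in> carrier G" for a
    using h by (auto simp: iso_def hom_def)
  have p: "Z2_parity G (h k) = of_bool (odd k)" for k
    using Z2_parity_iso[OF _ assms(1) h, of k] by (simp add: integer_group_parity)
  have "f z = f (h 1) * Z2_parity G z" if f: "Z2_additive G f" and z: "z \<in> carrier G" for f z
  proof -
    obtain k where k: "z = h k" using h z by (auto simp: iso_def bij_betw_def)
    have fa: "f (h (a + b)) = f (h a) + f (h b)" for a b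
      using f hc by (auto simp: hm Z2_additive_def)
    show ?thesis
    proof (cases "even k")
      case True
      then obtain b where "k = b + b" by (metis evenE mult_2)
      then show ?thesis using True fa[of b b] by (simp add: p k)
    next
      case False
      then obtain b where "k = 1 + (b + b)" by (metis oddE mult_2 add.commute)
      then show ?thesis using False fa[of 1 "b + b"] fa[of b b] by (simp add: p k)
    qed
  qed
  with that[of "h 1"] p[of 1] hc show ?thesis by auto
qed

section \<open>Pairs and triples of subspaces, exactness and excision\<close>

definition subspace_homology :: "int \<Rightarrow> 'a::topological_space set \<Rightarrow> 'a set \<Rightarrow> 'a chain set monoid" where
  "subspace_homology p S A = relative_homology_group p (top_of_set S) A"

text \<open>These wrappers hide nested subtopologies. Since only inclusions induce maps below, every
  triangle of such maps commutes by \<open>inclusion_map_compose\<close>.\<close>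

definition inclusion_map ::
    "int \<Rightarrow> 'a::topological_space set \<Rightarrow> 'a set \<Rightarrow> 'a set \<Rightarrow> 'a set \<Rightarrow> 'a chain set \<Rightarrow> 'a chain set" where
  "inclusion_map p S A T B = hom_induced p (top_of_set S) A (top_of_set T) B id"

definition triple_boundary ::
    "int \<Rightarrow> 'a::topological_space set \<Rightarrow> 'a set \<Rightarrow> 'a set \<Rightarrow> 'a chain set \<Rightarrow> 'a chain set" where
  "triple_boundary p S B A = hom_relboundary p (top_of_set S) B A"

lemma top_of_set_subset: "B \<subseteq> S \<Longrightarrow> subtopology (top_of_set S) B = top_of_set B"
  by (simp add: subtopology_subtopology inf_absorb2)

lemma group_subspace_homology [simp]: "group (subspace_homology p S A)"
  by (simp add: subspace_homology_def)

lemma inclusion_map_hom [simp]: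
  "inclusion_map p S A T B \<in> hom (subspace_homology p S A) (subspace_homology p T B)"
  by (simp add: inclusion_map_def subspace_homology_def hom_induced_hom)

lemma inclusion_map_carrier [simp]: "inclusion_map p S A T B z \<in> carrier (subspace_homology p T B)"
  by (simp add: inclusion_map_def subspace_homology_def hom_induced_carrier)

lemma inclusion_map_compose:
  assumes "S \<subseteq> T" "A \<subseteq> B" "T \<subseteq> U" "B \<subseteq> C"
  shows "inclusion_map p T B U C (inclusion_map p S A T B z) = inclusion_map p S A U C z"
  unfolding inclusion_map_def
  by (subst hom_induced_compose') (use assms in \<open>auto simp: Pi_iff\<close>)

lemma triple_boundary_hom:
  assumes "B \<subseteq> S"
  shows "triple_boundary p S B A \<in> hom (subspace_homology p S B) (subspace_homology (p - 1) B A)"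
  using group_homomorphism_hom_relboundary[of p "top_of_set S" B A]
  by (simp add: triple_boundary_def subspace_homology_def top_of_set_subset[OF assms])

lemma triple_boundary_natural:
  assumes "S \<subseteq> T" "B \<subseteq> C" "A \<subseteq> D" "B \<subseteq> S" "C \<subseteq> T"
  shows "triple_boundary p T C D (inclusion_map p S B T C z)
       = inclusion_map (p - 1) B A C D (triple_boundary p S B A z)"
proof -
  have "hom_relboundary p (top_of_set T) C D \<circ> hom_induced p (top_of_set S) B (top_of_set T) C id =
     hom_induced (p-1) (subtopology (top_of_set S) B) A (subtopology (top_of_set T) C) D id \<circ>
         hom_relboundary p (top_of_set S) B A"
    by (rule naturality_hom_induced_relboundary) (use assms in \<open>auto simp: id_def Pi_iff\<close>)
  then show ?thesis
    using assms by (simp add: triple_boundary_def inclusion_map_def top_of_set_subset o_def fun_eq_iff)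
qed

text \<open>Connecting maps with different third sets all factor through the one with third set
  \<open>{}\<close>. This allows boundaries taken relative to different subspaces to be
  compared.\<close>

lemma triple_boundary_empty:
  assumes "B \<subseteq> S"
  shows "triple_boundary p S B A z = inclusion_map (p - 1) B {} B A (triple_boundary p S B {} z)"
  using assms
  by (simp add: triple_boundary_def inclusion_map_def top_of_set_subset hom_relboundary_empty)
     (simp add: hom_relboundary_def top_of_set_subset)

lemma triple_exact_1:
  assumes "A \<subseteq> B" "B \<subseteq> S"
  shows "kernel (subspace_homology p S B) (subspace_homology (p - 1) B A) (triple_boundary p S B A)
       = inclusion_map p S A S B ` carrier (subspace_homology p S A)"
  using homology_exactness_triple_1[OF assms(1), of p "top_of_set S"]
  by (simp add: subspace_homology_def triple_boundary_def inclusion_map_def top_of_set_subset[OF assms(2)])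

lemma triple_exact_2:
  assumes "A \<subseteq> B" "B \<subseteq> S"
  shows "kernel (subspace_homology (p - 1) B A) (subspace_homology (p - 1) S A) (inclusion_map (p - 1) B A S A)
       = triple_boundary p S B A ` carrier (subspace_homology p S B)"
  using homology_exactness_triple_2[OF assms(1), of p "top_of_set S"]
  by (simp add: subspace_homology_def triple_boundary_def inclusion_map_def top_of_set_subset[OF assms(2)])

lemma triple_exact_3:
  assumes "A \<subseteq> B" "B \<subseteq> S"
  shows "kernel (subspace_homology p S A) (subspace_homology p S B) (inclusion_map p S A S B)
       = inclusion_map p B A S A ` carrier (subspace_homology p B A)"
  using homology_exactness_triple_3[OF assms(1), of p "top_of_set S"]
  by (simp add: subspace_homology_def triple_boundary_def inclusion_map_def top_of_set_subset[OF assms(2)])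

lemma iso_if_kernel_range:
  assumes "group G" "group K" "h \<in> hom G K" "kernel G K h \<subseteq> {\<one>\<^bsub>G\<^esub>}" "carrier K \<subseteq> h ` carrier G"
  shows "h \<in> iso G K"
proof -
  interpret group_hom G K h
    using assms by (simp add: group_hom_def group_hom_axioms_def)
  have "kernel G K h = {\<one>\<^bsub>G\<^esub>}"
    using assms(4) by (auto simp: kernel_def)
  then show ?thesis using assms(5) by (auto intro!: iso_kernel_image[THEN iffD2])
qed

lemma hom_trivial_image:
  assumes "group K" "group G" "h \<in> hom G K" "trivial_group G"
  shows "h ` carrier G = {\<one>\<^bsub>K\<^esub>}"
  using assms by (simp add: trivial_group_def hom_one)

text \<open>In the long exact sequence of the triple this map stands between the homology of
  \<open>(B, A)\<close> in degrees \<open>p\<close> and \<open>p - 1\<close>.\<close>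

lemma inclusion_iso_if_trivial:
  assumes "A \<subseteq> B" "B \<subseteq> S" "\<And>p. trivial_group (subspace_homology p B A)"
  shows "inclusion_map p S A S B \<in> iso (subspace_homology p S A) (subspace_homology p S B)"
proof (rule iso_if_kernel_range)
  show "kernel (subspace_homology p S A) (subspace_homology p S B) (inclusion_map p S A S B)
    \<subseteq> {\<one>\<^bsub>subspace_homology p S A\<^esub>}"
    using hom_trivial_image[OF _ _ inclusion_map_hom assms(3)] triple_exact_3[OF assms(1,2)] by simp
  have "kernel (subspace_homology p S B) (subspace_homology (p - 1) B A) (triple_boundary p S B A)
    = carrier (subspace_homology p S B)"
    using triple_boundary_hom[OF assms(2), of p A] assms(3)[of "p - 1"]
    by (fastforce simp: kernel_def trivial_group_def hom_def Pi_iff)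
  then show "carrier (subspace_homology p S B) \<subseteq> inclusion_map p S A S B ` carrier (subspace_homology p S A)"
    using triple_exact_1[OF assms(1,2)] by simp
qed auto

text \<open>Here the vanishing neighbours are the homology groups of \<open>(S, A)\<close> in
  degrees \<open>p\<close> and \<open>p - 1\<close>.\<close>

lemma triple_boundary_iso_if_trivial:
  assumes "A \<subseteq> B" "B \<subseteq> S" "\<And>p. trivial_group (subspace_homology p S A)"
  shows "triple_boundary p S B A \<in> iso (subspace_homology p S B) (subspace_homology (p - 1) B A)"
proof (rule iso_if_kernel_range)
  show "kernel (subspace_homology p S B) (subspace_homology (p - 1) B A) (triple_boundary p S B A)
    \<subseteq> {\<one>\<^bsub>subspace_homology p S B\<^esub>}"
    using hom_trivial_image[OF _ _ inclusion_map_hom assms(3)] triple_exact_1[OF assms(1,2)] by simp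
  have "kernel (subspace_homology (p-1) B A) (subspace_homology (p - 1) S A) (inclusion_map (p-1) B A S A)
    = carrier (subspace_homology (p-1) B A)"
    using inclusion_map_hom[of "p-1" B A S A] assms(3)[of "p - 1"]
    by (fastforce simp: kernel_def trivial_group_def hom_def Pi_iff)
  then show "carrier (subspace_homology (p - 1) B A) \<subseteq> triple_boundary p S B A ` carrier (subspace_homology p S B)"
    using triple_exact_2[OF assms(1,2)] by simp
qed (auto simp: triple_boundary_hom assms(2))

lemma excision_iso:
  assumes "U \<subseteq> B" "B \<subseteq> S" "closedin (top_of_set S) U" "openin (top_of_set S) B"
  shows "inclusion_map p (S - U) (B - U) S B \<in> iso (subspace_homology p (S - U) (B - U)) (subspace_homology p S B)"
proof -
  have "top_of_set S closure_of U \<subseteq> top_of_set S interior_of B"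
    using assms by (simp add: closure_of_closedin interior_of_openin)
  from homology_excision_axiom[OF this assms(2), of p]
  show ?thesis
    by (simp add: inclusion_map_def subspace_homology_def top_of_set_subset)
qed

lemma trivial_homology_if_deformation:
  assumes "A \<subseteq> S" "continuous_on S f" "f ` S \<subseteq> A"
    "homotopic_with_canon (\<lambda>h. True) A A f id" "homotopic_with_canon (\<lambda>h. True) S S f id"
  shows "trivial_group (subspace_homology p S A)"
  unfolding subspace_homology_def
  by (rule trivial_relative_homology_group_gen[of _ _ f])
     (use assms in \<open>auto simp: top_of_set_subset\<close>)

lemma trivial_homology_self: "trivial_group (subspace_homology p S S)"
  using trivial_relative_homology_group_topspace[of p "top_of_set S"]
  by (simp add: subspace_homology_def)

lemma trivial_homology_contractible_pair:
  fixes S :: "'a::real_normed_vector set"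
  assumes "A \<subseteq> S" "A \<noteq> {}" "contractible A" "contractible S"
  shows "trivial_group (subspace_homology p S A)"
proof -
  obtain c where c: "c \<in> A" using assms by auto
  show ?thesis
  proof (rule trivial_homology_if_deformation[of _ _ "\<lambda>_. c"])
    show "homotopic_with_canon (\<lambda>h. True) A A (\<lambda>_. c) id"
      using assms c by (intro homotopic_into_contractible) (auto simp: id_def)
    show "homotopic_with_canon (\<lambda>h. True) S S (\<lambda>_. c) id"
      using assms c by (intro homotopic_into_contractible) (auto simp: id_def)
  qed (use assms c in auto)
qed

section \<open>Homology of convex cells\<close>

text \<open>Each point is pushed away from \<open>x\<close> along its ray until it reaches the
  relative frontier. The direction map is a continuous injection on this compact set, so it has a
  continuous inverse there. The last conclusion is what makes the straight-line homotopy to the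
  retraction avoid the puncture.\<close>

lemma radial_retraction:
  fixes F :: "'a::euclidean_space set"
  assumes F: "convex F" "compact F" and x: "x \<in> rel_interior F"
  obtains r where "continuous_on (F - {x}) r" "\<And>y. y \<in> F - {x} \<Longrightarrow> r y \<in> rel_frontier F"
    "\<And>y. y \<in> rel_frontier F \<Longrightarrow> r y = y"
    "\<And>y. y \<in> F - {x} \<Longrightarrow> x \<notin> closed_segment y (r y)"
proof -
  define \<rho> where "\<rho> y = (y - x) /\<^sub>R norm (y - x)" for y
  have clF: "closure F = F" using F compact_imp_closed closure_closed by blast
  have frF: "rel_frontier F \<subseteq> F - {x}" using x by (auto simp: rel_frontier_def clF)
  have cont: "continuous_on (- {x}) \<rho>"
    unfolding \<rho>_def by (intro continuous_intros) auto
  have inj: "inj_on \<rho> (rel_frontier F)"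
  proof (rule inj_onI)
    \<comment> \<open>Of two frontier points on one ray, the nearer one is the farther one shrunk
      towards the interior point \<open>x\<close>, hence would be interior. The factor
      \<open>t\<close> is the one with \<open>u = v - t *\<^sub>R (v - x)\<close>.\<close>
    have *: False if u: "u \<in> rel_frontier F" and v: "v \<in> rel_frontier F" and eq: "\<rho> u = \<rho> v"
      and less: "norm (u - x) < norm (v - x)" for u v
    proof -
      have un: "norm (u - x) > 0" using u frF by auto
      define t where "t = 1 - norm (u - x) / norm (v - x)"
      have t: "0 < t" "t < 1" using un less order.strict_trans[OF un less] by (simp_all add: t_def)
      have "u - x = norm (u - x) *\<^sub>R \<rho> v"
        unfolding eq[symmetric] using un by (simp add: \<rho>_def)
      also have "\<dots> = (1 - t) *\<^sub>R (v - x)" by (simp add: \<rho>_def t_def divide_inverse)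
      finally have "u = v - t *\<^sub>R (v - x)" by (simp add: algebra_simps)
      moreover have "v - t *\<^sub>R (v - x) \<in> rel_interior F"
        by (rule rel_interior_closure_convex_shrink) (use F x v t in \<open>auto simp: rel_frontier_def\<close>)
      ultimately show False using u by (simp add: rel_frontier_def)
    qed
    fix u v assume uv: "u \<in> rel_frontier F" "v \<in> rel_frontier F" "\<rho> u = \<rho> v"
    then have n: "norm (u - x) = norm (v - x)"
      using *[of u v] *[of v u] by (metis linorder_neqE_linordered_idom)
    moreover have "norm (u - x) \<noteq> 0" using uv frF by auto
    ultimately show "u = v" using uv(3) by (simp add: \<rho>_def)
  qed
  have surj: "\<exists>v\<in>rel_frontier F. \<rho> v = \<rho> y" if y: "y \<in> F - {x}" for y
  proof -
    have "bounded F" using F compact_imp_bounded by blast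
    moreover have "x + (y - x) \<in> affine hull F" using y hull_subset by fastforce
    ultimately obtain d where d: "0 < d" "x + d *\<^sub>R (y - x) \<in> rel_frontier F"
      using x y ray_to_rel_frontier by (metis Diff_iff eq_iff_diff_eq_0 singletonI)
    moreover have "\<rho> (x + d *\<^sub>R (y - x)) = \<rho> y" using d by (simp add: \<rho>_def)
    ultimately show ?thesis by blast
  qed
  define r where "r = the_inv_into (rel_frontier F) \<rho> \<circ> \<rho>"
  have rin: "r y \<in> rel_frontier F" "\<rho> (r y) = \<rho> y" if "y \<in> F - {x}" for y
    using surj[OF that] inj unfolding r_def
    by (auto simp: the_inv_into_f_f dest: sym)
  show ?thesis
  proof
    have comp: "compact (rel_frontier F)"
      by (simp add: F compact_imp_bounded compact_rel_frontier_bounded)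
    have "continuous_on (\<rho> ` rel_frontier F) (the_inv_into (rel_frontier F) \<rho>)"
      by (rule continuous_on_inv[OF _ comp])
         (use frF inj in \<open>auto intro: continuous_on_subset[OF cont] simp: the_inv_into_f_f\<close>)
    moreover have "\<rho> ` (F - {x}) \<subseteq> \<rho> ` rel_frontier F"
      using rin by (metis image_eqI image_subsetI)
    ultimately have "continuous_on (\<rho> ` (F - {x})) (the_inv_into (rel_frontier F) \<rho>)"
      by (rule continuous_on_subset)
    moreover have "continuous_on (F - {x}) \<rho>"
      by (rule continuous_on_subset[OF cont]) auto
    ultimately show "continuous_on (F - {x}) r"
      unfolding r_def by (intro continuous_on_compose)
    show "r y = y" if "y \<in> rel_frontier F" for y
      using that inj by (simp add: r_def the_inv_into_f_f)
    show "x \<notin> closed_segment y (r y)" if y: "y \<in> F - {x}" for y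
    proof
      assume "x \<in> closed_segment y (r y)"
      then obtain u where u: "0 \<le> u" "u \<le> 1" "x = (1 - u) *\<^sub>R y + u *\<^sub>R r y"
        by (auto simp: in_segment)
      have ny: "norm (y - x) > 0" "norm (r y - x) > 0" using y rin[OF y] frF by auto
      have e1: "y - x = norm (y - x) *\<^sub>R \<rho> y" using ny by (simp add: \<rho>_def)
      have e2: "r y - x = norm (r y - x) *\<^sub>R \<rho> y" using ny unfolding rin(2)[OF y, symmetric] by (simp add: \<rho>_def)
      \<comment> \<open>Both offsets from \<open>x\<close> are positive multiples of the same unit
        vector, so no convex combination of them vanishes.\<close>
      have "0 = (1 - u) *\<^sub>R (y - x) + u *\<^sub>R (r y - x)" using u(3) by (simp add: algebra_simps)
      also have "\<dots> = ((1 - u) * norm (y - x) + u * norm (r y - x)) *\<^sub>R \<rho> y"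
        by (subst e1, subst e2) (simp add: algebra_simps)
      finally have "(1 - u) * norm (y - x) + u * norm (r y - x) = 0"
        using ny by (auto simp: \<rho>_def)
      moreover have "(1 - u) * norm (y - x) + u * norm (r y - x) > 0"
        using ny u by (cases "u = 0") (auto intro!: add_nonneg_pos)
      ultimately show False by simp
    qed
  qed (use rin in auto)
qed

text \<open>The radial retraction of the punctured cell, extended by the identity on
  \<open>Y\<close>, deforms the whole space onto \<open>Y\<close> along straight segments.\<close>

lemma trivial_homology_punctured_cell:
  fixes F :: "'a::euclidean_space set"
  assumes F: "convex F" "compact F" and x: "x \<in> rel_interior F"
    and Y: "closed Y" "rel_frontier F \<subseteq> Y" "Y \<inter> rel_interior F = {}"
  shows "trivial_group (subspace_homology p (Y \<union> F - {x}) Y)"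
proof -
  obtain r where r: "continuous_on (F - {x}) r" "\<And>y. y \<in> F - {x} \<Longrightarrow> r y \<in> rel_frontier F"
    "\<And>y. y \<in> rel_frontier F \<Longrightarrow> r y = y"
    "\<And>y. y \<in> F - {x} \<Longrightarrow> x \<notin> closed_segment y (r y)"
    using radial_retraction[OF F x] by metis
  have clF: "closure F = F" using F compact_imp_closed closure_closed by blast
  have YF: "Y \<inter> F \<subseteq> rel_frontier F" using Y by (auto simp: rel_frontier_def clF)
  have frF: "rel_frontier F \<subseteq> F" by (auto simp: rel_frontier_def clF)
  have xY: "x \<notin> Y" using x Y by auto
  define f where "f y = (if y \<in> Y then y else r y)" for y
  have S: "Y \<union> F - {x} = Y \<union> (F - {x})" using xY by auto
  have fr: "f y = r y" if "y \<in> F - {x}" for y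
    using that r(3) YF by (auto simp: f_def)
  \<comment> \<open>The two pieces are relatively closed and overlap only in the relative frontier,
    where the retraction is the identity, so they paste to a continuous map.\<close>
  have "closedin (top_of_set (Y \<union> (F - {x}))) Y"
    using Y(1) by (simp add: closedin_closed_Int[of Y] closed_subset)
  moreover have "closedin (top_of_set (Y \<union> (F - {x}))) (F - {x})"
    using closedin_closed_Int[of F "Y \<union> (F - {x})"] F xY compact_imp_closed
    by (metis (no_types, lifting) Diff_insert_absorb Int_Diff S Un_Int_eq(4) inf_commute)
  ultimately have cf: "continuous_on (Y \<union> (F - {x})) f"
    unfolding f_def using r(1,3) YF
    by (intro continuous_on_cases_local) (auto intro: continuous_on_id)
  show ?thesis
  proof (rule trivial_homology_if_deformation[of _ _ f])
    show "Y \<subseteq> Y \<union> F - {x}" using xY by auto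
    show "continuous_on (Y \<union> F - {x}) f" using cf S by simp
    show "f ` (Y \<union> F - {x}) \<subseteq> Y" using r(2) Y(2) by (auto simp: f_def)
    show "homotopic_with_canon (\<lambda>h. True) Y Y f id"
      by (rule homotopic_with_equal) (auto simp: f_def)
    show "homotopic_with_canon (\<lambda>h. True) (Y \<union> F - {x}) (Y \<union> F - {x}) f id"
    proof (rule homotopic_with_linear)
      show "closed_segment (f y) (id y) \<subseteq> Y \<union> F - {x}" if y: "y \<in> Y \<union> F - {x}" for y
      proof (cases "y \<in> Y")
        case True
        then show ?thesis using y by (auto simp: f_def)
      next
        case False
        then have y': "y \<in> F - {x}" using y by auto
        then have "closed_segment y (r y) \<subseteq> F"
          using F(1) r(2) frF by (meson DiffD1 closed_segment_subset subsetD)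
        then show ?thesis using r(4)[OF y'] fr[OF y'] by (auto simp: closed_segment_commute)
      qed
    qed (use cf S in \<open>auto simp: continuous_on_id\<close>)
  qed
qed

lemma isoI_if_compose_iso:
  assumes "f \<in> hom G K" "g \<in> iso K L" "\<And>z. z \<in> carrier G \<Longrightarrow> g (f z) = h z" "h \<in> iso G L"
  shows "f \<in> iso G K"
proof -
  have g: "bij_betw g (carrier K) (carrier L)" and h: "bij_betw h (carrier G) (carrier L)"
    using assms by (auto simp: iso_def)
  have "f ` carrier G \<subseteq> carrier K" using assms(1) by (auto simp: hom_def)
  then have "bij_betw f (carrier G) (carrier K)"
    using g h assms(3) bij_betw_comp_iff2[of g "carrier K" "carrier L" f "carrier G"]
    by (auto simp: o_def cong: bij_betw_cong)
  with assms(1) show ?thesis by (simp add: iso_def)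
qed

lemma isoI_if_precompose_iso:
  assumes "f \<in> iso G K" "g \<in> hom K L" "\<And>z. z \<in> carrier G \<Longrightarrow> g (f z) = h z" "h \<in> iso G L"
  shows "g \<in> iso K L"
proof -
  have f: "bij_betw f (carrier G) (carrier K)" and h: "bij_betw h (carrier G) (carrier L)"
    using assms by (auto simp: iso_def)
  then have "bij_betw g (carrier K) (carrier L)"
    using assms(3) bij_betw_comp_iff[OF f, of g "carrier L"]
    by (auto simp: o_def cong: bij_betw_cong)
  with assms(2) show ?thesis by (simp add: iso_def)
qed

lemma iso_compose_cong:
  assumes "f \<in> iso G K" "g \<in> iso K L" "\<And>z. z \<in> carrier G \<Longrightarrow> g (f z) = h z" "group G" "group L" "h \<in> hom G L"
  shows "h \<in> iso G L"
proof -
  have "bij_betw (g \<circ> f) (carrier G) (carrier L)"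
    using assms by (auto simp: iso_def intro: bij_betw_trans)
  then have "bij_betw h (carrier G) (carrier L)"
    using assms(3) by (auto simp: o_def cong: bij_betw_cong)
  with assms(6) show ?thesis by (simp add: iso_def)
qed

text \<open>Excision shows that the local homology at \<open>x\<close> depends only on the relative
  interior of \<open>G\<close>; within \<open>G\<close>, the radial retraction of
  \<open>G - {x}\<close> replaces the punctured cell by the relative frontier.\<close>

lemma local_homology_cell:
  fixes G :: "'a::euclidean_space set"
  assumes G: "convex G" "compact G" and x: "x \<in> rel_interior G"
    and Y: "closed Y" "Y \<inter> rel_interior G = {}"
  shows "inclusion_map p G (rel_frontier G) (Y \<union> G) (Y \<union> G - {x})
     \<in> iso (subspace_homology p G (rel_frontier G)) (subspace_homology p (Y \<union> G) (Y \<union> G - {x}))"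
proof -
  have clG: "closure G = G" using G compact_imp_closed closure_closed by blast
  have frG: "rel_frontier G \<subseteq> G" "closed (rel_frontier G)" "rel_frontier G \<inter> rel_interior G = {}"
    using compact_imp_closed[OF compact_rel_frontier_bounded[of G]] compact_imp_bounded[OF G(2)]
    by (auto simp: rel_frontier_def clG)
  have GI: "G - rel_frontier G = rel_interior G"
    using rel_interior_subset[of G] by (auto simp: rel_frontier_def clG)
  have xG: "x \<in> G" using x rel_interior_subset by auto
  \<comment> \<open>Excising \<open>Z\<close> together with the relative frontier. It is used for
    \<open>Z = {}\<close> and for \<open>Z = Y\<close>; comparing the two instances gives the
    isomorphism from the local homology of \<open>G\<close> to that of
    \<open>Y \<union> G\<close>.\<close>
  have *: "inclusion_map p (rel_interior G) (rel_interior G - {x}) (Z \<union> G) (Z \<union> G - {x})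
     \<in> iso (subspace_homology p (rel_interior G) (rel_interior G - {x}))
           (subspace_homology p (Z \<union> G) (Z \<union> G - {x}))"
    if Z: "closed Z" "Z \<inter> rel_interior G = {}" for Z
  proof -
    let ?U = "Z \<union> rel_frontier G"
    have U: "Z \<union> G - ?U = rel_interior G" "Z \<union> G - {x} - ?U = rel_interior G - {x}"
      using Z GI by auto
    have "inclusion_map p (Z \<union> G - ?U) (Z \<union> G - {x} - ?U) (Z \<union> G) (Z \<union> G - {x})
     \<in> iso (subspace_homology p (Z \<union> G - ?U) (Z \<union> G - {x} - ?U)) (subspace_homology p (Z \<union> G) (Z \<union> G - {x}))"
    proof (rule excision_iso)
      show "?U \<subseteq> Z \<union> G - {x}" using Z frG x by auto
      show "closedin (top_of_set (Z \<union> G)) ?U"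
        using Z frG by (intro closed_subset) auto
      show "openin (top_of_set (Z \<union> G)) (Z \<union> G - {x})"
        by (simp add: openin_delete)
    qed auto
    then show ?thesis by (simp add: U)
  qed
  have 1: "inclusion_map p G (G - {x}) (Y \<union> G) (Y \<union> G - {x})
     \<in> iso (subspace_homology p G (G - {x})) (subspace_homology p (Y \<union> G) (Y \<union> G - {x}))"
  proof (rule isoI_if_precompose_iso[OF *[of "{}", simplified] _ _ *[OF Y]])
    show "inclusion_map p G (G - {x}) (Y \<union> G) (Y \<union> G - {x})
        (inclusion_map p (rel_interior G) (rel_interior G - {x}) G (G - {x}) z)
      = inclusion_map p (rel_interior G) (rel_interior G - {x}) (Y \<union> G) (Y \<union> G - {x}) z" for z
      by (rule inclusion_map_compose) (use rel_interior_subset[of G] in auto)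
  qed simp
  have 2: "inclusion_map p G (rel_frontier G) G (G - {x})
     \<in> iso (subspace_homology p G (rel_frontier G)) (subspace_homology p G (G - {x}))"
  proof (rule inclusion_iso_if_trivial)
    have "rel_frontier G \<union> G - {x} = G - {x}" using frG by auto
    then show "trivial_group (subspace_homology p (G - {x}) (rel_frontier G))" for p
      using trivial_homology_punctured_cell[OF G x frG(2) subset_refl frG(3)] by simp
  qed (use frG x in auto)
  show ?thesis
  proof (rule iso_compose_cong[OF 2 1])
    show "inclusion_map p G (G - {x}) (Y \<union> G) (Y \<union> G - {x}) (inclusion_map p G (rel_frontier G) G (G - {x}) z)
      = inclusion_map p G (rel_frontier G) (Y \<union> G) (Y \<union> G - {x}) z" for z
      by (rule inclusion_map_compose) (use frG x in auto)
  qed simp_all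
qed

text \<open>Both groups map isomorphically onto the local homology of \<open>Y \<union> F\<close> at
  an interior point of \<open>F\<close>, and the triangle of inclusions commutes.\<close>

lemma cell_attachment_homology:
  fixes F :: "'a::euclidean_space set"
  assumes F: "convex F" "compact F" "F \<noteq> {}"
    and Y: "closed Y" "rel_frontier F \<subseteq> Y" "Y \<inter> rel_interior F = {}"
  shows "inclusion_map p F (rel_frontier F) (Y \<union> F) Y
     \<in> iso (subspace_homology p F (rel_frontier F)) (subspace_homology p (Y \<union> F) Y)"
proof -
  obtain x where x: "x \<in> rel_interior F" using F rel_interior_eq_empty by auto
  have xY: "x \<notin> Y" using x Y by auto
  have 1: "inclusion_map p (Y \<union> F) Y (Y \<union> F) (Y \<union> F - {x})
    \<in> iso (subspace_homology p (Y \<union> F) Y) (subspace_homology p (Y \<union> F) (Y \<union> F - {x}))"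
    by (rule inclusion_iso_if_trivial)
       (use xY trivial_homology_punctured_cell[OF F(1,2) x Y] in auto)
  show ?thesis
  proof (rule isoI_if_compose_iso[OF _ 1 _ local_homology_cell[OF F(1,2) x Y(1,3)]])
    show "inclusion_map p (Y \<union> F) Y (Y \<union> F) (Y \<union> F - {x}) (inclusion_map p F (rel_frontier F) (Y \<union> F) Y z)
        = inclusion_map p F (rel_frontier F) (Y \<union> F) (Y \<union> F - {x}) z" for z
      by (rule inclusion_map_compose) (use Y xY in auto)
  qed simp
qed

lemma boundary_to_local_homology:
  fixes F :: "'a::euclidean_space set"
  assumes F: "convex F" "compact F" "aff_dim F \<ge> 1" and x: "x \<in> rel_frontier F"
  shows "triple_boundary p F (rel_frontier F) (rel_frontier F - {x})
     \<in> iso (subspace_homology p F (rel_frontier F))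
           (subspace_homology (p - 1) (rel_frontier F) (rel_frontier F - {x}))"
proof (rule triple_boundary_iso_if_trivial)
  show "trivial_group (subspace_homology p F (rel_frontier F - {x}))" for p
  proof -
    have clF: "closure F = F" using F compact_imp_closed closure_closed by blast
    \<comment> \<open>The punctured frontier is a punctured sphere, hence homeomorphic to an affine
      space \<open>T\<close> of dimension one less than \<open>F\<close>. The bound on the dimension
      of \<open>F\<close> makes \<open>T\<close> nonempty, as is required of the smaller set in a
      contractible pair.\<close>
    obtain T :: "'a set" where T: "affine T" "aff_dim T = aff_dim F - 1"
    proof -
      have "aff_dim F - 1 \<le> int DIM('a)" "- 1 \<le> aff_dim F - 1"
        using F(3) aff_dim_le_DIM[of F] by auto
      then show ?thesis using choose_affine_subset[of UNIV "aff_dim F - 1"] that by auto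
    qed
    have h: "rel_frontier F - {x} homeomorphic T"
      by (rule homeomorphic_punctured_sphere_affine_gen)
         (use F x T compact_imp_bounded in auto)
    have "T \<noteq> {}" using T F(3) by auto
    then have "rel_frontier F - {x} \<noteq> {}" using h by (metis homeomorphic_empty(2))
    moreover have "contractible (rel_frontier F - {x})"
      using h T affine_imp_convex convex_imp_contractible homeomorphic_contractible_eq by blast
    ultimately show ?thesis
      using F convex_imp_contractible by (intro trivial_homology_contractible_pair) (auto simp: rel_frontier_def clF)
  qed
  show "rel_frontier F \<subseteq> F"
    using F compact_imp_closed closure_closed by (auto simp: rel_frontier_def)
qed auto

text \<open>Induction on the dimension: the connecting map lands in the local homology of the
  frontier at an interior point of a facet, and this is the homology of the facet relative to its
  own frontier, one degree lower.\<close>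

lemma homology_polytope_rel_frontier:
  fixes F :: "'a::euclidean_space set"
  assumes "polytope F" "aff_dim F = int n"
  shows "subspace_homology (int n) F (rel_frontier F) \<cong> integer_group"
  using assms
proof (induction n arbitrary: F)
  case 0
  then obtain a where a: "F = {a}" using aff_dim_eq_0 by auto
  show ?case
    unfolding subspace_homology_def a by (simp add: homology_coefficients)
next
  case (Suc n)
  have F: "convex F" "compact F" "polyhedron F" "closed F"
    using Suc.prems polytope_imp_convex polytope_imp_compact polytope_imp_polyhedron compact_imp_closed by auto
  obtain G where G: "G facet_of F" using Suc.prems polytope_facet_exists[of F] by auto
  have Gp: "polytope G" "aff_dim G = int n" "G \<noteq> {}"
    using G Suc.prems face_of_polytope_polytope by (auto simp: facet_of_def)
  then have G': "convex G" "compact G"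
    using polytope_imp_convex polytope_imp_compact by auto
  obtain x where x: "x \<in> rel_interior G" using Gp G' rel_interior_eq_empty by auto
  \<comment> \<open>The frontier is \<open>G\<close> glued to the remaining facets, the shape
    required by \<open>local_homology_cell\<close>.\<close>
  define Y where "Y = \<Union>{C. C facet_of F \<and> C \<noteq> G}"
  have "finite {C. C facet_of F \<and> C \<noteq> G}"
    by (rule finite_subset[OF _ finite_polyhedron_facets[OF F(3)]]) auto
  then have "closed Y"
    unfolding Y_def using F(1,4) face_of_imp_closed
    by (intro closed_Union) (auto simp: facet_of_def)
  moreover have "Y \<inter> rel_interior G = {}"
  proof -
    have "C \<inter> rel_interior G = {}" if C: "C facet_of F" "C \<noteq> G" for C
    proof (rule ccontr)
      assume "C \<inter> rel_interior G \<noteq> {}"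
      then have "G \<subseteq> C"
        using C G by (meson facet_of_imp_face_of face_of_imp_subset subset_of_face_of)
      \<comment> \<open>A facet contained in another facet would be a proper face of it and so have
        smaller dimension, although all facets have the same dimension.\<close>
      then have "G face_of C"
        using C G by (meson facet_of_imp_face_of facet_of_imp_subset face_of_subset)
      then show False
        using C G face_of_aff_dim_lt[of C G] face_of_imp_convex F(1)
        by (auto simp: facet_of_def)
    qed
    then show ?thesis by (auto simp: Y_def)
  qed
  moreover have fr: "rel_frontier F = Y \<union> G"
    using rel_frontier_of_polyhedron[OF F(3)] G by (auto simp: Y_def)
  ultimately have 1: "subspace_homology (int n) G (rel_frontier G) \<cong>
      subspace_homology (int n) (rel_frontier F) (rel_frontier F - {x})"
    using local_homology_cell[OF G' x, of Y "int n"] by (auto simp: is_iso_def)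
  have "x \<in> rel_frontier F" using fr x rel_interior_subset by auto
  then have 2: "subspace_homology (int (Suc n)) F (rel_frontier F) \<cong>
      subspace_homology (int n) (rel_frontier F) (rel_frontier F - {x})"
    using boundary_to_local_homology[OF F(1,2), of x "int (Suc n)"] Suc.prems(2) by (auto simp: is_iso_def)
  have 3: "subspace_homology (int n) (rel_frontier F) (rel_frontier F - {x}) \<cong> integer_group"
    using 1 Suc.IH[OF Gp(1,2)] group.iso_sym iso_trans group_subspace_homology by blast
  show ?case using 2 3 iso_trans by blast
qed

section \<open>Cellular cochains of a polytopal pair\<close>

text \<open>These default rules turn arithmetic on bits into Boolean connectives, which hides linearity.\<close>

declare add_bit_eq_xor [simp del] mult_bit_eq_and [simp del]

lemma cellular_chain_group_eq:
  "cellular_chain_group X B n = subspace_homology n (pair_skeleton X B n) (pair_skeleton X B (n - 1))"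
  by (simp add: cellular_chain_group_def subspace_homology_def)

lemma cellular_boundary_eq:
  "cellular_boundary X B n
     = triple_boundary n (pair_skeleton X B n) (pair_skeleton X B (n - 1)) (pair_skeleton X B (n - 2))"
  by (simp add: cellular_boundary_def triple_boundary_def)

lemma pair_skeleton_mono: "m \<le> n \<Longrightarrow> pair_skeleton X B m \<subseteq> pair_skeleton X B n"
  by (force simp: pair_skeleton_def)

lemma cellular_boundary_hom:
  "cellular_boundary X B n \<in> hom (cellular_chain_group X B n) (cellular_chain_group X B (n - 1))"
  using triple_boundary_hom[OF pair_skeleton_mono[of "n - 1" n]]
  by (simp add: cellular_boundary_eq cellular_chain_group_eq)

lemma cellular_cochains_iff:
  "f \<in> cellular_cochains X B i \<longleftrightarrow> Z2_additive (cellular_chain_group X B (int i)) f \<and>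
     (\<forall>z. z \<notin> carrier (cellular_chain_group X B (int i)) \<longrightarrow> f z = 0)"
  by (simp add: cellular_cochains_def Z2_additive_def)

text \<open>Factor both connecting maps through third set \<open>{}\<close>. The composite then
  contains two consecutive arrows of the long exact sequence of the pair of skeleta in degrees
  \<open>n - 1\<close> and \<open>n - 2\<close>.\<close>

lemma cellular_boundary_twice:
  assumes "z \<in> carrier (cellular_chain_group X B n)"
  shows "cellular_boundary X B (n - 1) (cellular_boundary X B n z) = \<one>\<^bsub>cellular_chain_group X B (n - 2)\<^esub>"
proof -
  let ?S = "pair_skeleton X B"
  have sub: "?S (n - 1) \<subseteq> ?S n" "?S (n - 2) \<subseteq> ?S (n - 1)" "?S (n - 3) \<subseteq> ?S (n - 2)"
    by (auto intro!: pair_skeleton_mono simp del: subsetI)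
  define w where "w = triple_boundary n (?S n) (?S (n - 1)) {} z"
  have w: "w \<in> carrier (subspace_homology (n - 1) (?S (n - 1)) {})"
    using assms triple_boundary_hom[OF sub(1), of n "{}"]
    by (auto simp: w_def cellular_chain_group_eq hom_def Pi_iff)
  have "inclusion_map (n - 1) (?S (n - 1)) {} (?S (n - 1)) (?S (n - 2)) w
     \<in> kernel (subspace_homology (n - 1) (?S (n - 1)) (?S (n - 2)))
          (subspace_homology (n - 1 - 1) (?S (n - 2)) {}) (triple_boundary (n - 1) (?S (n - 1)) (?S (n - 2)) {})"
    using w triple_exact_1[of "{}" "?S (n - 2)" "?S (n - 1)" "n - 1"] sub by simp
  then have 1: "triple_boundary (n - 1) (?S (n - 1)) (?S (n - 2)) {}
      (inclusion_map (n - 1) (?S (n - 1)) {} (?S (n - 1)) (?S (n - 2)) w)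
     = \<one>\<^bsub>subspace_homology (n - 2) (?S (n - 2)) {}\<^esub>"
    by (simp add: kernel_def)
  have "cellular_boundary X B (n - 1) (cellular_boundary X B n z) =
     inclusion_map (n - 2) (?S (n - 2)) {} (?S (n - 2)) (?S (n - 3))
       (triple_boundary (n - 1) (?S (n - 1)) (?S (n - 2)) {}
         (inclusion_map (n - 1) (?S (n - 1)) {} (?S (n - 1)) (?S (n - 2)) w))"
    using triple_boundary_empty[OF sub(1), of n "?S (n - 2)" z]
      triple_boundary_empty[OF sub(2), of "n - 1" "?S (n - 3)"]
    by (simp add: cellular_boundary_eq w_def)
  also have "\<dots> = \<one>\<^bsub>cellular_chain_group X B (n - 2)\<^esub>"
    unfolding 1 by (simp add: cellular_chain_group_eq hom_one[OF inclusion_map_hom])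
  finally show ?thesis .
qed

lemma cellular_coboundary_in:
  assumes "f \<in> cellular_cochains X B i"
  shows "cellular_coboundary X B i f \<in> cellular_cochains X B (Suc i)"
proof -
  let ?C = "cellular_chain_group X B (int (Suc i))"
  have "group ?C" by (simp add: cellular_chain_group_eq)
  then interpret group ?C .
  have "Z2_additive ?C (f \<circ> cellular_boundary X B (int (Suc i)))"
    by (rule Z2_additive_compose) (use assms cellular_boundary_hom[of X B "int (Suc i)"] in \<open>auto simp: cellular_cochains_iff\<close>)
  then show ?thesis
    by (auto simp: cellular_cochains_iff cellular_coboundary_def Z2_additive_def simp del: of_nat_Suc)
qed

lemma cellular_coboundary_twice:
  assumes "f \<in> cellular_cochains X B i"
  shows "cellular_coboundary X B (Suc i) (cellular_coboundary X B i f) = (\<lambda>z. 0)"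
proof
  fix z
  let ?C = "cellular_chain_group X B"
  show "cellular_coboundary X B (Suc i) (cellular_coboundary X B i f) z = 0"
  proof (cases "z \<in> carrier (?C (int (Suc (Suc i))))")
    case True
    then have "cellular_boundary X B (int (Suc (Suc i))) z \<in> carrier (?C (int (Suc i)))"
      using cellular_boundary_hom[of X B "int (Suc (Suc i))"] by (auto simp: hom_def Pi_iff)
    moreover have "cellular_boundary X B (int (Suc i)) (cellular_boundary X B (int (Suc (Suc i))) z) = \<one>\<^bsub>?C (int i)\<^esub>"
      using cellular_boundary_twice[OF True] by simp
    moreover have "f \<one>\<^bsub>?C (int i)\<^esub> = 0"
      using assms by (intro Z2_additive_one) (auto simp: cellular_cochains_iff cellular_chain_group_eq)
    ultimately show ?thesis by (simp add: cellular_coboundary_def del: of_nat_Suc)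
  qed (simp add: cellular_coboundary_def)
qed

section \<open>Polytopal pairs and the coordinates of their cells\<close>

lemma Z2_additive_sum:
  assumes "\<And>F. F \<in> I \<Longrightarrow> Z2_additive G (g F)"
  shows "Z2_additive G (\<lambda>z. \<Sum>F\<in>I. c F * g F z)"
  using assms unfolding Z2_additive_def
  by (simp add: sum.distrib distrib_left cong: sum.cong_simp)

locale polytopal_pair =
  fixes X B :: "'a::euclidean_space set set"
  assumes finite_cells: "finite X"
    and subcomplex: "B \<subseteq> X"
    and polytope_cell: "F \<in> X \<Longrightarrow> polytope F"
    and nonempty_cell: "F \<in> X \<Longrightarrow> F \<noteq> {}"
    and interior_disjoint: "\<lbrakk>F \<in> X - B; G \<in> X; \<not> F \<subseteq> G\<rbrakk> \<Longrightarrow> G \<inter> rel_interior F = {}"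
    and coface: "\<lbrakk>F \<in> X - B; G \<in> X; F \<subseteq> G; F \<noteq> G\<rbrakk> \<Longrightarrow> G \<notin> B \<and> aff_dim F < aff_dim G"
    and frontier_covered: "F \<in> X - B \<Longrightarrow> rel_frontier F \<subseteq> \<Union>{G \<in> X. aff_dim G < aff_dim F}"
begin

abbreviation skel :: "int \<Rightarrow> 'a set" where "skel \<equiv> pair_skeleton X B"

abbreviation skeleton_chains :: "int \<Rightarrow> 'a chain set monoid" where
  "skeleton_chains n \<equiv> subspace_homology n (skel n) (skel (n - 1))"

definition cells :: "int \<Rightarrow> 'a set set" where
  "cells n = {F \<in> X - B. aff_dim F = n}"

abbreviation cell_homology :: "int \<Rightarrow> 'a set \<Rightarrow> 'a chain set monoid" where
  "cell_homology n F \<equiv> subspace_homology n F (rel_frontier F)"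

abbreviation cell_inclusion :: "int \<Rightarrow> 'a set \<Rightarrow> 'a chain set \<Rightarrow> 'a chain set" where
  "cell_inclusion n F \<equiv> inclusion_map n F (rel_frontier F) (skel n) (skel (n - 1))"

definition center :: "'a set \<Rightarrow> 'a" where
  "center F = (SOME x. x \<in> rel_interior F)"

text \<open>The mod 2 coefficient of \<open>F\<close>: for a cell \<open>F\<close> of dimension
  \<open>n\<close> the local homology at its center is infinite cyclic and does not see the other
  \<open>n\<close>-cells.\<close>

definition coordinate :: "int \<Rightarrow> 'a set \<Rightarrow> 'a chain set \<Rightarrow> bit" where
  "coordinate n F z = Z2_parity (subspace_homology n (skel n) (skel n - {center F}))
     (inclusion_map n (skel n) (skel (n - 1)) (skel n) (skel n - {center F}) z)"

lemma finite_cells_dim: "finite (cells n)"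
  unfolding cells_def using finite_cells by simp

lemma cell_props:
  assumes "F \<in> cells n"
  shows "convex F" "compact F" "closed F" "F \<noteq> {}" "center F \<in> rel_interior F" "F \<subseteq> skel n"
    "rel_frontier F \<subseteq> F" "rel_frontier F \<subseteq> skel (n - 1)" "skel (n - 1) \<inter> rel_interior F = {}"
proof -
  have F: "F \<in> X" "F \<notin> B" "aff_dim F = n" using assms by (auto simp: cells_def)
  show c: "convex F" "compact F" "F \<noteq> {}"
    using polytope_cell[OF F(1)] nonempty_cell[OF F(1)] polytope_imp_convex polytope_imp_compact by auto
  then show "closed F" by (simp add: compact_imp_closed)
  then show "rel_frontier F \<subseteq> F" by (auto simp: rel_frontier_def)
  show "center F \<in> rel_interior F"
    unfolding center_def using c rel_interior_eq_empty by (metis ex_in_conv someI)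
  show "F \<subseteq> skel n" using F by (auto simp: pair_skeleton_def)
  show "rel_frontier F \<subseteq> skel (n - 1)"
    using frontier_covered[of F] F by (force simp: pair_skeleton_def)
  have "G \<inter> rel_interior F = {}" if "G \<in> X" "G \<in> B \<or> aff_dim G \<le> n - 1" for G
  proof -
    have "\<not> F \<subseteq> G" using coface[of F G] F that by force
    then show ?thesis using interior_disjoint[of F G] F that by simp
  qed
  then show "skel (n - 1) \<inter> rel_interior F = {}"
    using subcomplex unfolding pair_skeleton_def by blast
qed

lemma closed_skel: "closed (skel n)"
proof -
  have cl: "closed F" if "F \<in> X" for F
    using that polytope_cell polytope_imp_closed by auto
  have "finite B" using subcomplex finite_cells finite_subset by blast
  then show ?thesis
    unfolding pair_skeleton_def using finite_cells cl subcomplex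
    by (intro closed_Un closed_Union) auto
qed

text \<open>A top-dimensional cell of a skeleton is separated from the rest, so that
  \<open>local_homology_cell\<close> applies to it.\<close>

lemma skel_remove_cell:
  assumes F: "F \<in> cells n"
  obtains Y where "closed Y" "Y \<inter> rel_interior F = {}" "skel n = Y \<union> F"
proof -
  define Y where "Y = \<Union>{G \<in> X. aff_dim G \<le> n \<and> G \<noteq> F} \<union> \<Union>B"
  have cl: "closed F" if "F \<in> X" for F
    using that polytope_cell polytope_imp_closed by auto
  have "finite B" using subcomplex finite_cells finite_subset by blast
  then have "closed Y"
    unfolding Y_def using finite_cells cl subcomplex by (intro closed_Un closed_Union) auto
  moreover have "G \<inter> rel_interior F = {}" if "G \<in> X" "G \<in> B \<or> aff_dim G \<le> n" "G \<noteq> F" for G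
  proof -
    have "\<not> F \<subseteq> G" using coface[of F G] F that by (force simp: cells_def)
    then show ?thesis using interior_disjoint[of F G] F that by (simp add: cells_def)
  qed
  then have "Y \<inter> rel_interior F = {}"
    unfolding Y_def using subcomplex F by (auto simp: cells_def)
  moreover have "skel n = Y \<union> F"
    using F by (auto simp: pair_skeleton_def Y_def cells_def)
  ultimately show ?thesis using that by blast
qed

lemma local_iso:
  assumes F: "F \<in> cells n"
  shows "inclusion_map p F (rel_frontier F) (skel n) (skel n - {center F})
    \<in> iso (cell_homology p F) (subspace_homology p (skel n) (skel n - {center F}))"
proof -
  obtain Y where "closed Y" "Y \<inter> rel_interior F = {}" "skel n = Y \<union> F"
    using skel_remove_cell[OF F] by blast
  then show ?thesis using local_homology_cell[of F "center F" Y p] cell_props[OF F] by simp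
qed

lemma cell_cyclic:
  assumes "F \<in> cells (int n)"
  shows "cell_homology (int n) F \<cong> integer_group"
  using homology_polytope_rel_frontier[of F n] polytope_cell assms by (auto simp: cells_def)

lemma local_cyclic:
  assumes "F \<in> cells (int n)"
  shows "subspace_homology (int n) (skel (int n)) (skel (int n) - {center F}) \<cong> integer_group"
  using local_iso[OF assms, of "int n"] cell_cyclic[OF assms]
  by (meson group.iso_sym group_subspace_homology iso_trans is_isoI)

lemma skel_subset: "skel (n - 1) \<subseteq> skel n"
  by (rule pair_skeleton_mono) simp

lemma coordinate_additive:
  assumes "F \<in> cells (int n)"
  shows "Z2_additive (skeleton_chains (int n)) (coordinate (int n) F)"
  using Z2_additive_compose[OF Z2_parity_additive[OF _ local_cyclic[OF assms]] inclusion_map_hom]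
  unfolding coordinate_def o_def by simp

lemma coordinate_eq:
  assumes "F \<in> cells n" "T \<subseteq> skel n" "A \<subseteq> skel (n - 1)"
  shows "coordinate n F (inclusion_map n T A (skel n) (skel (n - 1)) z)
    = Z2_parity (subspace_homology n (skel n) (skel n - {center F}))
        (inclusion_map n T A (skel n) (skel n - {center F}) z)"
  unfolding coordinate_def
  by (subst inclusion_map_compose) (use assms cell_props[OF assms(1)] skel_subset[of n] in auto)

lemma coordinate_same:
  assumes "F \<in> cells n" "a \<in> carrier (cell_homology n F)"
  shows "coordinate n F (cell_inclusion n F a) = Z2_parity (cell_homology n F) a"
  by (subst coordinate_eq) (use assms cell_props Z2_parity_iso[OF _ _ local_iso] in auto)

text \<open>The map factors through the homology of \<open>(A', A')\<close>, which is zero.\<close>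

lemma inclusion_map_trivial:
  assumes "T \<subseteq> A'" "A \<subseteq> A'" "A \<subseteq> T" "A' \<subseteq> S" "a \<in> carrier (subspace_homology n T A)"
  shows "inclusion_map n T A S A' a = \<one>\<^bsub>subspace_homology n S A'\<^esub>"
proof -
  have "inclusion_map n T A S A' a = inclusion_map n A' A' S A' (inclusion_map n T A A' A' a)"
    by (subst inclusion_map_compose) (use assms in auto)
  also have "inclusion_map n T A A' A' a = \<one>\<^bsub>subspace_homology n A' A'\<^esub>"
    using trivial_homology_self[of n A'] by (metis inclusion_map_carrier singletonD trivial_group_def)
  finally show ?thesis by (simp add: hom_one[OF inclusion_map_hom])
qed

lemma coordinate_other:
  assumes F: "F \<in> cells n" and G: "G \<in> cells n" "F \<noteq> G" and a: "a \<in> carrier (cell_homology n G)"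
  shows "coordinate n F (cell_inclusion n G a) = 0"
proof -
  have "\<not> F \<subseteq> G" using F G coface[of F G] by (auto simp: cells_def)
  then have "center F \<notin> G"
    using interior_disjoint[of F G] cell_props(5)[OF F] F G by (auto simp: cells_def)
  then have "inclusion_map n G (rel_frontier G) (skel n) (skel n - {center F}) a
      = \<one>\<^bsub>subspace_homology n (skel n) (skel n - {center F})\<^esub>"
    using cell_props[OF G(1)] by (intro inclusion_map_trivial) (use a in auto)
  then show ?thesis
    by (subst coordinate_eq) (use F cell_props[OF G(1)] in auto)
qed

text \<open>The incidence number of \<open>G\<close> in \<open>F\<close> modulo two. If
  \<open>G\<close> is not inside \<open>F\<close>, the center of \<open>G\<close> avoids
  \<open>F\<close> and the boundary dies in the local homology there; otherwise everything between
  the homology of \<open>F\<close> and this local homology is an isomorphism and preserves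
  parity.\<close>

lemma coordinate_boundary:
  assumes F: "F \<in> cells (n + 1)" and G: "G \<in> cells n" and a: "a \<in> carrier (cell_homology (n + 1) F)"
    and n: "n \<ge> 0"
  shows "coordinate n G (triple_boundary (n + 1) (skel (n + 1)) (skel n) (skel (n - 1)) (cell_inclusion (n + 1) F a))
    = of_bool (G \<subseteq> F) * Z2_parity (cell_homology (n + 1) F) a"
proof -
  note Fp = cell_props[OF F, simplified]
  note Gp = cell_props[OF G]
  \<comment> \<open>The boundary with third set \<open>{}\<close> maps both to the chains of the
    skeleton and to the local homology of the frontier, and so links the two.\<close>
  define b where "b = triple_boundary (n + 1) F (rel_frontier F) {} a"
  have b: "b \<in> carrier (subspace_homology n (rel_frontier F) {})"
    using triple_boundary_hom[OF Fp(7), of "n + 1" "{}"] a by (auto simp: b_def hom_def Pi_iff)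
  have "triple_boundary (n + 1) (skel (n + 1)) (skel n) (skel (n - 1)) (cell_inclusion (n + 1) F a)
    = inclusion_map n (rel_frontier F) {} (skel n) (skel (n - 1)) b"
    using triple_boundary_natural[OF Fp(6,8) _ Fp(7), of "{}" "skel (n - 1)" "n + 1" a] skel_subset[of "n + 1"]
    by (simp add: b_def)
  then have eq: "coordinate n G (triple_boundary (n + 1) (skel (n + 1)) (skel n) (skel (n - 1)) (cell_inclusion (n + 1) F a))
    = Z2_parity (subspace_homology n (skel n) (skel n - {center G}))
        (inclusion_map n (rel_frontier F) {} (skel n) (skel n - {center G}) b)"
    using G Fp(8) by (simp add: coordinate_eq)
  show ?thesis
  proof (cases "G \<subseteq> F")
    case False
    then have "center G \<notin> F"
      using interior_disjoint[of G F] Gp(5) F G by (auto simp: cells_def)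
    then have "inclusion_map n (rel_frontier F) {} (skel n) (skel n - {center G}) b
        = \<one>\<^bsub>subspace_homology n (skel n) (skel n - {center G})\<^esub>"
      using Fp by (intro inclusion_map_trivial) (use b in auto)
    then show ?thesis using False unfolding eq by simp
  next
    case True
    define c where "c = center G"
    obtain Y where Y: "closed Y" "Y \<inter> rel_interior G = {}" "skel n = Y \<union> G"
      using skel_remove_cell[OF G] by blast
    have "Y \<inter> rel_interior F = {}" "G \<inter> rel_interior F = {}"
      using Fp(9) Y(3) by auto
    then have G_fr: "G \<subseteq> rel_frontier F"
      using True Fp(3) by (auto simp: rel_frontier_def)
    have fr: "rel_frontier F = (Y \<inter> rel_frontier F) \<union> G"
      using Fp(8) Y(3) G_fr by auto
    have "closed (rel_frontier F)"
      using compact_imp_closed[OF compact_rel_frontier_bounded] compact_imp_bounded[OF Fp(2)] by auto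
    then have "closed (Y \<inter> rel_frontier F)" using Y(1) by auto
    then have 1: "inclusion_map n G (rel_frontier G) (rel_frontier F) (rel_frontier F - {c})
      \<in> iso (cell_homology n G) (subspace_homology n (rel_frontier F) (rel_frontier F - {c}))"
      using local_homology_cell[OF Gp(1,2,5), of "Y \<inter> rel_frontier F" n] Y(2) fr
      unfolding c_def by (metis (no_types, lifting) inf_assoc inf_bot_right inf_commute)
    \<comment> \<open>The homology of the cell \<open>G\<close> maps isomorphically to both local
      groups, hence the inclusion between them is an isomorphism as well.\<close>
    have 2: "inclusion_map n (rel_frontier F) (rel_frontier F - {c}) (skel n) (skel n - {c})
      \<in> iso (subspace_homology n (rel_frontier F) (rel_frontier F - {c})) (subspace_homology n (skel n) (skel n - {c}))"
    proof (rule isoI_if_precompose_iso[OF 1 _ _ local_iso[OF G, of n, folded c_def]])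
      show "inclusion_map n (rel_frontier F) (rel_frontier F - {c}) (skel n) (skel n - {c})
          (inclusion_map n G (rel_frontier G) (rel_frontier F) (rel_frontier F - {c}) z)
        = inclusion_map n G (rel_frontier G) (skel n) (skel n - {c}) z" for z
        by (rule inclusion_map_compose) (use Gp Fp G_fr in \<open>auto simp: c_def rel_frontier_def\<close>)
    qed simp
    have c: "c \<in> rel_frontier F" using G_fr Gp(5) rel_interior_subset by (auto simp: c_def)
    have "aff_dim F \<ge> 1" using F n by (auto simp: cells_def)
    note 3 = boundary_to_local_homology[OF Fp(1,2) this c, of "n + 1", simplified]
    have "Z2_parity (cell_homology (n + 1) F) a
      = Z2_parity (subspace_homology n (rel_frontier F) (rel_frontier F - {c}))
          (triple_boundary (n + 1) F (rel_frontier F) (rel_frontier F - {c}) a)"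
      by (rule Z2_parity_iso[symmetric, OF _ _ 3]) (use a in auto)
    also have "triple_boundary (n + 1) F (rel_frontier F) (rel_frontier F - {c}) a
        = inclusion_map n (rel_frontier F) {} (rel_frontier F) (rel_frontier F - {c}) b"
      using triple_boundary_empty[OF Fp(7), of "n + 1" "rel_frontier F - {c}" a] by (simp only: b_def add_diff_cancel_right')
    also have "Z2_parity (subspace_homology n (rel_frontier F) (rel_frontier F - {c})) \<dots>
        = Z2_parity (subspace_homology n (skel n) (skel n - {c}))
           (inclusion_map n (rel_frontier F) (rel_frontier F - {c}) (skel n) (skel n - {c})
             (inclusion_map n (rel_frontier F) {} (rel_frontier F) (rel_frontier F - {c}) b))"
      by (rule Z2_parity_iso[symmetric, OF _ _ 2]) auto
    also have "inclusion_map n (rel_frontier F) (rel_frontier F - {c}) (skel n) (skel n - {c})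
             (inclusion_map n (rel_frontier F) {} (rel_frontier F) (rel_frontier F - {c}) b)
        = inclusion_map n (rel_frontier F) {} (skel n) (skel n - {c}) b"
      by (rule inclusion_map_compose) (use Fp in auto)
    finally show ?thesis using True eq by (simp add: c_def)
  qed
qed

text \<open>This says that the cells generate, as seen by additive functionals. Cells are attached
  to the lower skeleton one at a time; each attachment contributes only classes coming from the new
  cell.\<close>

lemma additive_eq_0_if_0_on_cells:
  assumes f: "Z2_additive (skeleton_chains n) f"
    and 0: "\<And>F a. F \<in> cells n \<Longrightarrow> a \<in> carrier (cell_homology n F) \<Longrightarrow> f (cell_inclusion n F a) = 0"
    and z: "z \<in> carrier (skeleton_chains n)"
  shows "f z = 0"
proof -
  let ?S = "skel (n - 1)"
  have grp: "group (skeleton_chains n)" by simp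
  have step: "\<forall>z\<in>carrier (subspace_homology n (?S \<union> \<Union>\<F>) ?S).
      f (inclusion_map n (?S \<union> \<Union>\<F>) ?S (skel n) ?S z) = 0"
    if "finite \<F>" "\<F> \<subseteq> cells n" for \<F>
    using that
  proof (induction \<F>)
    case empty
    show ?case
    proof
      fix z assume z: "z \<in> carrier (subspace_homology n (?S \<union> \<Union>{}) ?S)"
      have "inclusion_map n ?S ?S (skel n) ?S z = \<one>\<^bsub>skeleton_chains n\<^esub>"
        by (rule inclusion_map_trivial) (use z skel_subset[of n] in auto)
      then show "f (inclusion_map n (?S \<union> \<Union>{}) ?S (skel n) ?S z) = 0"
        using Z2_additive_one[OF grp f] by simp
    qed
  next
    case (insert F \<F>)
    define Y where "Y = ?S \<union> \<Union>\<F>"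
    have F: "F \<in> cells n" and \<F>: "\<F> \<subseteq> cells n" using insert.prems by auto
    note Fp = cell_props[OF F]
    have Y': "?S \<union> \<Union>(insert F \<F>) = Y \<union> F" by (auto simp: Y_def)
    have "closed Y"
      unfolding Y_def using insert.hyps(1) \<F> cell_props(3) closed_skel
      by (intro closed_Un closed_Union) auto
    moreover have "rel_frontier F \<subseteq> Y" using Fp by (auto simp: Y_def)
    moreover have "Y \<inter> rel_interior F = {}"
    proof -
      have "G \<inter> rel_interior F = {}" if "G \<in> \<F>" for G
      proof -
        have G: "G \<in> cells n" "G \<noteq> F" using that \<F> insert.hyps by auto
        then have "\<not> F \<subseteq> G" using F coface[of F G] by (auto simp: cells_def)
        then show ?thesis using interior_disjoint[of F G] F G by (auto simp: cells_def)
      qed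
      then show ?thesis using Fp(9) by (auto simp: Y_def)
    qed
    ultimately have att: "inclusion_map n F (rel_frontier F) (Y \<union> F) Y
      \<in> iso (cell_homology n F) (subspace_homology n (Y \<union> F) Y)"
      by (rule cell_attachment_homology[OF Fp(1,2,4)])
    have "\<Union>\<F> \<subseteq> skel n" using \<F> cell_props(6) by blast
    then have YS: "?S \<subseteq> Y" "Y \<union> F \<subseteq> skel n"
      using skel_subset[of n] Fp(6) by (auto simp: Y_def)
    show ?case
      unfolding Y'
    proof
      let ?K = "subspace_homology n (Y \<union> F) ?S" and ?L = "subspace_homology n (Y \<union> F) Y"
      let ?j = "inclusion_map n (Y \<union> F) ?S (Y \<union> F) Y" and ?i = "inclusion_map n (Y \<union> F) ?S (skel n) ?S"
      interpret K: group ?K by simp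
      interpret L: group ?L by simp
      fix z assume z: "z \<in> carrier ?K"
      have "?j z \<in> inclusion_map n F (rel_frontier F) (Y \<union> F) Y ` carrier (cell_homology n F)"
        using att inclusion_map_carrier unfolding iso_def bij_betw_def by simp
      then obtain a where a: "a \<in> carrier (cell_homology n F)"
        and az: "inclusion_map n F (rel_frontier F) (Y \<union> F) Y a = ?j z"
        by auto
      define a' where "a' = inclusion_map n F (rel_frontier F) (Y \<union> F) ?S a"
      have a': "a' \<in> carrier ?K" by (simp add: a'_def)
      have ja: "?j a' = ?j z"
        unfolding a'_def az[symmetric] by (rule inclusion_map_compose) (use Fp YS in auto)
      \<comment> \<open>Subtracting the part \<open>a'\<close> supported on \<open>F\<close> leaves
        a class that vanishes relative to \<open>Y\<close>; by exactness it comes from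
        \<open>Y\<close>, where the induction hypothesis applies.\<close>
      define y where "y = z \<otimes>\<^bsub>?K\<^esub> inv\<^bsub>?K\<^esub> a'"
      have y: "y \<in> carrier ?K" using z a' by (simp add: y_def)
      interpret j: group_hom ?K ?L ?j
        by (simp add: group_hom_def group_hom_axioms_def K.group_axioms L.group_axioms)
      have "?j y = \<one>\<^bsub>?L\<^esub>"
        using z a' by (simp add: y_def ja)
      then have "y \<in> kernel ?K ?L ?j" using y by (simp add: kernel_def)
      then obtain w where w: "w \<in> carrier (subspace_homology n Y ?S)" "y = inclusion_map n Y ?S (Y \<union> F) ?S w"
        using triple_exact_3[OF YS(1), of "Y \<union> F" n] by auto
      have "?i y = inclusion_map n Y ?S (skel n) ?S w"
        unfolding w(2) by (rule inclusion_map_compose) (use YS in auto)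
      then have fy: "f (?i y) = 0"
        using insert.IH[OF \<F>] w(1) by (simp add: Y_def)
      have "?i a' = cell_inclusion n F a"
        unfolding a'_def by (rule inclusion_map_compose) (use Fp YS in auto)
      then have fa: "f (?i a') = 0" using 0[OF F a] by simp
      have "z = y \<otimes>\<^bsub>?K\<^esub> a'" using z a' by (simp add: y_def K.m_assoc)
      moreover have "Z2_additive ?K (f \<circ> ?i)" by (rule Z2_additive_compose[OF f]) simp
      ultimately have "(f \<circ> ?i) z = (f \<circ> ?i) y + (f \<circ> ?i) a'"
        using y a' unfolding Z2_additive_def by metis
      then show "f (?i z) = 0" using fy fa by simp
    qed
  qed
  have "skel n = ?S \<union> \<Union>(cells n)"
    using skel_subset[of n] cell_props(6)[of _ n]
    by (auto simp: pair_skeleton_def cells_def subset_iff) (smt (verit) mem_Collect_eq)+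
  moreover have "inclusion_map n (skel n) ?S (skel n) ?S z = z"
    using z by (simp add: inclusion_map_def subspace_homology_def hom_induced_id)
  ultimately show ?thesis
    using step[OF finite_cells_dim subset_refl] z by metis
qed

section \<open>Cochains as functions on the relative cells\<close>

definition cell_cochains :: "nat \<Rightarrow> ('a set \<Rightarrow> bit) set" where
  "cell_cochains i = {c. \<forall>F. c F \<noteq> 0 \<longrightarrow> F \<in> cells (int i)}"

definition cell_coboundary :: "nat \<Rightarrow> ('a set \<Rightarrow> bit) \<Rightarrow> 'a set \<Rightarrow> bit" where
  "cell_coboundary i c F =
     (if F \<in> cells (int (Suc i)) then \<Sum>G\<in>cells (int i). c G * of_bool (G \<subseteq> F) else 0)"

text \<open>Coefficients are paired with the coordinates of the cells. The value zero outside the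
  carrier matches the normalization of \<open>cellular_cochains\<close>.\<close>

definition realize :: "nat \<Rightarrow> ('a set \<Rightarrow> bit) \<Rightarrow> 'a chain set \<Rightarrow> bit" where
  "realize i c z = (if z \<in> carrier (skeleton_chains (int i))
     then \<Sum>F\<in>cells (int i). c F * coordinate (int i) F z else 0)"

lemma realize_in: "realize i c \<in> cellular_cochains X B i"
proof -
  interpret group "skeleton_chains (int i)" by simp
  show ?thesis
    using Z2_additive_sum[of "cells (int i)" "skeleton_chains (int i)" "coordinate (int i)" c] coordinate_additive
    by (auto simp: cellular_cochains_iff cellular_chain_group_eq realize_def Z2_additive_def)
qed

lemma realize_cell:
  assumes "G \<in> cells (int i)" "a \<in> carrier (cell_homology (int i) G)"
  shows "realize i c (cell_inclusion (int i) G a) = c G * Z2_parity (cell_homology (int i) G) a"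
proof -
  have "(\<Sum>F\<in>cells (int i). c F * coordinate (int i) F (cell_inclusion (int i) G a))
     = (\<Sum>F\<in>cells (int i). if F = G then c G * Z2_parity (cell_homology (int i) G) a else 0)"
    by (rule sum.cong) (use assms coordinate_same coordinate_other in auto)
  then show ?thesis using assms finite_cells_dim by (simp add: realize_def)
qed

lemma cochain_eqI:
  assumes f: "f \<in> cellular_cochains X B i" and g: "g \<in> cellular_cochains X B i"
    and eq: "\<And>F a. F \<in> cells (int i) \<Longrightarrow> a \<in> carrier (cell_homology (int i) F) \<Longrightarrow>
      f (cell_inclusion (int i) F a) = g (cell_inclusion (int i) F a)"
  shows "f = g"
proof
  fix z
  show "f z = g z"
  proof (cases "z \<in> carrier (skeleton_chains (int i))")
    case True
    \<comment> \<open>In characteristic two, equality of \<open>f\<close> and \<open>g\<close> is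
      the vanishing of their sum.\<close>
    have "Z2_additive (skeleton_chains (int i)) (\<lambda>z. f z + g z)"
      using f g by (simp add: cellular_cochains_iff cellular_chain_group_eq Z2_additive_def algebra_simps)
    then have "f z + g z = 0"
      by (rule additive_eq_0_if_0_on_cells) (use True eq in auto)
    then show ?thesis by (cases "f z"; cases "g z") auto
  next
    case False
    then show ?thesis using f g by (simp add: cellular_cochains_iff cellular_chain_group_eq)
  qed
qed

text \<open>A class \<open>g F\<close> of odd parity recovers the coefficient of \<open>F\<close> by
  evaluation, which gives injectivity. Evaluating any cochain on these classes gives its preimage,
  since on each cell group it is a multiple of the parity.\<close>

lemma bij_realize: "bij_betw (realize i) (cell_cochains i) (cellular_cochains X B i)"
proof -
  have "\<exists>g. g \<in> carrier (cell_homology (int i) F) \<and> Z2_parity (cell_homology (int i) F) g = 1 \<and>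
      (\<forall>f z. Z2_additive (cell_homology (int i) F) f \<longrightarrow> z \<in> carrier (cell_homology (int i) F) \<longrightarrow>
        f z = f g * Z2_parity (cell_homology (int i) F) z)" if "F \<in> cells (int i)" for F
    using infinite_cyclic_generator[OF _ cell_cyclic[OF that]] by (metis group_subspace_homology)
  then obtain g where g: "\<And>F. F \<in> cells (int i) \<Longrightarrow> g F \<in> carrier (cell_homology (int i) F)"
    "\<And>F. F \<in> cells (int i) \<Longrightarrow> Z2_parity (cell_homology (int i) F) (g F) = 1"
    "\<And>F f z. \<lbrakk>F \<in> cells (int i); Z2_additive (cell_homology (int i) F) f; z \<in> carrier (cell_homology (int i) F)\<rbrakk> \<Longrightarrow>
        f z = f (g F) * Z2_parity (cell_homology (int i) F) z"
    by metis
  show ?thesis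
    unfolding bij_betw_def
  proof
    show "inj_on (realize i) (cell_cochains i)"
    proof (rule inj_onI, rule ext)
      fix c d F
      assume cd: "c \<in> cell_cochains i" "d \<in> cell_cochains i" "realize i c = realize i d"
      show "c F = d F"
      proof (cases "F \<in> cells (int i)")
        case True
        then show ?thesis
          using realize_cell[OF True g(1)[OF True], of c] realize_cell[OF True g(1)[OF True], of d] cd(3) g(2)[OF True]
          by simp
      next
        case False
        then have "c F = 0" "d F = 0" using cd unfolding cell_cochains_def by blast+
        then show ?thesis by simp
      qed
    qed
    show "realize i ` cell_cochains i = cellular_cochains X B i"
    proof (intro equalityI subsetI)
      fix f assume f: "f \<in> cellular_cochains X B i"
      define c where "c F = (if F \<in> cells (int i) then f (cell_inclusion (int i) F (g F)) else 0)" for F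
      have "realize i c = f"
      proof (rule cochain_eqI[OF realize_in f])
        fix F a assume F: "F \<in> cells (int i)" and a: "a \<in> carrier (cell_homology (int i) F)"
        have "Z2_additive (cell_homology (int i) F) (f \<circ> cell_inclusion (int i) F)"
          by (rule Z2_additive_compose[where K = "skeleton_chains (int i)"])
             (use f in \<open>auto simp: cellular_cochains_iff cellular_chain_group_eq\<close>)
        from g(3)[OF F this a] show "realize i c (cell_inclusion (int i) F a) = f (cell_inclusion (int i) F a)"
          using F by (simp add: realize_cell[OF F a] c_def)
      qed
      moreover have "c \<in> cell_cochains i" by (auto simp: cell_cochains_def c_def)
      ultimately show "f \<in> realize i ` cell_cochains i" by blast
    qed (use realize_in in auto)
  qed
qed

lemma realize_coboundary:
  "realize (Suc i) (cell_coboundary i c) = cellular_coboundary X B i (realize i c)"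
proof (rule cochain_eqI[OF realize_in cellular_coboundary_in[OF realize_in]])
  fix F a assume F: "F \<in> cells (int (Suc i))" and a: "a \<in> carrier (cell_homology (int (Suc i)) F)"
  let ?i = "int i"
  have F': "F \<in> cells (?i + 1)" and a': "a \<in> carrier (cell_homology (?i + 1) F)"
    using F a by (auto simp: add.commute)
  let ?b = "triple_boundary (?i + 1) (skel (?i + 1)) (skel ?i) (skel (?i - 1)) (cell_inclusion (?i + 1) F a)"
  have b: "?b \<in> carrier (skeleton_chains ?i)"
    using triple_boundary_hom[OF skel_subset[of "?i + 1"], of "?i + 1" "skel (?i - 1)"]
    by (auto simp: hom_def Pi_iff)
  have "realize (Suc i) (cell_coboundary i c) (cell_inclusion (int (Suc i)) F a)
    = (\<Sum>G\<in>cells ?i. c G * of_bool (G \<subseteq> F)) * Z2_parity (cell_homology (?i + 1) F) a"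
    using realize_cell[OF F a] F by (simp add: cell_coboundary_def add.commute)
  also have "\<dots> = (\<Sum>G\<in>cells ?i. c G * coordinate ?i G ?b)"
    unfolding sum_distrib_right
    by (rule sum.cong) (simp_all add: coordinate_boundary[OF F' _ a' of_nat_0_le_iff, simplified] mult.assoc)
  also have "\<dots> = realize i c ?b"
    using b by (simp add: realize_def)
  also have "\<dots> = cellular_coboundary X B i (realize i c) (cell_inclusion (int (Suc i)) F a)"
    by (simp add: cellular_coboundary_def cellular_boundary_eq cellular_chain_group_eq add.commute)
  finally show "realize (Suc i) (cell_coboundary i c) (cell_inclusion (int (Suc i)) F a)
    = cellular_coboundary X B i (realize i c) (cell_inclusion (int (Suc i)) F a)" .
qed

lemma realize_add: "realize i (\<lambda>F. c F + d F) = (\<lambda>z. realize i c z + realize i d z)"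
  by (auto simp: realize_def fun_eq_iff distrib_right sum.distrib)

lemma realize_mult: "realize i (\<lambda>F. a * c F) = (\<lambda>z. a * realize i c z)"
  by (auto simp: realize_def fun_eq_iff mult.assoc sum_distrib_left)

end

section \<open>Chains of ideals as total preorders\<close>

text \<open>The preorder in which \<open>p\<close> enters the chain no later than \<open>q\<close>.
  Its classes are the blocks, and it lets block indices be avoided in the geometry.\<close>

definition chain_le :: "'p set list \<Rightarrow> 'p \<Rightarrow> 'p \<Rightarrow> bool" where
  "chain_le L p q \<longleftrightarrow> (\<forall>I\<in>set L. q \<in> I \<longrightarrow> p \<in> I)"

lemma ideal_chain_sorted:
  assumes "ideal_chain L" shows "sorted_wrt (\<subset>) L"
proof -
  have "L ! i \<subset> L ! Suc i" if "Suc i < length L" for i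
  proof -
    have "Suc i \<in> {1..chain_length L}" using that by (auto simp: chain_length_def)
    then have "L ! (Suc i - 1) \<subset> L ! Suc i" using assms unfolding ideal_chain_def by blast
    then show ?thesis by simp
  qed
  then show ?thesis
    by (subst sorted_wrt_iff_nth_Suc_transp) (auto intro: transpI)
qed

lemma ideal_chain_ends:
  assumes "ideal_chain L"
  shows "L ! 0 = {}" "L ! chain_length L = UNIV" "chain_length L < length L" "length L = Suc (chain_length L)"
  using assms by (auto simp: ideal_chain_def chain_length_def hd_conv_nth last_conv_nth)

lemma ideal_chain_mono:
  assumes "ideal_chain L" "i \<le> j" "j \<le> chain_length L" shows "L ! i \<subseteq> L ! j"
  using ideal_chain_sorted[OF assms(1)] assms ideal_chain_ends[OF assms(1)]
  by (cases "i = j") (auto simp: sorted_wrt_iff_nth_less less_imp_le)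

lemma ideal_chain_distinct:
  assumes "ideal_chain L" shows "distinct L"
  using ideal_chain_sorted[OF assms]
  by (auto simp: distinct_conv_nth sorted_wrt_iff_nth_less) (metis nat_neq_iff psubset_eq)

lemma sorted_psubset_unique:
  "\<lbrakk>sorted_wrt (\<subset>) L; sorted_wrt (\<subset>) L'; set L = set L'\<rbrakk> \<Longrightarrow> L = L'"
proof (induction L arbitrary: L')
  case (Cons I L)
  obtain J L'' where L': "L' = J # L''" using Cons.prems by (cases L') auto
  have "I = J"
  proof (rule ccontr)
    assume "I \<noteq> J"
    then have "I \<in> set L''" "J \<in> set L" using Cons.prems L' by auto
    then show False using Cons.prems L' by auto
  qed
  moreover have "I \<notin> set L" "J \<notin> set L''" using Cons.prems L' by auto
  ultimately have "set L = set L''" using Cons.prems(3) L' by auto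
  then have "L = L''" using Cons L' by auto
  then show ?case using \<open>I = J\<close> L' by simp
qed auto

lemma ideal_chain_eqI:
  "\<lbrakk>ideal_chain L; ideal_chain L'; set L = set L'\<rbrakk> \<Longrightarrow> L = L'"
  using sorted_psubset_unique ideal_chain_sorted by blast

lemma nth_in_block_iff:
  assumes "ideal_chain L" "i \<in> {1..chain_length L}" "p \<in> block L i" "k \<le> chain_length L"
  shows "p \<in> L ! k \<longleftrightarrow> i \<le> k"
proof
  assume "p \<in> L ! k"
  then show "i \<le> k"
    using assms ideal_chain_mono[OF assms(1), of k "i - 1"] by (fastforce simp: block_def)
qed (use assms ideal_chain_mono[OF assms(1), of i k] in \<open>auto simp: block_def\<close>)

definition block_index :: "'p set list \<Rightarrow> 'p \<Rightarrow> nat" where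
  "block_index L p = (LEAST i. p \<in> L ! i)"

lemma block_index:
  assumes "ideal_chain L"
  shows "block_index L p \<in> {1..chain_length L}" "p \<in> block L (block_index L p)"
proof -
  let ?i = "block_index L p"
  have l: "p \<in> L ! chain_length L" using ideal_chain_ends[OF assms] by simp
  have i: "p \<in> L ! ?i" unfolding block_index_def by (rule LeastI[of "\<lambda>i. p \<in> L ! i", OF l])
  have "?i \<le> chain_length L" unfolding block_index_def by (rule Least_le[of "\<lambda>i. p \<in> L ! i", OF l])
  moreover have "?i \<noteq> 0" using i ideal_chain_ends[OF assms] by (metis empty_iff)
  ultimately show "?i \<in> {1..chain_length L}" by auto
  have "p \<notin> L ! (?i - 1)"
    unfolding block_index_def using \<open>?i \<noteq> 0\<close> not_less_Least[of "?i - 1" "\<lambda>i. p \<in> L ! i"]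
    by (auto simp: block_index_def)
  then show "p \<in> block L ?i" using i by (simp add: block_def)
qed

lemma block_index_eq:
  assumes "ideal_chain L" "i \<in> {1..chain_length L}" "p \<in> block L i"
  shows "block_index L p = i"
proof (rule antisym)
  note b = block_index[OF assms(1), of p]
  show "block_index L p \<le> i"
    using nth_in_block_iff[OF assms(1) b, of i] nth_in_block_iff[OF assms, of i] assms(2) by simp
  show "i \<le> block_index L p"
    using nth_in_block_iff[OF assms, of "block_index L p"] nth_in_block_iff[OF assms(1) b, of "block_index L p"] b(1) by simp
qed

lemma block_iff:
  assumes "ideal_chain L" "i \<in> {1..chain_length L}"
  shows "p \<in> block L i \<longleftrightarrow> block_index L p = i"
  using block_index_eq[OF assms] block_index[OF assms(1)] by blast

lemma block_nonempty:
  assumes "ideal_chain L" "i \<in> {1..chain_length L}"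
  shows "\<exists>p. p \<in> block L i"
  using assms by (fastforce simp: block_def ideal_chain_def)

lemma mem_nth_iff:
  assumes "ideal_chain L" "k \<le> chain_length L"
  shows "p \<in> L ! k \<longleftrightarrow> block_index L p \<le> k"
  using nth_in_block_iff[OF assms(1) block_index[OF assms(1)] assms(2)] .

lemma chain_le_iff:
  assumes "ideal_chain L"
  shows "chain_le L p q \<longleftrightarrow> block_index L p \<le> block_index L q"
proof
  assume "chain_le L p q"
  moreover have "L ! block_index L q \<in> set L"
    using block_index(1)[OF assms, of q] ideal_chain_ends(4)[OF assms] by (intro nth_mem) simp
  moreover have "q \<in> L ! block_index L q"
    using block_index(2)[OF assms, of q] by (simp add: block_def)
  ultimately have "p \<in> L ! block_index L q" by (auto simp: chain_le_def)
  then show "block_index L p \<le> block_index L q"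
    using mem_nth_iff[OF assms] block_index(1)[OF assms, of q] by simp
next
  assume le: "block_index L p \<le> block_index L q"
  show "chain_le L p q"
    unfolding chain_le_def
  proof (intro ballI impI)
    fix I assume "I \<in> set L" "q \<in> I"
    then obtain k where k: "k \<le> chain_length L" "I = L ! k"
      using ideal_chain_ends[OF assms] by (metis in_set_conv_nth less_Suc_eq_le)
    then show "p \<in> I" using \<open>q \<in> I\<close> le mem_nth_iff[OF assms k(1)] by auto
  qed
qed

lemma chain_le_total: "ideal_chain L \<Longrightarrow> chain_le L p q \<or> chain_le L q p"
  using chain_le_iff by (metis linear)

lemma chain_le_if_le: "\<lbrakk>ideal_chain L; p \<le> q\<rbrakk> \<Longrightarrow> chain_le L p q"
  unfolding chain_le_def ideal_chain_def order_ideal_def by blast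

text \<open>A nonempty down-set of a total preorder with finitely many classes is the initial
  segment up to the last block that it meets. So a chain consists of all down-sets of its
  preorder.\<close>

lemma down_closed_mem_chain:
  assumes L: "ideal_chain (L :: 'p::{finite,order} set list)"
    and I: "\<And>p q. q \<in> I \<Longrightarrow> chain_le L p q \<Longrightarrow> p \<in> I"
  shows "I \<in> set L"
proof (cases "I = {}")
  case True
  then show ?thesis using L unfolding ideal_chain_def by (metis hd_in_set)
next
  case False
  define k where "k = Max (block_index L ` I)"
  have "k \<in> block_index L ` I" unfolding k_def using False by (intro Max_in) auto
  then obtain q where q: "q \<in> I" "block_index L q = k" by auto
  have k: "k \<in> {1..chain_length L}" using q block_index[OF L] by auto
  have "p \<in> I \<longleftrightarrow> p \<in> L ! k" for p
  proof
    show "p \<in> L ! k" if "p \<in> I"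
      using that k mem_nth_iff[OF L, of k p] by (simp add: k_def)
    show "p \<in> I" if "p \<in> L ! k"
      using that I[OF q(1), of p] q(2) k mem_nth_iff[OF L, of k p] by (simp add: chain_le_iff[OF L])
  qed
  then have "I = L ! k" by auto
  then show ?thesis using k ideal_chain_ends(4)[OF L] by (metis atLeastAtMost_iff less_Suc_eq_le nth_mem)
qed

text \<open>Adding ideals breaks ties, so finer chains have smaller preorders. Conversely, if the
  preorder of \<open>L'\<close> is smaller, ideals of \<open>L\<close> are down-closed for it and
  hence occur in \<open>L'\<close>.\<close>

lemma subset_chain_iff:
  assumes "ideal_chain (L' :: 'p::{finite,order} set list)"
  shows "set L \<subseteq> set L' \<longleftrightarrow> (\<forall>p q. chain_le L' p q \<longrightarrow> chain_le L p q)"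
proof
  assume *: "\<forall>p q. chain_le L' p q \<longrightarrow> chain_le L p q"
  show "set L \<subseteq> set L'"
  proof
    fix I assume "I \<in> set L"
    then show "I \<in> set L'"
      by (intro down_closed_mem_chain[OF assms]) (use * in \<open>auto simp: chain_le_def\<close>)
  qed
qed (auto simp: chain_le_def)

text \<open>Equal marks within a block and increasing marks along blocks together say that the
  preorder of \<open>L\<close> agrees on \<open>Ps\<close> with the order of the marks.\<close>

lemma admissible_iff:
  "L \<in> admissible_chains Ps lam \<longleftrightarrow>
     ideal_chain L \<and> (\<forall>a\<in>Ps. \<forall>b\<in>Ps. chain_le L a b \<longleftrightarrow> lam a \<le> lam b)"
proof (cases "ideal_chain L")
  case L: True
  let ?m = "chain_length L" and ?i = "block_index L"
  note bi = block_index(1)[OF L]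
  have img: "lam ` (block L i \<inter> Ps) = {lam a |a. a \<in> Ps \<and> ?i a = i}" if "i \<in> {1..?m}" for i
    using block_iff[OF L that] by auto
  have "L \<in> admissible_chains Ps lam \<longleftrightarrow>
    (\<forall>i\<in>{1..?m}. \<forall>a\<in>Ps. \<forall>b\<in>Ps. ?i a = i \<and> ?i b = i \<longrightarrow> lam a = lam b) \<and>
    (\<forall>i\<in>{1..?m}. \<forall>j\<in>{1..?m}. \<forall>s t. i < j \<and> {lam a |a. a \<in> Ps \<and> ?i a = i} = {s} \<and>
         {lam a |a. a \<in> Ps \<and> ?i a = j} = {t} \<longrightarrow> s < t)" (is "_ \<longleftrightarrow> ?A \<and> ?B")
  proof -
    have "(lam ` (block L i \<inter> Ps) = {} \<or> (\<exists>t. lam ` (block L i \<inter> Ps) = {t})) \<longleftrightarrow>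
       (\<forall>a\<in>Ps. \<forall>b\<in>Ps. ?i a = i \<and> ?i b = i \<longrightarrow> lam a = lam b)" if "i \<in> {1..?m}" for i
    proof -
      have *: "S = {} \<or> (\<exists>t. S = {t}) \<longleftrightarrow> (\<forall>s\<in>S. \<forall>t\<in>S. s = t)" for S :: "real set"
      proof (cases "S = {}")
        case False
        then obtain s where "s \<in> S" by blast
        then show ?thesis by (metis empty_iff insert_iff is_singletonI' is_singleton_the_elem)
      qed simp
      show ?thesis unfolding img[OF that] * by auto
    qed
    moreover have "(\<forall>i\<in>{1..?m}. \<forall>j\<in>{1..?m}. \<forall>s t.
        i < j \<and> lam ` (block L i \<inter> Ps) = {s} \<and> lam ` (block L j \<inter> Ps) = {t} \<longrightarrow> s < t) \<longleftrightarrow> ?B"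
      by (intro ball_cong refl) (simp only: img)
    ultimately show ?thesis
      unfolding admissible_chains_def mem_Collect_eq by (simp only: L simp_thms cong: ball_cong)
  qed
  also have "?A \<and> ?B \<longleftrightarrow> (\<forall>a\<in>Ps. \<forall>b\<in>Ps. (?i a = ?i b \<longrightarrow> lam a = lam b) \<and> (?i a < ?i b \<longrightarrow> lam a < lam b))"
    (is "_ \<longleftrightarrow> ?C")
  proof
    assume AB: "?A \<and> ?B"
    show ?C
    proof (intro ballI conjI impI)
      fix a b assume ab: "a \<in> Ps" "b \<in> Ps"
      show "lam a = lam b" if "?i a = ?i b" using AB ab that bi by blast
      \<comment> \<open>The monotonicity clause speaks only about blocks whose mark set is a
        singleton, so this has to be established before the clause can be applied.\<close>
      have single: "{lam a' |a'. a' \<in> Ps \<and> ?i a' = ?i c} = {lam c}" if "c \<in> Ps" for c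
        using AB that bi[of c] by blast
      show "lam a < lam b" if "?i a < ?i b"
        using AB single[OF ab(1)] single[OF ab(2)] bi that by blast
    qed
  next
    assume C: ?C
    show "?A \<and> ?B"
    proof
      show ?A
      proof (intro ballI impI, elim conjE)
        fix i a b assume "a \<in> Ps" "b \<in> Ps" "?i a = i" "?i b = i"
        then show "lam a = lam b" using C by metis
      qed
      show ?B
      proof (intro ballI allI impI, elim conjE)
        fix i j s t assume ij: "i < j" and s: "{lam a |a. a \<in> Ps \<and> ?i a = i} = {s}"
          and t: "{lam a |a. a \<in> Ps \<and> ?i a = j} = {t}"
        have "s \<in> {lam a |a. a \<in> Ps \<and> ?i a = i}" "t \<in> {lam a |a. a \<in> Ps \<and> ?i a = j}"
          unfolding s t by simp_all
        then obtain a b where "a \<in> Ps" "?i a = i" "lam a = s" "b \<in> Ps" "?i b = j" "lam b = t"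
          by auto
        then show "s < t" using C ij by metis
      qed
    qed
  qed
  also have "\<dots> \<longleftrightarrow> (\<forall>a\<in>Ps. \<forall>b\<in>Ps. chain_le L a b \<longleftrightarrow> lam a \<le> lam b)"
    unfolding chain_le_iff[OF L] by (smt (verit, best) linorder_not_le nless_le order_le_less)
  finally show ?thesis using L by simp
qed (simp add: admissible_chains_def)

section \<open>Length and dimension of admissible chains\<close>

lemma card_image_eq_if:
  assumes "\<And>a b. a \<in> A \<Longrightarrow> b \<in> A \<Longrightarrow> f a = f b \<longleftrightarrow> g a = g b"
  shows "card (f ` A) = card (g ` A)"
proof -
  have "bij_betw (\<lambda>y. g (SOME a. a \<in> A \<and> f a = y)) (f ` A) (g ` A)"
  proof -
    have *: "g (SOME a. a \<in> A \<and> f a = f b) = g b" if "b \<in> A" for b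
      using assms[of "SOME a. a \<in> A \<and> f a = f b" b] someI[of "\<lambda>a. a \<in> A \<and> f a = f b" b] that by auto
    show ?thesis
      unfolding bij_betw_def inj_on_def using * assms by (auto simp: image_iff)
  qed
  then show ?thesis by (rule bij_betw_same_card)
qed

text \<open>The blocks with marked elements correspond to the values of \<open>lam\<close>, so their
  number is the same for every admissible chain. Thus dimension and length grow together under
  refinement.\<close>

lemma chain_length_eq_dim:
  assumes "L \<in> admissible_chains (Ps :: 'p::{finite,order} set) lam"
  shows "chain_length L = chain_dim Ps L + card (lam ` Ps)"
proof -
  have L: "ideal_chain L" and le: "\<And>a b. a \<in> Ps \<Longrightarrow> b \<in> Ps \<Longrightarrow> chain_le L a b \<longleftrightarrow> lam a \<le> lam b"
    using assms by (auto simp: admissible_iff)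
  have bi: "block L i \<inter> Ps = {} \<longleftrightarrow> i \<notin> block_index L ` Ps" if "i \<in> {1..chain_length L}" for i
    using block_iff[OF L that] by auto
  have "{1..chain_length L} = {i\<in>{1..chain_length L}. block L i \<inter> Ps = {}} \<union> block_index L ` Ps"
  proof (intro equalityI subsetI)
    fix i assume "i \<in> {1..chain_length L}"
    then show "i \<in> {i\<in>{1..chain_length L}. block L i \<inter> Ps = {}} \<union> block_index L ` Ps"
      using bi[of i] by simp
  next
    fix i assume "i \<in> {i\<in>{1..chain_length L}. block L i \<inter> Ps = {}} \<union> block_index L ` Ps"
    then show "i \<in> {1..chain_length L}" using block_index(1)[OF L] by auto
  qed
  moreover have "{i\<in>{1..chain_length L}. block L i \<inter> Ps = {}} \<inter> block_index L ` Ps = {}"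
    using bi by blast
  ultimately have "card {1..chain_length L} = chain_dim Ps L + card (block_index L ` Ps)"
    unfolding chain_dim_def by (metis (no_types, lifting) card_Un_disjoint finite_Un finite_atLeastAtMost)
  moreover have "card (block_index L ` Ps) = card (lam ` Ps)"
    by (rule card_image_eq_if) (use le chain_le_iff[OF L] in \<open>metis antisym order_refl\<close>)
  ultimately show ?thesis by simp
qed

lemma card_set_chain: "ideal_chain L \<Longrightarrow> card (set L) = Suc (chain_length L)"
  using ideal_chain_distinct ideal_chain_ends(4) distinct_card by metis

lemma chain_dim_less:
  assumes "L \<in> admissible_chains (Ps :: 'p::{finite,order} set) lam" "L' \<in> admissible_chains Ps lam" "set L \<subset> set L'"
  shows "chain_dim Ps L < chain_dim Ps L'"
proof -
  have "ideal_chain L" "ideal_chain L'" using assms(1,2) by (simp_all add: admissible_iff)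
  then show ?thesis
    using psubset_card_mono[OF _ assms(3)] chain_length_eq_dim[OF assms(1)] chain_length_eq_dim[OF assms(2)]
      card_set_chain[of L] card_set_chain[of L'] by simp
qed

section \<open>Open cells and inclusion of cells as refinement of chains\<close>

definition open_cell :: "'p::{finite,order} set \<Rightarrow> ('p \<Rightarrow> real) \<Rightarrow> 'p set list \<Rightarrow> (real, 'p) vec set" where
  "open_cell Ps lam L = {x. (\<forall>a\<in>Ps. x $ a = lam a) \<and> (\<forall>p q. chain_le L p q \<longleftrightarrow> x $ p \<le> x $ q)}"

lemma chain_polytope_iff:
  assumes L: "ideal_chain (L :: 'p::{finite,order} set list)"
  shows "x \<in> chain_polytope Ps lam L \<longleftrightarrow>
    (\<forall>a\<in>Ps. x $ a = lam a) \<and> (\<forall>p q. chain_le L p q \<longrightarrow> x $ p \<le> x $ q)" (is "_ \<longleftrightarrow> ?R")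
proof
  assume x: "x \<in> chain_polytope Ps lam L"
  \<comment> \<open>Inequalities between adjacent blocks are composed by induction on the distance
    \<open>n\<close> of the blocks. Blocks are nonempty, which supplies an intermediate element
    \<open>r\<close>.\<close>
  have *: "x $ p \<le> x $ q" if "block_index L q = block_index L p + n" for n p q
    using that
  proof (induction n arbitrary: q)
    case 0
    then have "q \<in> block L (block_index L p)" using block_index(2)[OF L, of q] by simp
    then have "x $ p = x $ q"
      using x block_index[OF L, of p] unfolding chain_polytope_def by blast
    then show ?case by simp
  next
    case (Suc n)
    have i: "block_index L p + n \<in> {1..chain_length L}" "block_index L p + n \<in> {1..<chain_length L}"
      using Suc.prems block_index(1)[OF L, of q] block_index(1)[OF L, of p] by auto
    then obtain r where r: "r \<in> block L (block_index L p + n)" using block_nonempty[OF L] by blast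
    then have "x $ p \<le> x $ r" using Suc.IH block_index_eq[OF L i(1)] by simp
    also have "x $ r \<le> x $ q"
      using x r i(2) block_index(2)[OF L, of q] Suc.prems unfolding chain_polytope_def by simp
    finally show ?case .
  qed
  show ?R
    using x * unfolding chain_le_iff[OF L] chain_polytope_def by (auto simp: le_iff_add)
next
  assume x: ?R
  have le: "x $ p \<le> x $ q" if "i \<in> {1..chain_length L}" "j \<in> {1..chain_length L}" "p \<in> block L i" "q \<in> block L j" "i \<le> j" for p q i j
    using x that block_index_eq[OF L] chain_le_iff[OF L] by metis
  show "x \<in> chain_polytope Ps lam L"
    unfolding chain_polytope_def
  proof (intro CollectI conjI ballI)
    fix i p q assume "i \<in> {1..chain_length L}" "p \<in> block L i" "q \<in> block L i"
    then show "x $ p = x $ q" using le[of i i p q] le[of i i q p] by simp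
  next
    fix i p q assume "i \<in> {1..<chain_length L}" "p \<in> block L i" "q \<in> block L (Suc i)"
    then show "x $ p \<le> x $ q" using le[of i "Suc i" p q] by simp
  qed (use x in auto)
qed

lemma open_cell_subset: "ideal_chain L \<Longrightarrow> open_cell Ps lam L \<subseteq> chain_polytope Ps lam L"
  by (auto simp: chain_polytope_iff open_cell_def)

lemma exists_between_finite:
  fixes A B :: "real set"
  assumes "finite A" "finite B" "\<And>a b. a \<in> A \<Longrightarrow> b \<in> B \<Longrightarrow> a < b"
  shows "\<exists>r. (\<forall>a\<in>A. a < r) \<and> (\<forall>b\<in>B. r < b)"
proof (cases "A = {} \<or> B = {}")
  case True
  have "\<forall>a\<in>A. a < Max A + 1" "\<forall>b\<in>B. Min B - 1 < b"
    using Max_ge[OF assms(1)] Min_le[OF assms(2)] by (smt (verit))+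
  then show ?thesis using True by blast
next
  case False
  then have "Max A < Min B" using assms by simp
  then obtain r where "Max A < r" "r < Min B" using dense by blast
  then show ?thesis using assms False by auto
qed

text \<open>Extends the marks from the marked blocks to all blocks, one index at a time.\<close>

lemma strict_mono_extension:
  fixes f :: "nat \<Rightarrow> real"
  assumes "finite A" "finite D" "strict_mono_on A f"
  shows "\<exists>g. strict_mono_on (A \<union> D) g \<and> (\<forall>i\<in>A. g i = f i)"
  using assms(2)
proof (induction D)
  case empty
  then show ?case using assms(3) by (intro exI[of _ f]) simp
next
  case (insert d D)
  then obtain g where g: "strict_mono_on (A \<union> D) g" "\<forall>i\<in>A. g i = f i" by auto
  show ?case
  proof (cases "d \<in> A")
    case True
    then have "A \<union> insert d D = A \<union> D" by auto
    then show ?thesis using g by auto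
  next
    case False
    \<comment> \<open>The value at \<open>d\<close> has to lie above the values to its left and
      below those to its right; these are finite sets of reals, the first below the second.\<close>
    have "\<exists>r. (\<forall>a\<in>g ` {i\<in>A \<union> D. i < d}. a < r) \<and> (\<forall>b\<in>g ` {i\<in>A \<union> D. d < i}. r < b)"
      by (rule exists_between_finite)
         (use g(1) assms(1) insert.hyps in \<open>auto simp: strict_mono_on_def\<close>)
    then obtain r where r: "\<And>i. i \<in> A \<union> D \<Longrightarrow> i < d \<Longrightarrow> g i < r" "\<And>i. i \<in> A \<union> D \<Longrightarrow> d < i \<Longrightarrow> r < g i"
      by blast
    have "strict_mono_on (A \<union> insert d D) (g(d := r))"
      unfolding strict_mono_on_def
    proof (intro allI impI, elim conjE)
      fix i j assume "i \<in> A \<union> insert d D" "j \<in> A \<union> insert d D" "i < j"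
      then show "(g(d := r)) i < (g(d := r)) j"
        using r g(1) unfolding strict_mono_on_def by auto
    qed
    moreover have "\<forall>i\<in>A. (g(d := r)) i = f i" using g(2) False by auto
    ultimately show ?thesis by blast
  qed
qed

text \<open>By admissibility the marks are a strictly increasing function of the block index; any
  strictly increasing extension to all blocks gives a point with exactly the preorder of
  \<open>L\<close>.\<close>

lemma open_cell_nonempty:
  assumes "L \<in> admissible_chains (Ps :: 'p::{finite,order} set) lam"
  shows "open_cell Ps lam L \<noteq> {}"
proof -
  have L: "ideal_chain L" and le: "\<And>a b. a \<in> Ps \<Longrightarrow> b \<in> Ps \<Longrightarrow> chain_le L a b \<longleftrightarrow> lam a \<le> lam b"
    using assms by (auto simp: admissible_iff)
  let ?i = "block_index L"
  \<comment> \<open>The mark of block \<open>k\<close>, with an arbitrary value if the block has no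
    marked element.\<close>
  define f where "f k = lam (SOME a. a \<in> Ps \<and> ?i a = k)" for k
  have f: "f (?i a) = lam a" if "a \<in> Ps" for a
  proof -
    let ?b = "SOME b. b \<in> Ps \<and> ?i b = ?i a"
    have "?b \<in> Ps \<and> ?i ?b = ?i a" by (rule someI[of _ a]) (use that in auto)
    then show ?thesis
      unfolding f_def using le[of ?b a] le[of a ?b] that by (auto simp: chain_le_iff[OF L])
  qed
  have "strict_mono_on (?i ` Ps) f"
    unfolding strict_mono_on_def using f le by (auto simp: chain_le_iff[OF L] not_le[symmetric])
  then obtain g where g: "strict_mono_on (?i ` Ps \<union> {1..chain_length L}) g" "\<And>k. k \<in> ?i ` Ps \<Longrightarrow> g k = f k"
    using strict_mono_extension[of "?i ` Ps" "{1..chain_length L}" f] by auto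
  have "g (?i p) \<le> g (?i q) \<longleftrightarrow> ?i p \<le> ?i q" for p q
    using g(1) block_index(1)[OF L] by (intro strict_mono_on_less_eq) auto
  then have "(\<chi> p. g (?i p)) \<in> open_cell Ps lam L"
    using g(2) f by (auto simp: open_cell_def chain_le_iff[OF L])
  then show ?thesis by auto
qed

text \<open>A point of the open cell realizes the preorder of \<open>L\<close> exactly, so any cell
  containing it belongs to a chain with a smaller preorder, that is, to a refinement.\<close>

lemma cell_contains_imp_subset:
  assumes "ideal_chain L" "ideal_chain L'" "x \<in> open_cell Ps lam L" "x \<in> chain_polytope Ps lam L'"
  shows "set L \<subseteq> set L'"
  unfolding subset_chain_iff[OF assms(2)]
  using assms(3,4) by (auto simp: open_cell_def chain_polytope_iff[OF assms(2)])

lemma chain_polytope_mono: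
  assumes "ideal_chain L" "ideal_chain L'" "set L \<subseteq> set L'"
  shows "chain_polytope Ps lam L \<subseteq> chain_polytope Ps lam L'"
  using assms(3) by (auto simp: chain_polytope_iff assms(1,2) subset_chain_iff)

lemma chain_polytope_subset_iff:
  assumes "L \<in> admissible_chains Ps lam" "L' \<in> admissible_chains Ps lam"
  shows "chain_polytope Ps lam L \<subseteq> chain_polytope Ps lam L' \<longleftrightarrow> set L \<subseteq> set L'"
proof -
  have L: "ideal_chain L" "ideal_chain L'" using assms by (auto simp: admissible_iff)
  obtain x where "x \<in> open_cell Ps lam L" using open_cell_nonempty[OF assms(1)] by auto
  then show ?thesis
    using cell_contains_imp_subset[OF L] chain_polytope_mono[OF L] open_cell_subset[OF L(1)] by blast
qed

lemma inj_chain_polytope: "inj_on (chain_polytope Ps lam) (admissible_chains Ps lam)"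
proof (rule inj_onI)
  fix L L' assume L: "L \<in> admissible_chains Ps lam" "L' \<in> admissible_chains Ps lam"
    and "chain_polytope Ps lam L = chain_polytope Ps lam L'"
  then have "set L = set L'"
    using chain_polytope_subset_iff[OF L] chain_polytope_subset_iff[OF L(2,1)] by simp
  then show "L = L'" using L ideal_chain_eqI by (auto simp: admissible_iff)
qed

text \<open>The sublevel sets start at the least coordinate and are nonempty; the prepended
  \<open>{}\<close> supplies the ideal at index 0.\<close>

definition level_chain :: "(real, 'p::{finite,order}) vec \<Rightarrow> 'p set list" where
  "level_chain x = {} # map (\<lambda>t. {p. x $ p \<le> t}) (sorted_list_of_set (range (($) x)))"

lemma set_level_chain: "set (level_chain x) = insert {} ((\<lambda>q. {p. x $ p \<le> x $ q}) ` UNIV)"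
  by (auto simp: level_chain_def)

lemma chain_le_level: "chain_le (level_chain x) p q \<longleftrightarrow> x $ p \<le> x $ q"
  by (fastforce simp: chain_le_def set_level_chain)

lemma ideal_chain_level:
  assumes "\<And>p q. p \<le> q \<Longrightarrow> x $ p \<le> x $ q"
  shows "ideal_chain (level_chain x)"
proof -
  let ?V = "range (($) x)"
  have "sorted_wrt (\<subset>) (map (\<lambda>t. {p. x $ p \<le> t}) (sorted_list_of_set ?V))"
    unfolding sorted_wrt_map
  proof (rule sorted_wrt_mono_rel)
    show "sorted_wrt (<) (sorted_list_of_set ?V)"
      by (rule strict_sorted_list_of_set)
    fix s t assume "s \<in> set (sorted_list_of_set ?V)" "t \<in> set (sorted_list_of_set ?V)" "s < t"
    then obtain q where "t = x $ q" by auto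
    then have "q \<in> {p. x $ p \<le> t}" "q \<notin> {p. x $ p \<le> s}" using \<open>s < t\<close> by auto
    moreover have "{p. x $ p \<le> s} \<subseteq> {p. x $ p \<le> t}" using \<open>s < t\<close> by auto
    ultimately show "{p. x $ p \<le> s} \<subset> {p. x $ p \<le> t}" by blast
  qed
  then have s: "sorted_wrt (\<subset>) (level_chain x)"
    by (auto simp: level_chain_def)
  have "last (level_chain x) = UNIV"
  proof -
    have ne: "sorted_list_of_set ?V \<noteq> []" by simp
    then have "last (level_chain x) = {p. x $ p \<le> last (sorted_list_of_set ?V)}"
      by (simp add: level_chain_def last_map)
    moreover have "t \<le> last (sorted_list_of_set ?V)" if "t \<in> ?V" for t
    proof -
      have "t \<in> set (sorted_list_of_set ?V)" using that by simp
      then show ?thesis using ne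
        by (metis sorted_list_of_set.sorted_sorted_key_list_of_set sorted_wrt_iff_nth_less last_conv_nth in_set_conv_nth
            diff_less length_greater_0_conv less_Suc_eq_le Suc_pred' order_refl zero_less_one sorted_nth_mono)
    qed
    ultimately show ?thesis by auto
  qed
  moreover have "order_ideal I" if "I \<in> set (level_chain x)" for I
    using that assms by (auto simp: set_level_chain order_ideal_def intro: order_trans)
  moreover have "level_chain x ! (i - 1) \<subset> level_chain x ! i" if "i \<in> {1..chain_length (level_chain x)}" for i
    using that sorted_wrt_nth_less[OF s, of "i - 1" i] by (simp add: chain_length_def level_chain_def)
  ultimately show ?thesis
    unfolding ideal_chain_def by (auto simp: level_chain_def)
qed

lemma level_chain_admissible:
  assumes "x \<in> marked_order_polytope Ps lam"
  shows "level_chain x \<in> admissible_chains Ps lam" "x \<in> open_cell Ps lam (level_chain x)"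
  using assms ideal_chain_level[of x]
  by (auto simp: marked_order_polytope_def admissible_iff open_cell_def chain_le_level)

lemma chain_polytope_subset_marked:
  assumes "ideal_chain L" shows "chain_polytope Ps lam L \<subseteq> marked_order_polytope Ps lam"
  using chain_le_if_le[OF assms] by (auto simp: chain_polytope_iff[OF assms] marked_order_polytope_def)

section \<open>The cells of the subdivision\<close>

lemma nth_as_inner: "(x :: (real, 'p::finite) vec) $ p = axis p 1 \<bullet> x"
  by (simp add: inner_axis')

text \<open>The relation \<open>R\<close> is arbitrary so that the polytope (order of the poset) and
  its cells (preorder of a chain) are covered at once.\<close>

lemma polyhedron_order_constraints:
  "polyhedron {x :: (real, 'p::finite) vec. (\<forall>a\<in>Ps. x $ a = lam a) \<and> (\<forall>p q. R p q \<longrightarrow> x $ p \<le> x $ q)}"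
proof -
  have 1: "polyhedron {x :: (real, 'p) vec. x $ a = lam a}" for a
    unfolding nth_as_inner by (rule polyhedron_hyperplane)
  have 2: "polyhedron {x :: (real, 'p) vec. x $ p \<le> x $ q}" for p q
  proof -
    have "{x :: (real, 'p) vec. x $ p \<le> x $ q} = {x. (axis p 1 - axis q 1) \<bullet> x \<le> 0}"
      by (auto simp: inner_diff_left inner_axis')
    then show ?thesis using polyhedron_halfspace_le by metis
  qed
  have "{x :: (real, 'p) vec. (\<forall>a\<in>Ps. x $ a = lam a) \<and> (\<forall>p q. R p q \<longrightarrow> x $ p \<le> x $ q)}
    = \<Inter>((\<lambda>a. {x. x $ a = lam a}) ` Ps) \<inter> \<Inter>((\<lambda>(p, q). {x. x $ p \<le> x $ q}) ` {(p, q). R p q})"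
    by auto
  then show ?thesis
    using 1 2 by (auto intro!: polyhedron_Int polyhedron_Inter)
qed

lemma polyhedron_marked_order_polytope: "polyhedron (marked_order_polytope Ps lam)"
proof -
  have "marked_order_polytope Ps lam = {x. (\<forall>a\<in>Ps. x $ a = lam a) \<and> (\<forall>p q. p \<le> q \<longrightarrow> x $ p \<le> x $ q)}"
    by (auto simp: marked_order_polytope_def)
  then show ?thesis by (simp only: polyhedron_order_constraints)
qed

lemma polyhedron_chain_polytope:
  assumes "ideal_chain L" shows "polyhedron (chain_polytope Ps lam L)"
proof -
  have "chain_polytope Ps lam L = {x. (\<forall>a\<in>Ps. x $ a = lam a) \<and> (\<forall>p q. chain_le L p q \<longrightarrow> x $ p \<le> x $ q)}"
    using chain_polytope_iff[OF assms] by blast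
  then show ?thesis by (simp only: polyhedron_order_constraints)
qed

text \<open>Every element lies between a minimal and a maximal one, both marked, so each coordinate
  is squeezed between two marks.\<close>

lemma bounded_marked_order_polytope:
  fixes Ps :: "'p::{finite,order} set"
  assumes "\<And>p. (\<forall>q. \<not> q < p) \<Longrightarrow> p \<in> Ps" "\<And>p. (\<forall>q. \<not> p < q) \<Longrightarrow> p \<in> Ps"
  shows "bounded (marked_order_polytope Ps lam)"
proof -
  have "marked_order_polytope Ps lam \<subseteq> cbox (\<chi> p. Min (lam ` Ps)) (\<chi> p. Max (lam ` Ps))"
  proof
    fix x assume x: "x \<in> marked_order_polytope Ps lam"
    have "Min (lam ` Ps) \<le> x $ p \<and> x $ p \<le> Max (lam ` Ps)" for p
    proof
      obtain a where a: "a \<le> p" "\<forall>b. b \<le> a \<longrightarrow> a = b"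
        using finite_has_minimal2[of UNIV p] by auto
      then have "a \<in> Ps" using assms(1)[of a] by (metis order.strict_iff_not order_refl)
      then have "Min (lam ` Ps) \<le> lam a" by simp
      also have "lam a \<le> x $ p"
        using x \<open>a \<in> Ps\<close> a(1) unfolding marked_order_polytope_def by force
      finally show "Min (lam ` Ps) \<le> x $ p" .
      obtain b where b: "p \<le> b" "\<forall>c. b \<le> c \<longrightarrow> b = c"
        using finite_has_maximal2[of UNIV p] by auto
      then have "b \<in> Ps" using assms(2)[of b] by (metis order.strict_iff_not order_refl)
      have "x $ p \<le> x $ b" using x b(1) by (auto simp: marked_order_polytope_def)
      also have "\<dots> = lam b" using x \<open>b \<in> Ps\<close> by (auto simp: marked_order_polytope_def)
      also have "\<dots> \<le> Max (lam ` Ps)" using \<open>b \<in> Ps\<close> by simp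
      finally show "x $ p \<le> Max (lam ` Ps)" .
    qed
    then show "x \<in> cbox (\<chi> p. Min (lam ` Ps)) (\<chi> p. Max (lam ` Ps))"
      by (simp add: mem_box_cart)
  qed
  then show ?thesis using bounded_cbox bounded_subset by blast
qed

section \<open>Affine hull, relative interior and dimension of a cell\<close>

definition cell_span :: "'p::{finite,order} set \<Rightarrow> ('p \<Rightarrow> real) \<Rightarrow> 'p set list \<Rightarrow> (real, 'p) vec set" where
  "cell_span Ps lam L = {x. (\<forall>a\<in>Ps. x $ a = lam a) \<and> (\<forall>p q. chain_le L p q \<and> chain_le L q p \<longrightarrow> x $ p = x $ q)}"

lemma admissible_imp_ideal_chain: "L \<in> admissible_chains Ps lam \<Longrightarrow> ideal_chain L"
  by (simp add: admissible_chains_def)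

lemma affine_cell_span: "affine (cell_span Ps lam L)"
  unfolding affine_def
proof (intro ballI allI impI)
  fix x y u v
  assume x: "x \<in> cell_span Ps lam L" and y: "y \<in> cell_span Ps lam L" and uv: "u + v = (1::real)"
  have "u * x $ a + v * y $ a = lam a" if "a \<in> Ps" for a
  proof -
    have "x $ a = lam a" "y $ a = lam a" using x y that unfolding cell_span_def by blast+
    then show ?thesis using uv by (metis distrib_right mult_1)
  qed
  moreover have "u * x $ p + v * y $ p = u * x $ q + v * y $ q" if "chain_le L p q" "chain_le L q p" for p q
  proof -
    have "x $ p = x $ q" "y $ p = y $ q" using x y that unfolding cell_span_def by blast+
    then show ?thesis by simp
  qed
  ultimately show "u *\<^sub>R x + v *\<^sub>R y \<in> cell_span Ps lam L"
    unfolding cell_span_def by simp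
qed

text \<open>Ties cut out an affine subspace and strict inequalities an open set. An intersection of
  this kind makes both the affine hull and the relative interior of the cell accessible.\<close>

lemma open_cell_eq:
  assumes "ideal_chain L"
  shows "open_cell Ps lam L = cell_span Ps lam L \<inter> {x. \<forall>p q. \<not> chain_le L q p \<longrightarrow> x $ p < x $ q}"
proof (intro equalityI subsetI)
  fix x assume "x \<in> open_cell Ps lam L"
  then show "x \<in> cell_span Ps lam L \<inter> {x. \<forall>p q. \<not> chain_le L q p \<longrightarrow> x $ p < x $ q}"
    by (auto simp: open_cell_def cell_span_def not_le)
next
  fix x assume x: "x \<in> cell_span Ps lam L \<inter> {x. \<forall>p q. \<not> chain_le L q p \<longrightarrow> x $ p < x $ q}"
  have "chain_le L p q \<longleftrightarrow> x $ p \<le> x $ q" for p q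
  proof (cases "chain_le L p q \<and> chain_le L q p")
    case True
    then have "x $ p = x $ q" using x unfolding cell_span_def by blast
    then show ?thesis using True by simp
  next
    case False
    then show ?thesis using x chain_le_total[OF assms, of p q] by (force simp: not_le)
  qed
  then show "x \<in> open_cell Ps lam L" using x by (auto simp: open_cell_def cell_span_def)
qed

lemma open_strict: "open {x :: (real, 'p::finite) vec. \<forall>p q. R p q \<longrightarrow> x $ p < x $ q}"
proof -
  have "{x :: (real, 'p) vec. \<forall>p q. R p q \<longrightarrow> x $ p < x $ q} = (\<Inter>(p, q)\<in>{(p, q). R p q}. {x. x $ p < x $ q})"
    by auto
  moreover have "open {x :: (real, 'p) vec. x $ p < x $ q}" for p q
    by (intro open_Collect_less continuous_intros)
  ultimately show ?thesis by (auto intro!: open_INT)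
qed

lemma chain_polytope_subset_span:
  "ideal_chain L \<Longrightarrow> chain_polytope Ps lam L \<subseteq> cell_span Ps lam L"
  by (auto simp: chain_polytope_iff cell_span_def intro: antisym)

lemma convex_chain_polytope: "ideal_chain L \<Longrightarrow> convex (chain_polytope Ps lam L)"
  using polyhedron_chain_polytope polyhedron_imp_convex by blast

lemma affine_hull_chain_polytope:
  assumes "L \<in> admissible_chains Ps lam"
  shows "affine hull (chain_polytope Ps lam L) = cell_span Ps lam L"
proof -
  have L: "ideal_chain L" using assms by (rule admissible_imp_ideal_chain)
  have "affine hull (open_cell Ps lam L) = affine hull (cell_span Ps lam L)"
    unfolding open_cell_eq[OF L]
    by (rule affine_hull_affine_Int_open[OF affine_cell_span open_strict])
       (use open_cell_nonempty[OF assms] in \<open>simp add: open_cell_eq[OF L]\<close>)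
  then have "affine hull (open_cell Ps lam L) = cell_span Ps lam L"
    using affine_cell_span by (simp add: affine_hull_eq)
  moreover have "affine hull (open_cell Ps lam L) \<subseteq> affine hull (chain_polytope Ps lam L)"
    by (rule hull_mono[OF open_cell_subset[OF L]])
  moreover have "affine hull (chain_polytope Ps lam L) \<subseteq> cell_span Ps lam L"
    by (rule hull_minimal) (simp_all add: chain_polytope_subset_span[OF L] affine_cell_span)
  ultimately show ?thesis by auto
qed

lemma rel_interior_chain_polytope:
  assumes "L \<in> admissible_chains Ps lam"
  shows "rel_interior (chain_polytope Ps lam L) = open_cell Ps lam L"
proof
  have L: "ideal_chain L" using assms by (rule admissible_imp_ideal_chain)
  show "open_cell Ps lam L \<subseteq> rel_interior (chain_polytope Ps lam L)"
  proof (rule rel_interior_maximal[OF open_cell_subset[OF L]])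
    show "openin (top_of_set (affine hull (chain_polytope Ps lam L))) (open_cell Ps lam L)"
      unfolding affine_hull_chain_polytope[OF assms] open_cell_eq[OF L]
      using open_strict by (rule openin_open_Int)
  qed
  obtain y where y: "y \<in> open_cell Ps lam L" using open_cell_nonempty[OF assms] by auto
  show "rel_interior (chain_polytope Ps lam L) \<subseteq> open_cell Ps lam L"
  proof
    fix x assume x: "x \<in> rel_interior (chain_polytope Ps lam L)"
    then have xF: "x \<in> chain_polytope Ps lam L" using rel_interior_subset by blast
    \<comment> \<open>The segment from \<open>y\<close> to the relative interior point
      \<open>x\<close> can be prolonged beyond \<open>x\<close>. If two coordinates were tied at
      \<open>x\<close> but strictly ordered at \<open>y\<close>, their order would be reversed
      there.\<close>
    obtain e where e: "e > 1" "(1 - e) *\<^sub>R y + e *\<^sub>R x \<in> chain_polytope Ps lam L"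
      using x y open_cell_subset[OF L] convex_rel_interior_iff[OF convex_chain_polytope[OF L]] xF by blast
    have "x $ p < x $ q" if pq: "\<not> chain_le L q p" for p q
    proof -
      have le: "chain_le L p q" using chain_le_total[OF L] pq by blast
      then have "x $ p \<le> x $ q" using xF by (simp add: chain_polytope_iff[OF L])
      moreover have "x $ p \<noteq> x $ q"
      proof
        assume eq: "x $ p = x $ q"
        have "(1 - e) * y $ p + e * x $ p \<le> (1 - e) * y $ q + e * x $ q"
          using e(2) le by (simp add: chain_polytope_iff[OF L])
        then have "(1 - e) * y $ p \<le> (1 - e) * y $ q" using eq by simp
        then have "y $ q \<le> y $ p" using e(1) by (simp add: mult_le_cancel_left)
        then show False using y pq by (simp add: open_cell_def)
      qed
      ultimately show ?thesis by simp
    qed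
    then show "x \<in> open_cell Ps lam L"
      unfolding open_cell_eq[OF L] using xF chain_polytope_subset_span[OF L] by blast
  qed
qed

text \<open>The direction space of the affine hull consists of the vectors that are constant on
  blocks and zero on marked elements. The indicators of the unmarked blocks form an orthogonal basis
  of it.\<close>

lemma aff_dim_chain_polytope:
  fixes Ps :: "'p::{finite,order} set"
  assumes "L \<in> admissible_chains Ps lam"
  shows "aff_dim (chain_polytope Ps lam L) = int (chain_dim Ps L)"
proof -
  have L: "ideal_chain L" using assms by (rule admissible_imp_ideal_chain)
  define W where "W = cell_span Ps (\<lambda>_. 0) L"
  obtain x where x: "x \<in> cell_span Ps lam L"
    using open_cell_nonempty[OF assms] open_cell_eq[OF L] by blast
  have sp: "cell_span Ps lam L = (+) x ` W"
  proof (intro equalityI subsetI)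
    fix y assume "y \<in> cell_span Ps lam L"
    then have "y - x \<in> W" using x unfolding W_def cell_span_def by simp
    then show "y \<in> (+) x ` W" by (metis add_diff_cancel_left' add.commute diff_add_cancel image_eqI)
  next
    fix y assume "y \<in> (+) x ` W"
    then obtain w where "w \<in> W" "y = x + w" by auto
    then show "y \<in> cell_span Ps lam L" using x unfolding W_def cell_span_def by simp
  qed
  have subsp: "subspace W"
    unfolding W_def subspace_def cell_span_def by simp
  define I where "I = {i\<in>{1..chain_length L}. block L i \<inter> Ps = {}}"
  define ind :: "nat \<Rightarrow> (real, 'p) vec" where "ind i = (\<chi> p. of_bool (block_index L p = i))" for i
  have rep: "\<exists>p. block_index L p = i" if "i \<in> I" for i
    using that block_nonempty[OF L, of i] block_iff[OF L, of i] by (auto simp: I_def)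
  have ind_nz: "ind i \<noteq> 0" if "i \<in> I" for i
    using rep[OF that] by (auto simp: ind_def vec_eq_iff)
  have orth: "ind i \<bullet> ind j = 0" if "i \<noteq> j" for i j
    using that by (auto simp: ind_def inner_vec_def intro!: sum.neutral)
  have inj: "inj_on ind I"
    by (rule inj_onI) (metis ind_nz inner_eq_zero_iff orth)
  have W: "ind i \<in> W" if "i \<in> I" for i
  proof -
    have "block_index L a \<noteq> i" if "a \<in> Ps" for a
      using that \<open>i \<in> I\<close> block_iff[OF L, of i a] by (auto simp: I_def)
    then show ?thesis by (auto simp: W_def cell_span_def ind_def chain_le_iff[OF L])
  qed
  have "pairwise orthogonal (ind ` I)"
    unfolding pairwise_def orthogonal_def by (metis imageE orth)
  then have ind_indep: "independent (ind ` I)"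
    by (rule pairwise_orthogonal_independent) (use ind_nz in auto)
  have span: "W \<subseteq> span (ind ` I)"
  proof
    fix w assume w: "w \<in> W"
    define r where "r i = (SOME p. block_index L p = i)" for i
    have r: "block_index L (r (block_index L p)) = block_index L p" for p
      unfolding r_def by (rule someI[of _ p]) simp
    have const: "w $ p = w $ q" if "block_index L p = block_index L q" for p q
      using w that unfolding W_def cell_span_def chain_le_iff[OF L] by simp
    have "w = (\<Sum>i\<in>I. w $ r i *\<^sub>R ind i)"
    proof (rule vec_eq_iff[THEN iffD2], rule allI)
      fix p
      have "(\<Sum>i\<in>I. w $ r i *\<^sub>R ind i) $ p = (\<Sum>i\<in>I. if i = block_index L p then w $ r i else 0)"
        by (auto simp: ind_def intro!: sum.cong)
      also have "\<dots> = (if block_index L p \<in> I then w $ r (block_index L p) else 0)"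
        by (simp add: I_def)
      also have "\<dots> = w $ p"
      proof (cases "block_index L p \<in> I")
        case True
        then show ?thesis using const[OF r] by simp
      next
        case False
        \<comment> \<open>A block outside \<open>I\<close> contains a marked element, where
          \<open>w\<close> is zero; being constant on the block, \<open>w\<close> vanishes at
          \<open>p\<close> too.\<close>
        then obtain a where "a \<in> Ps" "block_index L a = block_index L p"
          using block_index(1)[OF L, of p] block_iff[OF L, of "block_index L p"] by (auto simp: I_def)
        moreover have "w $ a = 0" using w \<open>a \<in> Ps\<close> by (simp add: W_def cell_span_def)
        ultimately show ?thesis using const[of a p] False by simp
      qed
      finally show "w $ p = (\<Sum>i\<in>I. w $ r i *\<^sub>R ind i) $ p" by simp
    qed
    also have "\<dots> \<in> span (ind ` I)"
      by (intro span_sum span_scale span_base) auto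
    finally show "w \<in> span (ind ` I)" .
  qed
  have "dim W = card (ind ` I)"
    using basis_card_eq_dim[OF _ span ind_indep] image_subsetI[of I ind W, OF W] by simp
  also have "\<dots> = chain_dim Ps L"
    using card_image[OF inj] by (simp add: chain_dim_def I_def)
  finally have d: "dim W = chain_dim Ps L" .
  have "aff_dim (chain_polytope Ps lam L) = aff_dim (cell_span Ps lam L)"
    using affine_hull_chain_polytope[OF assms] aff_dim_affine_hull by metis
  also have "\<dots> = int (dim W)"
    unfolding sp by (simp add: aff_dim_translation_eq aff_dim_subspace subsp)
  finally show ?thesis using d by simp
qed

section \<open>Conjugated densifications and faces\<close>

text \<open>Take a face of least dimension containing \<open>F\<close>. If \<open>F\<close> were in
  its relative frontier, an interior point of \<open>F\<close> would lie in a facet, which would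
  then contain all of \<open>F\<close>.\<close>

lemma subset_face_interior:
  fixes M :: "'a::euclidean_space set"
  assumes "polyhedron M" "convex F" "F \<noteq> {}" "F \<subseteq> M"
  obtains A where "A face_of M" "F \<subseteq> A" "\<not> F \<subseteq> rel_frontier A"
proof -
  define P where "P A \<longleftrightarrow> A face_of M \<and> F \<subseteq> A" for A
  have "P M" using assms face_of_refl[OF polyhedron_imp_convex[OF assms(1)]] by (simp add: P_def)
  \<comment> \<open>The empty set has dimension -1, hence the shift by one before passing to natural
    numbers.\<close>
  then obtain A where A: "P A" "\<And>C. P C \<Longrightarrow> nat (aff_dim A + 1) \<le> nat (aff_dim C + 1)"
    using ex_has_least_nat[of P M "\<lambda>A. nat (aff_dim A + 1)"] by blast
  have "\<not> F \<subseteq> rel_frontier A"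
  proof
    assume fr: "F \<subseteq> rel_frontier A"
    obtain x where x: "x \<in> rel_interior F"
      using assms rel_interior_eq_empty by auto
    have "polyhedron A" using A(1) assms(1) face_of_polyhedron_polyhedron P_def by blast
    then have "x \<in> \<Union>{C. C facet_of A}"
      using rel_frontier_of_polyhedron[of A] fr x rel_interior_subset[of F] by auto
    then obtain C where C: "C facet_of A" "x \<in> C" by blast
    then have "F \<subseteq> C"
      using A(1) x by (intro subset_of_face_of[of C A]) (auto simp: P_def facet_of_def)
    moreover have "C face_of M"
      using C A(1) face_of_trans by (auto simp: P_def facet_of_def)
    ultimately have "nat (aff_dim A + 1) \<le> nat (aff_dim C + 1)" using A(2) by (simp add: P_def)
    moreover have "aff_dim C = aff_dim A - 1" "C \<noteq> {}" using C by (auto simp: facet_of_def)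
    moreover have "aff_dim C \<ge> 0" using \<open>C \<noteq> {}\<close> by (smt (verit) aff_dim_empty aff_dim_geq)
    ultimately show False by simp
  qed
  with A(1) show ?thesis using that unfolding P_def by blast
qed

text \<open>The relative interiors of both faces contain that of \<open>F\<close>, and faces with
  intersecting relative interiors coincide.\<close>

lemma subset_face_interior_unique:
  fixes M :: "'a::euclidean_space set"
  assumes "convex M" "convex F" "F \<noteq> {}" "A face_of M" "F \<subseteq> A" "\<not> F \<subseteq> rel_frontier A"
    "A' face_of M" "F \<subseteq> A'" "\<not> F \<subseteq> rel_frontier A'"
  shows "A = A'"
proof -
  have c: "convex A" "convex A'" using assms face_of_imp_convex by blast+
  have "rel_interior F \<subseteq> rel_interior A" "rel_interior F \<subseteq> rel_interior A'"
    using subset_rel_interior_convex[OF assms(2) c(1) order_trans[OF assms(5) closure_subset] assms(6)]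
      subset_rel_interior_convex[OF assms(2) c(2) order_trans[OF assms(8) closure_subset] assms(9)] by auto
  moreover have "rel_interior F \<noteq> {}" using assms rel_interior_eq_empty by auto
  ultimately show ?thesis using assms(4,7) by (intro face_of_eq) auto
qed

lemma not_subset_rel_frontier_iff:
  fixes A :: "'a::euclidean_space set"
  assumes "convex A" "convex F" "F \<noteq> {}" "F \<subseteq> A"
  shows "\<not> F \<subseteq> rel_frontier A \<longleftrightarrow> rel_interior F \<subseteq> rel_interior A"
proof
  assume fr: "\<not> F \<subseteq> rel_frontier A"
  show "rel_interior F \<subseteq> rel_interior A"
    by (rule subset_rel_interior_convex[OF assms(2,1) order_trans[OF assms(4) closure_subset] fr])
next
  assume *: "rel_interior F \<subseteq> rel_interior A"
  obtain x where "x \<in> rel_interior F" using assms rel_interior_eq_empty by auto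
  then show "\<not> F \<subseteq> rel_frontier A"
    using * rel_interior_subset by (auto simp: rel_frontier_def)
qed

section \<open>Inserting one ideal into a chain\<close>

lemma ideal_chain_iff_sorted:
  "ideal_chain L \<longleftrightarrow> L \<noteq> [] \<and> hd L = {} \<and> last L = UNIV \<and> (\<forall>I\<in>set L. order_ideal I) \<and> sorted_wrt (\<subset>) L"
    (is "_ \<longleftrightarrow> ?R")
proof
  assume L: ?R
  have "L ! (i - 1) \<subset> L ! i" if "i \<in> {1..chain_length L}" for i
  proof -
    have "i < length L" "i - 1 < i" using that L by (cases L; auto simp: chain_length_def)+
    then show ?thesis using sorted_wrt_nth_less[of "(\<subset>)" L "i - 1" i] L by blast
  qed
  then show "ideal_chain L" using L by (simp add: ideal_chain_def)
qed (simp add: ideal_chain_sorted, simp add: ideal_chain_def)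

lemma set_insert_ideal: "set (insert_ideal L k J) = insert J (set L)"
  unfolding insert_ideal_def by (metis append_take_drop_id insert_is_Un list.simps(15) set_append sup_left_commute)

lemma ideal_chain_insert:
  assumes L: "ideal_chain L" and k: "k \<in> {1..chain_length L}"
    and J: "L ! (k - 1) \<subset> J" "J \<subset> L ! k" "order_ideal J"
  shows "ideal_chain (insert_ideal L k J)"
  unfolding ideal_chain_iff_sorted
proof (intro conjI)
  have kl: "k < length L" "k \<ge> 1" using k ideal_chain_ends[OF L] by auto
  note L' = L[unfolded ideal_chain_iff_sorted]
  show "insert_ideal L k J \<noteq> []" by (simp add: insert_ideal_def)
  show "hd (insert_ideal L k J) = {}" using L' kl by (cases L; cases k) (auto simp: insert_ideal_def)
  show "last (insert_ideal L k J) = UNIV" using L' kl by (simp add: insert_ideal_def)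
  show "\<forall>I\<in>set (insert_ideal L k J). order_ideal I" using L' J(3) by (simp add: set_insert_ideal)
  have below: "I \<subset> J" if "I \<in> set (take k L)" for I
  proof -
    obtain i where i: "i < k" "I = L ! i" using \<open>I \<in> set (take k L)\<close> kl by (auto simp: in_set_conv_nth)
    then have "I \<subseteq> L ! (k - 1)" using ideal_chain_mono[OF L, of i "k - 1"] k by auto
    then show ?thesis using J(1) by blast
  qed
  have above: "J \<subset> I" if "I \<in> set (drop k L)" for I
  proof -
    obtain i where "i < length (drop k L)" "I = drop k L ! i"
      using \<open>I \<in> set (drop k L)\<close> by (metis in_set_conv_nth)
    then have i: "k + i < length L" "I = L ! (k + i)" by auto
    then have "L ! k \<subseteq> I" using ideal_chain_mono[OF L, of k "k + i"] ideal_chain_ends(4)[OF L] by auto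
    then show ?thesis using J(2) by blast
  qed
  show "sorted_wrt (\<subset>) (insert_ideal L k J)"
    unfolding insert_ideal_def sorted_wrt_append sorted_wrt.simps
    using L' below above by (auto intro: sorted_wrt_take sorted_wrt_drop)
qed

lemma chain_le_insert:
  "chain_le (insert_ideal L k J) p q \<longleftrightarrow> chain_le L p q \<and> (q \<in> J \<longrightarrow> p \<in> J)"
  by (auto simp: chain_le_def set_insert_ideal)

text \<open>There is exactly one new ideal. Deleting it from \<open>L'\<close> leaves a strictly
  increasing list with the same members as \<open>L\<close>, hence \<open>L\<close> itself, and the
  place of deletion is the position \<open>k\<close>.\<close>

lemma subset_chain_insert:
  assumes L: "ideal_chain (L :: 'p::{finite,order} set list)" and L': "ideal_chain L'"
    and sub: "set L \<subseteq> set L'" and len: "chain_length L' = Suc (chain_length L)"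
  obtains k J where "k \<in> {1..chain_length L}" "L' = insert_ideal L k J" "L ! (k - 1) \<subset> J" "J \<subset> L ! k"
proof -
  have "card (set L' - set L) = 1"
    using card_set_chain[OF L] card_set_chain[OF L'] len sub by (simp add: card_Diff_subset)
  then obtain J where J: "set L' - set L = {J}" by (metis card_1_singletonE)
  then obtain xs ys where L'eq: "L' = xs @ J # ys" by (metis Diff_iff insertI1 split_list)
  have "distinct L'" using ideal_chain_distinct[OF L'] .
  then have "set (xs @ ys) = set L" using J sub L'eq by auto
  moreover have s: "sorted_wrt (\<subset>) L'" using ideal_chain_sorted[OF L'] .
  then have "sorted_wrt (\<subset>) (xs @ ys)" unfolding L'eq by (auto simp: sorted_wrt_append)
  ultimately have Leq: "L = xs @ ys"
    using sorted_psubset_unique ideal_chain_sorted[OF L] by metis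
  have JL: "J \<notin> set L" using J by auto
  \<comment> \<open>The new ideal is neither first nor last, because \<open>{}\<close> and
    \<open>UNIV\<close> already belong to \<open>L\<close>.\<close>
  have "xs \<noteq> []"
  proof
    assume "xs = []"
    then have "J = {}" using L' L'eq by (simp add: ideal_chain_def)
    then show False using JL L by (metis ideal_chain_def hd_in_set)
  qed
  moreover have "ys \<noteq> []"
  proof
    assume "ys = []"
    then have "J = UNIV" using L' L'eq by (simp add: ideal_chain_def)
    then show False using JL L by (metis ideal_chain_def last_in_set)
  qed
  ultimately have "length xs \<in> {1..chain_length L}"
    using Leq by (cases xs; cases ys) (auto simp: chain_length_def)
  moreover have "L' = insert_ideal L (length xs) J"
    using Leq L'eq by (simp add: insert_ideal_def)
  moreover have "L ! (length xs - 1) \<subset> J"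
    using s Leq L'eq \<open>xs \<noteq> []\<close> by (auto simp: sorted_wrt_append nth_append)
  moreover have "J \<subset> L ! length xs"
    using s Leq L'eq \<open>ys \<noteq> []\<close> by (auto simp: sorted_wrt_append nth_append)
  ultimately show ?thesis using that by blast
qed

text \<open>At the smaller of two distinct positions one list shows the inserted ideal and the other
  an old one.\<close>

lemma insert_ideal_position:
  assumes L: "ideal_chain L" and k: "k \<in> {1..chain_length L}" "k' \<in> {1..chain_length L}"
    and J: "J \<subset> L ! k" and J': "J' \<subset> L ! k'" and eq: "insert_ideal L k J = insert_ideal L k' J'"
  shows "k = k'"
proof -
  have *: "J = L ! k" if "k < k'" "k' \<in> {1..chain_length L}" "insert_ideal L k J = insert_ideal L k' J'" for k k' J J'
  proof -
    have "k' < length L" using that ideal_chain_ends(4)[OF L] by simp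
    then have "insert_ideal L k J ! k = J" "insert_ideal L k' J' ! k = L ! k"
      using that(1) by (auto simp: insert_ideal_def nth_append)
    then show ?thesis using that by simp
  qed
  show ?thesis
    using *[of k k' J J'] *[of k' k J' J] k J J' eq by (metis linorder_neqE_nat psubset_eq)
qed

text \<open>At most one index contributes. This matters because two contributions would cancel
  modulo two.\<close>

lemma sum_Sigma_sum:
  assumes "ideal_chain L"
  shows "(\<Sum>k = 1..chain_length L. Sigma_sum Ps lam L k L')
    = of_bool (\<exists>k\<in>{1..chain_length L}. L' \<in> conjugated_densifications Ps lam L k)"
proof (cases "\<exists>k\<in>{1..chain_length L}. L' \<in> conjugated_densifications Ps lam L k")
  case True
  then obtain k where k: "k \<in> {1..chain_length L}" "L' \<in> conjugated_densifications Ps lam L k" by blast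
  have unique: "k' = k" if k': "k' \<in> {1..chain_length L}" "L' \<in> conjugated_densifications Ps lam L k'" for k'
  proof -
    obtain J where J: "L' = insert_ideal L k J" "J \<subset> L ! k"
      using k(2) unfolding conjugated_densifications_def densifying_def by blast
    obtain J' where J': "L' = insert_ideal L k' J'" "J' \<subset> L ! k'"
      using k'(2) unfolding conjugated_densifications_def densifying_def by blast
    show ?thesis
      using insert_ideal_position[OF assms k'(1) k(1) J'(2) J(2)] J(1) J'(1) by simp
  qed
  have "Sigma_sum Ps lam L k' L' = (if k' = k then 1 else 0)" if "k' \<in> {1..chain_length L}" for k'
    using unique[OF that] k(2) unfolding Sigma_sum_def by metis
  then have "(\<Sum>k' = 1..chain_length L. Sigma_sum Ps lam L k' L')
    = (\<Sum>k' = 1..chain_length L. if k' = k then 1 else 0)"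
    by (intro sum.cong) auto
  then show ?thesis using True k(1) by simp
next
  case False
  then have "(\<Sum>k = 1..chain_length L. Sigma_sum Ps lam L k L') = 0"
    by (intro sum.neutral) (auto simp: Sigma_sum_def)
  then show ?thesis using False by simp
qed

text \<open>Conjugation is complementation inside the block, so the conjugate is determined by
  \<open>J\<close>.\<close>

lemma conjugate_ideals_iff:
  assumes "L ! (k - 1) \<subset> J" "J \<subset> L ! k" "L ! (k - 1) \<subset> J'" "J' \<subset> L ! k"
  shows "conjugate_ideals L k J J' \<longleftrightarrow> J' = L ! (k - 1) \<union> (L ! k - J)"
  using assms unfolding conjugate_ideals_def by blast

text \<open>Marked elements of one block carry equal marks, so \<open>J\<close> contains all or none
  of them, and so does its complement in the block. Hence the only condition left on the conjugate
  is that it be an order ideal.\<close>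

lemma admissible_insert_conjugate:
  assumes L: "L \<in> admissible_chains (Ps :: 'p::{finite,order} set) lam" and k: "k \<in> {1..chain_length L}"
    and J: "densifying Ps lam L k J" and J': "order_ideal (L ! (k - 1) \<union> (L ! k - J))"
  shows "densifying Ps lam L k (L ! (k - 1) \<union> (L ! k - J))"
proof -
  have Lc: "ideal_chain L" and le: "\<And>a b. a \<in> Ps \<Longrightarrow> b \<in> Ps \<Longrightarrow> chain_le L a b \<longleftrightarrow> lam a \<le> lam b"
    using L unfolding admissible_iff by blast+
  have le': "lam a \<le> lam b \<Longrightarrow> b \<in> J \<Longrightarrow> a \<in> J" if "a \<in> Ps" "b \<in> Ps" for a b
    using J that unfolding densifying_def admissible_iff chain_le_insert by blast
  have sub: "L ! (k - 1) \<subset> J" "J \<subset> L ! k" using J by (auto simp: densifying_def)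
  let ?J = "L ! (k - 1) \<union> (L ! k - J)"
  have sub': "L ! (k - 1) \<subset> ?J" "?J \<subset> L ! k"
    using sub ideal_chain_mono[OF Lc, of "k - 1" k] k by auto
  have "a \<in> ?J" if ab: "a \<in> Ps" "b \<in> Ps" "chain_le L a b" "b \<in> ?J" for a b
  proof (rule ccontr)
    assume a: "a \<notin> ?J"
    have mem: "L ! (k - 1) \<in> set L" "L ! k \<in> set L"
      using k ideal_chain_ends(4)[OF Lc] by auto
    have b: "b \<in> L ! k - J" "b \<notin> L ! (k - 1)" using ab(3,4) a mem(1) unfolding chain_le_def by blast+
    then have aJ: "a \<in> J" "a \<notin> L ! (k - 1)" using ab(3) a mem(2) unfolding chain_le_def by blast+
    have "a \<in> block L k" "b \<in> block L k" using aJ b sub by (auto simp: block_def)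
    then have "chain_le L b a"
      using chain_le_iff[OF Lc, of b a] block_index_eq[OF Lc k] by simp
    then show False using le' le ab(1,2) aJ b by blast
  qed
  then have "insert_ideal L k ?J \<in> admissible_chains Ps lam"
    using ideal_chain_insert[OF Lc k sub' J'] le unfolding admissible_iff chain_le_insert by blast
  then show ?thesis using sub' by (simp add: densifying_def)
qed

lemma conjugated_iff:
  assumes L: "L \<in> admissible_chains (Ps :: 'p::{finite,order} set) lam" and k: "k \<in> {1..chain_length L}"
  shows "L' \<in> conjugated_densifications Ps lam L k \<longleftrightarrow>
    (\<exists>J. L' = insert_ideal L k J \<and> densifying Ps lam L k J \<and> order_ideal (L ! (k - 1) \<union> (L ! k - J)))"
proof -
  have "(\<exists>J''. densifying Ps lam L k J'' \<and> conjugate_ideals L k J J'') \<longleftrightarrow>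
      order_ideal (L ! (k - 1) \<union> (L ! k - J))" if J: "densifying Ps lam L k J" for J
  proof
    assume "\<exists>J''. densifying Ps lam L k J'' \<and> conjugate_ideals L k J J''"
    then obtain J'' where J'': "densifying Ps lam L k J''" "conjugate_ideals L k J J''" by blast
    then have "J'' = L ! (k - 1) \<union> (L ! k - J)"
      using J conjugate_ideals_iff[of L k J J''] by (simp only: densifying_def)
    moreover have "order_ideal J''"
      using J''(1) unfolding densifying_def admissible_iff ideal_chain_def set_insert_ideal by blast
    ultimately show "order_ideal (L ! (k - 1) \<union> (L ! k - J))" by simp
  next
    assume "order_ideal (L ! (k - 1) \<union> (L ! k - J))"
    note d = admissible_insert_conjugate[OF L k J this]
    have "conjugate_ideals L k J (L ! (k - 1) \<union> (L ! k - J))"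
      by (subst conjugate_ideals_iff) (use d J in \<open>simp_all only: densifying_def\<close>)
    with d show "\<exists>J''. densifying Ps lam L k J'' \<and> conjugate_ideals L k J J''" by blast
  qed
  then show ?thesis
    unfolding conjugated_densifications_def mem_Collect_eq by (intro iff_exI) metis
qed

section \<open>Conjugacy and the face carrying the larger cell\<close>

context
  fixes Ps :: "'p::{finite,order} set" and lam :: "'p \<Rightarrow> real" and L L' :: "'p set list" and A k J
  assumes L: "L \<in> admissible_chains Ps lam" and L': "L' \<in> admissible_chains Ps lam"
    and k: "k \<in> {1..chain_length L}" and L'_eq: "L' = insert_ideal L k J"
    and J: "L ! (k - 1) \<subset> J" "J \<subset> L ! k"
    and A: "A face_of marked_order_polytope Ps lam"
    and L'A: "chain_polytope Ps lam L' \<subseteq> A" "\<not> chain_polytope Ps lam L' \<subseteq> rel_frontier A"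
begin

text \<open>An interior point of the small cell is now interior to \<open>A\<close>. Moving from it
  away from the large cell stays in \<open>A\<close> and reverses the order between the two parts of
  the split block, so the reversed split must respect the poset.\<close>

lemma order_ideal_if_same_face:
  assumes fr: "\<not> chain_polytope Ps lam L \<subseteq> rel_frontier A"
  shows "order_ideal (L ! (k - 1) \<union> (L ! k - J))"
  unfolding order_ideal_def
proof (intro ballI allI impI)
  have Lc: "ideal_chain L" "ideal_chain L'" by (rule admissible_imp_ideal_chain[OF L], rule admissible_imp_ideal_chain[OF L'])
  have sub: "set L \<subseteq> set L'" by (auto simp: L'_eq set_insert_ideal)
  have LA: "chain_polytope Ps lam L \<subseteq> A"
    using chain_polytope_mono[OF Lc sub] L'A(1) by blast
  have cA: "convex A" using A face_of_imp_convex by blast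
  obtain x where x: "x \<in> open_cell Ps lam L" using open_cell_nonempty[OF L] by auto
  obtain u where u: "u \<in> open_cell Ps lam L'" using open_cell_nonempty[OF L'] by auto
  have "x \<in> rel_interior A"
    using not_subset_rel_frontier_iff[OF cA convex_chain_polytope[OF Lc(1)] _ LA] fr x
      rel_interior_chain_polytope[OF L] by auto
  moreover have "u \<in> A" using u open_cell_subset[OF Lc(2)] L'A(1) by blast
  \<comment> \<open>Since \<open>e > 1\<close>, this point lies beyond \<open>x\<close> as seen from
    \<open>u\<close>, so coordinates that are tied at \<open>x\<close> occur here in the order
    opposite to \<open>u\<close>.\<close>
  ultimately obtain e where e: "e > 1" "(1 - e) *\<^sub>R u + e *\<^sub>R x \<in> A"
    using convex_rel_interior_iff[OF cA] by blast
  then have v: "(1 - e) *\<^sub>R u + e *\<^sub>R x \<in> marked_order_polytope Ps lam"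
    using A face_of_imp_subset by blast
  fix p q assume p: "p \<in> L ! (k - 1) \<union> (L ! k - J)" and qp: "q \<le> p"
  have ideals: "order_ideal (L ! (k - 1))" "order_ideal (L ! k)"
    using Lc(1) k ideal_chain_ends(4)[OF Lc(1)] by (auto simp: ideal_chain_def)
  show "q \<in> L ! (k - 1) \<union> (L ! k - J)"
  proof (rule ccontr)
    assume q: "q \<notin> L ! (k - 1) \<union> (L ! k - J)"
    have p': "p \<in> L ! k" "p \<notin> J" "p \<notin> L ! (k - 1)"
      using p q ideals(1) qp unfolding order_ideal_def by blast+
    then have q': "q \<in> J" "q \<notin> L ! (k - 1)"
      using q ideals(2) qp unfolding order_ideal_def by blast+
    then have "q \<in> block L k" "p \<in> block L k" using J p' by (auto simp: block_def)
    then have "chain_le L p q" "chain_le L q p"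
      using chain_le_iff[OF Lc(1)] block_index_eq[OF Lc(1) k] by simp_all
    then have eq: "x $ p = x $ q" using x unfolding open_cell_def by (simp add: antisym)
    have "\<not> chain_le L' p q" using p' q' by (simp add: L'_eq chain_le_insert)
    then have "u $ q < u $ p" using u by (simp add: open_cell_def)
    moreover have "(1 - e) * u $ q + e * x $ q \<le> (1 - e) * u $ p + e * x $ p"
      using v qp by (simp add: marked_order_polytope_def)
    then have "(1 - e) * u $ q \<le> (1 - e) * u $ p" using eq by simp
    ultimately show False using e(1) by (simp add: mult_le_cancel_left)
  qed
qed

text \<open>A point slightly beyond \<open>x\<close> as seen from \<open>u\<close> still satisfies
  the order constraints. The face property puts it into \<open>A\<close>, and then \<open>x\<close>
  lies strictly between a point of \<open>A\<close> and the relative interior point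
  \<open>u\<close>, hence is itself interior to \<open>A\<close>.\<close>

lemma same_face_if_order_ideal:
  assumes J': "order_ideal (L ! (k - 1) \<union> (L ! k - J))"
  shows "\<not> chain_polytope Ps lam L \<subseteq> rel_frontier A"
proof -
  have Lc: "ideal_chain L" "ideal_chain L'" by (rule admissible_imp_ideal_chain[OF L], rule admissible_imp_ideal_chain[OF L'])
  have sub: "set L \<subseteq> set L'" by (auto simp: L'_eq set_insert_ideal)
  have LA: "chain_polytope Ps lam L \<subseteq> A"
    using chain_polytope_mono[OF Lc sub] L'A(1) by blast
  have cA: "convex A" using A face_of_imp_convex by blast
  obtain x where x: "x \<in> open_cell Ps lam L" using open_cell_nonempty[OF L] by auto
  obtain u where u: "u \<in> open_cell Ps lam L'" using open_cell_nonempty[OF L'] by auto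
  have xA: "x \<in> A" using x open_cell_subset[OF Lc(1)] LA by blast
  have uA: "u \<in> rel_interior A"
  proof -
    have "chain_polytope Ps lam L' \<noteq> {}" using u open_cell_subset[OF Lc(2)] by auto
    then show ?thesis
      using not_subset_rel_frontier_iff[OF cA convex_chain_polytope[OF Lc(2)] _ L'A(1)] L'A(2) u
        rel_interior_chain_polytope[OF L'] by auto
  qed
  \<comment> \<open>The reflected ray through \<open>x\<close>. Strict inequalities of
    \<open>x\<close> survive for small parameters; only ties of \<open>x\<close> need an
    argument.\<close>
  define v where "v \<epsilon> = x - \<epsilon> *\<^sub>R (u - x)" for \<epsilon>
  have "\<forall>\<^sub>F \<epsilon> in at_right 0. x $ p < x $ q \<longrightarrow> v \<epsilon> $ p < v \<epsilon> $ q" for p q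
  proof (cases "x $ p < x $ q")
    case True
    have "((\<lambda>\<epsilon>. (x $ q - \<epsilon> * (u $ q - x $ q)) - (x $ p - \<epsilon> * (u $ p - x $ p)))
        \<longlongrightarrow> (x $ q - 0 * (u $ q - x $ q)) - (x $ p - 0 * (u $ p - x $ p))) (at_right 0)"
      by (intro tendsto_intros)
    then have "((\<lambda>\<epsilon>. v \<epsilon> $ q - v \<epsilon> $ p) \<longlongrightarrow> x $ q - x $ p) (at_right 0)"
      by (simp add: v_def)
    then have "\<forall>\<^sub>F \<epsilon> in at_right 0. 0 < v \<epsilon> $ q - v \<epsilon> $ p"
      by (rule order_tendstoD(1)) (use True in simp)
    then show ?thesis by (rule eventually_mono) simp
  qed simp
  then have "\<forall>\<^sub>F \<epsilon> in at_right 0. \<forall>p q. x $ p < x $ q \<longrightarrow> v \<epsilon> $ p < v \<epsilon> $ q"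
    by (intro eventually_all_finite)
  moreover have "\<forall>\<^sub>F \<epsilon> in at_right (0::real). 0 < \<epsilon>"
    by (simp add: eventually_at_right_less)
  ultimately have "\<forall>\<^sub>F \<epsilon> in at_right 0. 0 < \<epsilon> \<and> (\<forall>p q. x $ p < x $ q \<longrightarrow> v \<epsilon> $ p < v \<epsilon> $ q)"
    by (simp add: eventually_conj)
  then have "\<exists>\<epsilon>. 0 < \<epsilon> \<and> (\<forall>p q. x $ p < x $ q \<longrightarrow> v \<epsilon> $ p < v \<epsilon> $ q)"
    by (rule eventually_happens'[OF trivial_limit_at_right_real])
  then obtain \<epsilon> where \<epsilon>: "0 < \<epsilon>" "\<And>p q. x $ p < x $ q \<Longrightarrow> v \<epsilon> $ p < v \<epsilon> $ q"
    by blast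
  have "v \<epsilon> \<in> marked_order_polytope Ps lam"
    unfolding marked_order_polytope_def
  proof (intro CollectI conjI allI impI ballI)
    fix a assume "a \<in> Ps"
    then show "v \<epsilon> $ a = lam a" using x u by (simp add: v_def open_cell_def)
  next
    fix p q :: 'p assume pq: "p \<le> q"
    have xpq: "x $ p \<le> x $ q"
      using x chain_le_if_le[OF Lc(1) pq] by (simp add: open_cell_def)
    show "v \<epsilon> $ p \<le> v \<epsilon> $ q"
    proof (cases "x $ p = x $ q")
      case False
      then show ?thesis using xpq \<epsilon>(2)[of p q] by simp
    next
      case True
      then have qp: "chain_le L q p" using x by (simp add: open_cell_def)
      \<comment> \<open>Otherwise \<open>J\<close> contains \<open>p\<close> but not
        \<open>q\<close>, so \<open>q\<close> lies in the conjugate ideal and so does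
        \<open>p\<close>. Being in \<open>J\<close>, \<open>p\<close> then lies in the ideal below
        the block, and so does the tied \<open>q\<close>, a contradiction.\<close>
      have "chain_le L' q p"
      proof (rule ccontr)
        assume "\<not> chain_le L' q p"
        then have pJ: "p \<in> J" "q \<notin> J" using qp by (auto simp: L'_eq chain_le_insert)
        have mem: "L ! (k - 1) \<in> set L" "L ! k \<in> set L"
          using k ideal_chain_ends(4)[OF Lc(1)] by auto
        have "q \<in> L ! k" using pJ J(2) qp mem(2) unfolding chain_le_def by blast
        then have "p \<in> L ! (k - 1)" using J' pq pJ unfolding order_ideal_def by blast
        then have "q \<in> L ! (k - 1)" using qp mem(1) unfolding chain_le_def by blast
        then show False using pJ J by blast
      qed
      then have "u $ q \<le> u $ p" using u by (simp add: open_cell_def)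
      then show ?thesis using True \<epsilon>(1) by (simp add: v_def mult_left_mono)
    qed
  qed
  moreover have seg: "x = v \<epsilon> - (\<epsilon> / (1 + \<epsilon>)) *\<^sub>R (v \<epsilon> - u)"
  proof -
    \<comment> \<open>This factor is the origin of the ratio
      \<open>\<epsilon> / (1 + \<epsilon>)\<close> at which \<open>x\<close> divides the
      segment.\<close>
    have "v \<epsilon> - u = (1 + \<epsilon>) *\<^sub>R (x - u)" by (simp add: v_def algebra_simps)
    then have "(\<epsilon> / (1 + \<epsilon>)) *\<^sub>R (v \<epsilon> - u) = \<epsilon> *\<^sub>R (x - u)" using \<epsilon>(1) by simp
    then show ?thesis by (simp add: v_def algebra_simps)
  qed
  moreover have "x \<noteq> u"
  proof
    assume "x = u"
    then have eq: "chain_le L p q \<longleftrightarrow> chain_le (insert_ideal L k J) p q" for p q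
      using x u unfolding open_cell_def L'_eq by blast
    obtain p q where pq: "q \<in> J" "q \<notin> L ! (k - 1)" "p \<in> L ! k" "p \<notin> J" using J by blast
    then have "p \<in> block L k" "q \<in> block L k" using J by (auto simp: block_def)
    then have "chain_le L p q" using chain_le_iff[OF Lc(1)] block_index_eq[OF Lc(1) k] by simp
    then show False using pq eq[of p q] chain_le_insert[of L k J p q] by blast
  qed
  ultimately have "v \<epsilon> \<in> A"
  proof -
    have "v \<epsilon> \<noteq> u"
    proof
      assume "v \<epsilon> = u"
      then have "x = u" using seg by simp
      then show False using \<open>x \<noteq> u\<close> by simp
    qed
    moreover have "x = (1 - \<epsilon> / (1 + \<epsilon>)) *\<^sub>R v \<epsilon> + (\<epsilon> / (1 + \<epsilon>)) *\<^sub>R u"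
      by (subst seg) (simp add: algebra_simps)
    moreover have "0 < \<epsilon> / (1 + \<epsilon>)" "\<epsilon> / (1 + \<epsilon>) < 1" using \<epsilon>(1) by auto
    ultimately have "x \<in> open_segment (v \<epsilon>) u" unfolding in_segment by blast
    moreover have "u \<in> marked_order_polytope Ps lam"
      using u open_cell_subset[OF Lc(2)] chain_polytope_subset_marked[OF Lc(2)] by blast
    ultimately show ?thesis
      using A xA \<open>v \<epsilon> \<in> marked_order_polytope Ps lam\<close> face_ofD by blast
  qed
  then have "v \<epsilon> \<in> closure A" using closure_subset by blast
  then have "x \<in> rel_interior A"
    by (subst seg, intro rel_interior_closure_convex_shrink) (use cA uA \<epsilon>(1) in auto)
  moreover have "x \<in> chain_polytope Ps lam L" using x open_cell_subset[OF Lc(1)] by blast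
  ultimately show ?thesis by (auto simp: rel_frontier_def)
qed

end

lemma incidence_iff:
  assumes L: "L \<in> admissible_chains (Ps :: 'p::{finite,order} set) lam" and L': "L' \<in> admissible_chains Ps lam"
    and dim: "chain_dim Ps L' = Suc (chain_dim Ps L)"
    and A: "A face_of marked_order_polytope Ps lam"
    and L'A: "chain_polytope Ps lam L' \<subseteq> A" "\<not> chain_polytope Ps lam L' \<subseteq> rel_frontier A"
  shows "(\<exists>k\<in>{1..chain_length L}. L' \<in> conjugated_densifications Ps lam L k) \<longleftrightarrow>
    chain_polytope Ps lam L \<subseteq> chain_polytope Ps lam L' \<and> \<not> chain_polytope Ps lam L \<subseteq> rel_frontier A"
proof
  assume "\<exists>k\<in>{1..chain_length L}. L' \<in> conjugated_densifications Ps lam L k"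
  then obtain k J where k: "k \<in> {1..chain_length L}" and J: "L' = insert_ideal L k J"
    "densifying Ps lam L k J" "order_ideal (L ! (k - 1) \<union> (L ! k - J))"
    by (metis conjugated_iff[OF L])
  have "L ! (k - 1) \<subset> J" "J \<subset> L ! k" using J(2) by (auto simp: densifying_def)
  then have "\<not> chain_polytope Ps lam L \<subseteq> rel_frontier A"
    using same_face_if_order_ideal[OF L L' k J(1) _ _ A L'A J(3)] by blast
  moreover have "set L \<subseteq> set L'" by (auto simp: J(1) set_insert_ideal)
  ultimately show "chain_polytope Ps lam L \<subseteq> chain_polytope Ps lam L' \<and> \<not> chain_polytope Ps lam L \<subseteq> rel_frontier A"
    using chain_polytope_subset_iff[OF L L'] by blast
next
  assume R: "chain_polytope Ps lam L \<subseteq> chain_polytope Ps lam L' \<and> \<not> chain_polytope Ps lam L \<subseteq> rel_frontier A"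
  have Lc: "ideal_chain L" "ideal_chain L'" by (rule admissible_imp_ideal_chain[OF L], rule admissible_imp_ideal_chain[OF L'])
  have "set L \<subseteq> set L'" using R chain_polytope_subset_iff[OF L L'] by blast
  moreover have "chain_length L' = Suc (chain_length L)"
    using dim chain_length_eq_dim[OF L] chain_length_eq_dim[OF L'] by simp
  ultimately obtain k J where k: "k \<in> {1..chain_length L}" and J: "L' = insert_ideal L k J" "L ! (k - 1) \<subset> J" "J \<subset> L ! k"
    using subset_chain_insert[OF Lc] by metis
  have "order_ideal (L ! (k - 1) \<union> (L ! k - J))"
    using order_ideal_if_same_face[OF L L' k J A L'A] R by blast
  moreover have "densifying Ps lam L k J" using L' J by (simp add: densifying_def)
  ultimately show "\<exists>k\<in>{1..chain_length L}. L' \<in> conjugated_densifications Ps lam L k"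
    using k J(1) conjugated_iff[OF L] by blast
qed

section \<open>The isomorphism of cochain complexes\<close>

text \<open>There are no chains of dimension above \<open>marked_dim\<close>, so the case
  distinction in the definition collapses to one support condition.\<close>

lemma marked_cochains_iff:
  "c \<in> marked_cochains (Ps :: 'p::{finite,order} set) lam i \<longleftrightarrow>
     (\<forall>L. c L \<noteq> 0 \<longrightarrow> L \<in> admissible_chains Ps lam \<and> chain_dim Ps L = i)"
proof (cases "i \<le> marked_dim Ps lam")
  case True
  then show ?thesis by (simp add: marked_cochains_def)
next
  case False
  have "chain_dim Ps L \<le> marked_dim Ps lam" if "L \<in> admissible_chains Ps lam" for L
    unfolding marked_dim_def using that finite_admissible_chains by (intro Max_ge) auto
  then have "\<not> (L \<in> admissible_chains Ps lam \<and> chain_dim Ps L = i)" for L using False by blast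
  then have "(\<forall>L. c L \<noteq> 0 \<longrightarrow> L \<in> admissible_chains Ps lam \<and> chain_dim Ps L = i) \<longleftrightarrow> (\<forall>L. c L = 0)"
    by blast
  then show ?thesis using False by (simp only: marked_cochains_def fun_eq_iff if_False singleton_iff)
qed

lemma z2_subspace_marked_cochains: "z2_subspace (marked_cochains (Ps :: 'p::{finite,order} set) lam i)"
  unfolding z2_subspace_def marked_cochains_iff
proof (intro conjI ballI allI impI)
  fix c d :: "'p set list \<Rightarrow> bit" and L
  assume cd: "c \<in> marked_cochains Ps lam i" "d \<in> marked_cochains Ps lam i" and nz: "c L + d L \<noteq> 0"
  have "c L \<noteq> 0 \<or> d L \<noteq> 0" using nz by auto
  then show "L \<in> admissible_chains Ps lam" "chain_dim Ps L = i"
    using cd unfolding marked_cochains_iff by blast+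
next
  fix a :: bit and c :: "'p set list \<Rightarrow> bit" and L
  assume c: "c \<in> marked_cochains Ps lam i" and nz: "a * c L \<noteq> 0"
  have "c L \<noteq> 0" using nz by auto
  then show "L \<in> admissible_chains Ps lam" "chain_dim Ps L = i"
    using c unfolding marked_cochains_iff by blast+
qed simp_all

lemma marked_coboundary_eq:
  "marked_coboundary Ps lam i c L' =
    (\<Sum>L | L \<in> admissible_chains (Ps :: 'p::{finite,order} set) lam \<and> chain_dim Ps L = i.
      c L * of_bool (\<exists>k\<in>{1..chain_length L}. L' \<in> conjugated_densifications Ps lam L k))"
  unfolding marked_coboundary_def
proof (rule sum.cong[OF refl])
  fix L assume "L \<in> {L \<in> admissible_chains Ps lam. chain_dim Ps L = i}"
  then have "ideal_chain L" using admissible_imp_ideal_chain by blast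
  then show "c L * (\<Sum>k = 1..chain_length L. Sigma_sum Ps lam L k L')
    = c L * of_bool (\<exists>k\<in>{1..chain_length L}. L' \<in> conjugated_densifications Ps lam L k)"
    by (simp only: sum_Sigma_sum)
qed

lemma conjugated_densification_dim:
  assumes L: "L \<in> admissible_chains (Ps :: 'p::{finite,order} set) lam" and k: "k \<in> {1..chain_length L}"
    and L': "L' \<in> conjugated_densifications Ps lam L k"
  shows "L' \<in> admissible_chains Ps lam \<and> chain_dim Ps L' = Suc (chain_dim Ps L)"
proof
  obtain J where J: "L' = insert_ideal L k J" "densifying Ps lam L k J"
    using L' conjugated_iff[OF L k] by blast
  then show L'a: "L' \<in> admissible_chains Ps lam" by (simp add: densifying_def)
  have "chain_length L' = Suc (chain_length L)"
  proof -
    have "length L' = Suc (length L)" by (simp add: J(1) insert_ideal_def min_def)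
    then show ?thesis
      using ideal_chain_ends(4)[OF admissible_imp_ideal_chain[OF L]]
        ideal_chain_ends(4)[OF admissible_imp_ideal_chain[OF L'a]] by linarith
  qed
  then show "chain_dim Ps L' = Suc (chain_dim Ps L)"
    using chain_length_eq_dim[OF L] chain_length_eq_dim[OF L'a] by simp
qed

lemma marked_coboundary_in:
  "marked_coboundary (Ps :: 'p::{finite,order} set) lam i c \<in> marked_cochains Ps lam (Suc i)"
  unfolding marked_cochains_iff
proof (intro allI impI)
  fix L' assume "marked_coboundary Ps lam i c L' \<noteq> 0"
  then obtain L where "L \<in> admissible_chains Ps lam" "chain_dim Ps L = i"
    "\<exists>k\<in>{1..chain_length L}. L' \<in> conjugated_densifications Ps lam L k"
    unfolding marked_coboundary_eq by (smt (verit) mem_Collect_eq mult_zero_right of_bool_eq(1) sum.neutral)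
  then show "L' \<in> admissible_chains Ps lam \<and> chain_dim Ps L' = Suc i"
    using conjugated_densification_dim by metis
qed

lemma marked_coboundary_linear:
  "marked_coboundary Ps lam i (\<lambda>L. c L + d L) = (\<lambda>L. marked_coboundary Ps lam i c L + marked_coboundary Ps lam i d L)"
  "marked_coboundary Ps lam i (\<lambda>L. a * c L) = (\<lambda>L. a * marked_coboundary Ps lam i c L)"
  by (simp_all add: marked_coboundary_def distrib_right sum.distrib sum_distrib_left mult.assoc)

section \<open>Assembling the summands over all faces\<close>

locale marked_poset =
  fixes Ps :: "'p::{finite,order} set" and lam :: "'p \<Rightarrow> real"
  assumes minimal_marked: "\<And>p. (\<forall>q. \<not> q < p) \<Longrightarrow> p \<in> Ps"
    and maximal_marked: "\<And>p. (\<forall>q. \<not> p < q) \<Longrightarrow> p \<in> Ps"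
begin

abbreviation "M \<equiv> marked_order_polytope Ps lam"
abbreviation "K \<equiv> marked_subdivision Ps lam"
abbreviation "cell \<equiv> chain_polytope Ps lam"
abbreviation "adm \<equiv> admissible_chains Ps lam"

text \<open>The face \<open>A\<close> carries the cell: equivalently, its relative interior contains
  that of the cell. Each admissible chain has exactly one such face.\<close>

definition face_interior :: "(real, 'p) vec set \<Rightarrow> 'p set list \<Rightarrow> bool" where
  "face_interior A L \<longleftrightarrow> A face_of M \<and> cell L \<subseteq> A \<and> \<not> cell L \<subseteq> rel_frontier A"

lemma convex_M: "convex M"
  using polyhedron_marked_order_polytope polyhedron_imp_convex by blast

lemma cell_props:
  assumes "L \<in> adm"
  shows "convex (cell L)" "cell L \<noteq> {}" "cell L \<subseteq> M" "polytope (cell L)"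
proof -
  have L: "ideal_chain L" using assms by (rule admissible_imp_ideal_chain)
  show "convex (cell L)" by (rule convex_chain_polytope[OF L])
  show "cell L \<noteq> {}" using open_cell_nonempty[OF assms] open_cell_subset[OF L] by blast
  show M: "cell L \<subseteq> M" by (rule chain_polytope_subset_marked[OF L])
  have "bounded (cell L)"
    using bounded_marked_order_polytope[OF minimal_marked maximal_marked] M bounded_subset by blast
  then show "polytope (cell L)"
    using polyhedron_chain_polytope[OF L] polytope_eq_bounded_polyhedron by blast
qed

lemma ex_face_interior:
  assumes "L \<in> adm" obtains A where "face_interior A L"
  using subset_face_interior[OF polyhedron_marked_order_polytope cell_props(1-3)[OF assms]]
  unfolding face_interior_def by metis

lemma face_interior_unique:
  "\<lbrakk>L \<in> adm; face_interior A L; face_interior A' L\<rbrakk> \<Longrightarrow> A = A'"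
  using subset_face_interior_unique[OF convex_M cell_props(1,2)] unfolding face_interior_def by blast

lemma face_subset: "A face_of M \<Longrightarrow> rel_frontier A \<subseteq> A"
proof -
  assume "A face_of M"
  then have "closed A"
    using face_of_polyhedron_polyhedron polyhedron_marked_order_polytope polyhedron_imp_closed by blast
  then show ?thesis by (auto simp: rel_frontier_def)
qed

text \<open>All incidence conditions reduce to inclusion of chains: a cell meeting an open cell
  belongs to a refinement, and proper refinement raises the dimension.\<close>

lemma face_pair:
  assumes A: "A face_of M"
  shows "polytopal_pair (cells_in_face K A) (cells_in_boundary K A)"
proof
  have K: "\<exists>L\<in>adm. F = cell L" if "F \<in> cells_in_face K A" for F
    using that by (auto simp: cells_in_face_def marked_subdivision_def)
  show "finite (cells_in_face K A)"
    unfolding cells_in_face_def marked_subdivision_def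
    by (rule finite_subset[OF _ finite_imageI[OF finite_admissible_chains]]) blast
  show "cells_in_boundary K A \<subseteq> cells_in_face K A"
    using face_subset[OF A] by (auto simp: cells_in_boundary_def cells_in_face_def)
  show "polytope F" "F \<noteq> {}" if "F \<in> cells_in_face K A" for F
    using K[OF that] cell_props by auto
  fix F assume F: "F \<in> cells_in_face K A - cells_in_boundary K A"
  then obtain L where L: "L \<in> adm" "F = cell L" using K by blast
  have Lc: "ideal_chain L" using L by (blast intro: admissible_imp_ideal_chain)
  have F': "F \<subseteq> A" "\<not> F \<subseteq> rel_frontier A"
    using F by (auto simp: cells_in_face_def cells_in_boundary_def)
  show "G \<inter> rel_interior F = {}" if G: "G \<in> cells_in_face K A" and ns: "\<not> F \<subseteq> G" for G
  proof (rule ccontr)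
    assume "G \<inter> rel_interior F \<noteq> {}"
    then obtain x where x: "x \<in> G" "x \<in> open_cell Ps lam L"
      using rel_interior_chain_polytope[OF L(1)] L(2) by auto
    obtain L' where L': "L' \<in> adm" "G = cell L'" using K[OF G] by blast
    have "set L \<subseteq> set L'"
      using cell_contains_imp_subset[OF Lc _ x(2)] x(1) L' admissible_imp_ideal_chain by blast
    then show False using ns L L' chain_polytope_subset_iff[OF L(1) L'(1)] by simp
  qed
  show "G \<notin> cells_in_boundary K A \<and> aff_dim F < aff_dim G"
    if G: "G \<in> cells_in_face K A" "F \<subseteq> G" "F \<noteq> G" for G
  proof
    show "G \<notin> cells_in_boundary K A" using F' G(2) by (auto simp: cells_in_boundary_def)
    obtain L' where L': "L' \<in> adm" "G = cell L'" using K[OF G(1)] by blast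
    have "set L \<subset> set L'"
      using G(2,3) L L' chain_polytope_subset_iff[OF L(1) L'(1)] chain_polytope_subset_iff[OF L'(1) L(1)] by blast
    then show "aff_dim F < aff_dim G"
      using chain_dim_less[OF L(1) L'(1)] by (simp add: L L' aff_dim_chain_polytope)
  qed
  show "rel_frontier F \<subseteq> \<Union>{G \<in> cells_in_face K A. aff_dim G < aff_dim F}"
  proof
    \<comment> \<open>The level chain of a frontier point is a proper subchain of \<open>L\<close>,
      so its cell is a lower-dimensional cell inside \<open>F\<close> through
      \<open>x\<close>.\<close>
    fix x assume x: "x \<in> rel_frontier F"
    have "closed F" using cell_props(4)[OF L(1)] L(2) polytope_imp_closed by blast
    then have x': "x \<in> cell L" "x \<notin> open_cell Ps lam L"
      using x rel_interior_chain_polytope[OF L(1)] L(2) by (auto simp: rel_frontier_def)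
    then have "x \<in> M" using cell_props(3)[OF L(1)] by blast
    note l = level_chain_admissible[OF this]
    have lc: "ideal_chain (level_chain x)" using l(1) by (rule admissible_imp_ideal_chain)
    have "set (level_chain x) \<subseteq> set L" by (rule cell_contains_imp_subset[OF lc Lc l(2) x'(1)])
    moreover have "set (level_chain x) \<noteq> set L" using ideal_chain_eqI[OF lc Lc] l(2) x'(2) by auto
    ultimately have "set (level_chain x) \<subset> set L" by blast
    then have "cell (level_chain x) \<subseteq> F" "aff_dim (cell (level_chain x)) < aff_dim F"
      using chain_polytope_mono[OF lc Lc] chain_dim_less[OF l(1) L(1)] l(1) L
      by (auto simp: aff_dim_chain_polytope)
    moreover have "x \<in> cell (level_chain x)" using open_cell_subset[OF lc] l(2) by blast
    ultimately show "x \<in> \<Union>{G \<in> cells_in_face K A. aff_dim G < aff_dim F}"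
      using F'(1) l(1) by (auto simp: cells_in_face_def marked_subdivision_def)
  qed
qed

abbreviation face_cells :: "(real, 'p) vec set \<Rightarrow> nat \<Rightarrow> (real, 'p) vec set set" where
  "face_cells A i \<equiv> polytopal_pair.cells (cells_in_face K A) (cells_in_boundary K A) (int i)"

abbreviation face_realize :: "(real, 'p) vec set \<Rightarrow> nat \<Rightarrow> ((real, 'p) vec set \<Rightarrow> bit) \<Rightarrow> (real, 'p) vec chain set \<Rightarrow> bit" where
  "face_realize A \<equiv> polytopal_pair.realize (cells_in_face K A) (cells_in_boundary K A)"

abbreviation face_cochains :: "(real, 'p) vec set \<Rightarrow> nat \<Rightarrow> ((real, 'p) vec set \<Rightarrow> bit) set" where
  "face_cochains A \<equiv> polytopal_pair.cell_cochains (cells_in_face K A) (cells_in_boundary K A)"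

lemma face_cells_eq:
  assumes A: "A face_of M"
  shows "face_cells A i = cell ` {L \<in> adm. chain_dim Ps L = i \<and> face_interior A L}"
proof -
  have "face_cells A i = {F \<in> cell ` adm. F \<subseteq> A \<and> \<not> F \<subseteq> rel_frontier A \<and> aff_dim F = int i}"
    unfolding polytopal_pair.cells_def[OF face_pair[OF A]]
    unfolding cells_in_face_def cells_in_boundary_def marked_subdivision_def by blast
  also have "\<dots> = cell ` {L \<in> adm. chain_dim Ps L = i \<and> face_interior A L}"
    using A by (auto simp: face_interior_def aff_dim_chain_polytope)
  finally show ?thesis .
qed

definition cell_chain :: "(real, 'p) vec set \<Rightarrow> 'p set list" where
  "cell_chain = inv_into adm cell"

lemma cell_chain: "L \<in> adm \<Longrightarrow> cell_chain (cell L) = L"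
  unfolding cell_chain_def by (rule inv_into_f_f[OF inj_chain_polytope])

text \<open>The component of a chain cochain in the summand of \<open>A\<close>, transported from
  chains to cells.\<close>

definition face_part :: "(real, 'p) vec set \<Rightarrow> nat \<Rightarrow> ('p set list \<Rightarrow> bit) \<Rightarrow> (real, 'p) vec set \<Rightarrow> bit" where
  "face_part A i c F = (if F \<in> face_cells A i then c (cell_chain F) else 0)"

lemma face_part_in: "A face_of M \<Longrightarrow> face_part A i c \<in> face_cochains A i"
  by (simp add: polytopal_pair.cell_cochains_def[OF face_pair] face_part_def)

text \<open>For cells carried by \<open>A\<close>, inclusion in codimension one is conjugated
  densification. Chains not carried by \<open>A\<close> contribute nothing to a cell carried by
  \<open>A\<close>.\<close>

lemma face_part_coboundary:
  assumes A: "A face_of M"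
  shows "face_part A (Suc i) (marked_coboundary Ps lam i c)
    = polytopal_pair.cell_coboundary (cells_in_face K A) (cells_in_boundary K A) i (face_part A i c)"
proof
  fix F
  show "face_part A (Suc i) (marked_coboundary Ps lam i c) F
    = polytopal_pair.cell_coboundary (cells_in_face K A) (cells_in_boundary K A) i (face_part A i c) F"
  proof (cases "F \<in> face_cells A (Suc i)")
    case False
    then show ?thesis by (simp add: face_part_def polytopal_pair.cell_coboundary_def[OF face_pair[OF A]] del: of_nat_Suc)
  next
    case True
    then obtain L' where L': "L' \<in> adm" "chain_dim Ps L' = Suc i" "face_interior A L'" "F = cell L'"
      unfolding face_cells_eq[OF A] by blast
    let ?D = "{L \<in> adm. chain_dim Ps L = i}" and ?D' = "{L \<in> adm. chain_dim Ps L = i \<and> face_interior A L}"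
    have fin: "finite ?D" by (rule finite_subset[OF _ finite_admissible_chains]) blast
    have "polytopal_pair.cell_coboundary (cells_in_face K A) (cells_in_boundary K A) i (face_part A i c) F
      = (\<Sum>G\<in>face_cells A i. face_part A i c G * of_bool (G \<subseteq> F))"
      using True by (simp add: polytopal_pair.cell_coboundary_def[OF face_pair[OF A]] del: of_nat_Suc)
    also have "\<dots> = (\<Sum>G\<in>cell ` ?D'. c (cell_chain G) * of_bool (G \<subseteq> F))"
      by (rule sum.cong) (simp_all add: face_cells_eq[OF A] face_part_def)
    also have "\<dots> = (\<Sum>L\<in>?D'. c (cell_chain (cell L)) * of_bool (cell L \<subseteq> F))"
      by (rule sum.reindex_cong[of cell]) (auto intro: inj_on_subset[OF inj_chain_polytope])
    also have "\<dots> = (\<Sum>L\<in>?D'. c L * of_bool (\<exists>k\<in>{1..chain_length L}. L' \<in> conjugated_densifications Ps lam L k))"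
    proof (rule sum.cong[OF refl])
      fix L assume L: "L \<in> ?D'"
      then have "(\<exists>k\<in>{1..chain_length L}. L' \<in> conjugated_densifications Ps lam L k) \<longleftrightarrow> cell L \<subseteq> F"
        using incidence_iff[of L Ps lam L' A] L' A by (simp add: face_interior_def)
      then show "c (cell_chain (cell L)) * of_bool (cell L \<subseteq> F) =
          c L * of_bool (\<exists>k\<in>{1..chain_length L}. L' \<in> conjugated_densifications Ps lam L k)"
        using L by (simp add: cell_chain)
    qed
    \<comment> \<open>Enlarging the index set is harmless: a chain with a conjugated densification
      carried by \<open>A\<close> is carried by \<open>A\<close> itself.\<close>
    also have "\<dots> = (\<Sum>L\<in>?D. c L * of_bool (\<exists>k\<in>{1..chain_length L}. L' \<in> conjugated_densifications Ps lam L k))"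
    proof (rule sum.mono_neutral_left[OF fin])
      show "\<forall>L\<in>?D - ?D'. c L * of_bool (\<exists>k\<in>{1..chain_length L}. L' \<in> conjugated_densifications Ps lam L k) = 0"
      proof
        fix L assume L: "L \<in> ?D - ?D'"
        then have "\<not> face_interior A L" by simp
        moreover have "cell L \<subseteq> F \<Longrightarrow> cell L \<subseteq> A" using L' by (auto simp: face_interior_def)
        ultimately have "\<not> (\<exists>k\<in>{1..chain_length L}. L' \<in> conjugated_densifications Ps lam L k)"
          using incidence_iff[of L Ps lam L' A] L L' A by (simp add: face_interior_def)
        then show "c L * of_bool (\<exists>k\<in>{1..chain_length L}. L' \<in> conjugated_densifications Ps lam L k) = 0"
          by simp
      qed
    qed auto
    also have "\<dots> = face_part A (Suc i) (marked_coboundary Ps lam i c) F"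
      using True L' by (simp add: face_part_def marked_coboundary_eq cell_chain del: of_nat_Suc)
    finally show ?thesis by simp
  qed
qed

definition realize_all :: "nat \<Rightarrow> ('p set list \<Rightarrow> bit) \<Rightarrow> (real, 'p) vec set \<times> (real, 'p) vec chain set \<Rightarrow> bit" where
  "realize_all i c = (\<lambda>(A, z). if A face_of M \<and> A \<noteq> {} then face_realize A i (face_part A i c) z else 0)"

lemma realize_all_linear:
  "realize_all i (\<lambda>L. c L + d L) = (\<lambda>y. realize_all i c y + realize_all i d y)"
  "realize_all i (\<lambda>L. a * c L) = (\<lambda>y. a * realize_all i c y)"
proof -
  have "face_part A i (\<lambda>L. c L + d L) = (\<lambda>F. face_part A i c F + face_part A i d F)"
    "face_part A i (\<lambda>L. a * c L) = (\<lambda>F. a * face_part A i c F)" for A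
    by (auto simp: face_part_def fun_eq_iff)
  then have "face_realize A i (face_part A i (\<lambda>L. c L + d L)) z
      = face_realize A i (face_part A i c) z + face_realize A i (face_part A i d) z"
    "face_realize A i (face_part A i (\<lambda>L. a * c L)) z = a * face_realize A i (face_part A i c) z"
    if "A face_of M" for A z
    using that by (simp_all only: polytopal_pair.realize_add[OF face_pair] polytopal_pair.realize_mult[OF face_pair])
  then show "realize_all i (\<lambda>L. c L + d L) = (\<lambda>y. realize_all i c y + realize_all i d y)"
    "realize_all i (\<lambda>L. a * c L) = (\<lambda>y. a * realize_all i c y)"
    by (auto simp: realize_all_def fun_eq_iff)
qed

lemma realize_all_in: "realize_all i c \<in> subdivision_cochains M K i"
  unfolding subdivision_cochains_def
  by (auto simp: realize_all_def polytopal_pair.realize_in[OF face_pair])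

lemma realize_all_coboundary:
  "realize_all (Suc i) (marked_coboundary Ps lam i c) = subdivision_coboundary M K i (realize_all i c)"
proof -
  have "face_realize A (Suc i) (face_part A (Suc i) (marked_coboundary Ps lam i c))
    = cellular_coboundary (cells_in_face K A) (cells_in_boundary K A) i (face_realize A i (face_part A i c))"
    if "A face_of M" for A
    unfolding face_part_coboundary[OF that] by (rule polytopal_pair.realize_coboundary[OF face_pair[OF that]])
  then show ?thesis
    by (auto simp: realize_all_def subdivision_coboundary_def fun_eq_iff)
qed

text \<open>Each chain is visible in exactly one summand, that of its carrying face, so the
  bijections for the single faces combine.\<close>

lemma bij_realize_all: "bij_betw (realize_all i) (marked_cochains Ps lam i) (subdivision_cochains M K i)"
  unfolding bij_betw_def
proof
  show "inj_on (realize_all i) (marked_cochains Ps lam i)"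
  proof (rule inj_onI, rule ext)
    fix c d L
    assume cd: "c \<in> marked_cochains Ps lam i" "d \<in> marked_cochains Ps lam i" "realize_all i c = realize_all i d"
    show "c L = d L"
    proof (cases "L \<in> adm \<and> chain_dim Ps L = i")
      case True
      then obtain A where AL: "face_interior A L" using ex_face_interior by blast
      then have A: "A face_of M" "A \<noteq> {}" using cell_props(2) True unfolding face_interior_def by blast+
      have "face_realize A i (face_part A i c) = face_realize A i (face_part A i d)"
      proof
        fix z
        show "face_realize A i (face_part A i c) z = face_realize A i (face_part A i d) z"
          using A fun_cong[OF cd(3), of "(A, z)"] by (simp add: realize_all_def)
      qed
      then have "face_part A i c = face_part A i d"
        using polytopal_pair.bij_realize[OF face_pair[OF A(1)], of i] face_part_in[OF A(1)]
        unfolding bij_betw_def inj_on_def by blast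
      moreover have "cell L \<in> face_cells A i"
        unfolding face_cells_eq[OF A(1)] using True AL by blast
      moreover have "face_part A i b (cell L) = b L" if "cell L \<in> face_cells A i" for b
        using that True by (simp only: face_part_def cell_chain if_True)
      ultimately show ?thesis by metis
    next
      case False
      then have "c L = 0" "d L = 0" using cd(1,2) unfolding marked_cochains_iff by blast+
      then show ?thesis by simp
    qed
  qed
  show "realize_all i ` marked_cochains Ps lam i = subdivision_cochains M K i"
  proof (intro equalityI subsetI)
    fix e assume e: "e \<in> subdivision_cochains M K i"
    have "\<exists>c\<in>face_cochains A i. face_realize A i c = (\<lambda>z. e (A, z))" if "A face_of M" "A \<noteq> {}" for A
    proof -
      have "(\<lambda>z. e (A, z)) \<in> cellular_cochains (cells_in_face K A) (cells_in_boundary K A) i"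
        using e that unfolding subdivision_cochains_def by auto
      then have "(\<lambda>z. e (A, z)) \<in> face_realize A i ` face_cochains A i"
        using polytopal_pair.bij_realize[OF face_pair[OF that(1)], of i] unfolding bij_betw_def by simp
      then show ?thesis by force
    qed
    then obtain f where f: "\<And>A. A face_of M \<Longrightarrow> A \<noteq> {} \<Longrightarrow> f A \<in> face_cochains A i"
      "\<And>A. A face_of M \<Longrightarrow> A \<noteq> {} \<Longrightarrow> face_realize A i (f A) = (\<lambda>z. e (A, z))"
      by metis
    \<comment> \<open>The coefficient of \<open>L\<close> is taken from the component at its
      carrying face, which exists and is unique.\<close>
    define c where "c L = (if L \<in> adm \<and> chain_dim Ps L = i then f (THE A. face_interior A L) (cell L) else 0)" for L
    have part: "face_part A i c = f A" if A: "A face_of M" "A \<noteq> {}" for A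
    proof
      fix F
      show "face_part A i c F = f A F"
      proof (cases "F \<in> face_cells A i")
        case True
        then obtain L where L: "L \<in> adm" "chain_dim Ps L = i" "face_interior A L" "F = cell L"
          unfolding face_cells_eq[OF A(1)] by blast
        have "(THE A. face_interior A L) = A"
          using L face_interior_unique by (intro the_equality) blast+
        then show ?thesis using True L by (simp add: face_part_def cell_chain c_def)
      next
        case False
        moreover have "f A F = 0"
          using f(1)[OF A] False unfolding polytopal_pair.cell_cochains_def[OF face_pair[OF A(1)]] by blast
        ultimately show ?thesis by (simp add: face_part_def)
      qed
    qed
    have "realize_all i c = e"
    proof
      fix y :: "(real, 'p) vec set \<times> (real, 'p) vec chain set"
      obtain A z where y: "y = (A, z)" by fastforce
      show "realize_all i c y = e y"
      proof (cases "A face_of M \<and> A \<noteq> {}")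
        case True
        then show ?thesis using part f(2)[of A] by (simp add: y realize_all_def)
      next
        case False
        have "\<forall>z. e (A, z) = 0"
          using spec[OF e[unfolded subdivision_cochains_def mem_Collect_eq], of A] unfolding if_not_P[OF False] .
        then have "e (A, z) = 0" ..
        then show ?thesis by (simp only: y realize_all_def prod.case if_not_P[OF False])
      qed
    qed
    moreover have "c \<in> marked_cochains Ps lam i"
      unfolding marked_cochains_iff by (simp add: c_def)
    ultimately show "e \<in> realize_all i ` marked_cochains Ps lam i" by blast
  qed (use realize_all_in in blast)
qed

lemma subdivision_coboundary_twice:
  assumes "c \<in> subdivision_cochains M K i"
  shows "subdivision_coboundary M K (Suc i) (subdivision_coboundary M K i c) = (\<lambda>y. 0)"
proof
  fix y :: "(real, 'p) vec set \<times> (real, 'p) vec chain set"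
  obtain A z where y: "y = (A, z)" by fastforce
  show "subdivision_coboundary M K (Suc i) (subdivision_coboundary M K i c) y = 0"
  proof (cases "A face_of M \<and> A \<noteq> {}")
    case True
    then have "(\<lambda>z. c (A, z)) \<in> cellular_cochains (cells_in_face K A) (cells_in_boundary K A) i"
      using assms unfolding subdivision_cochains_def by auto
    from fun_cong[OF cellular_coboundary_twice[OF this], of z] show ?thesis
      using True by (simp add: y subdivision_coboundary_def)
  next
    case False
    then show ?thesis unfolding y subdivision_coboundary_def prod.case by (simp only: if_False)
  qed
qed

text \<open>Inherited from the cellular complex: the comparison map commutes with the coboundaries
  and is injective, so no cancellation of chains has to be examined.\<close>

lemma marked_coboundary_twice:
  assumes c: "c \<in> marked_cochains Ps lam i"
  shows "marked_coboundary Ps lam (Suc i) (marked_coboundary Ps lam i c) = (\<lambda>L. 0)"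
proof -
  let ?i = "Suc (Suc i)"
  have "realize_all ?i (marked_coboundary Ps lam (Suc i) (marked_coboundary Ps lam i c)) = (\<lambda>y. 0)"
    unfolding realize_all_coboundary by (rule subdivision_coboundary_twice[OF realize_all_in])
  moreover have "realize_all ?i (\<lambda>L. 0) = (\<lambda>y. 0)"
    using realize_all_linear(2)[of ?i 0 "\<lambda>L. 0"] by simp
  moreover have "(\<lambda>L. 0) \<in> marked_cochains Ps lam ?i" by (simp add: marked_cochains_iff)
  ultimately show ?thesis
    using bij_realize_all[of ?i] marked_coboundary_in[of Ps lam "Suc i" "marked_coboundary Ps lam i c"]
    unfolding bij_betw_def inj_on_def by metis
qed

end

theorem theorem3p8:
  fixes Ps :: "'p::{finite,order} set" and lam :: "'p \<Rightarrow> real"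
  assumes "\<And>p. (\<forall>q. \<not> q < p) \<Longrightarrow> p \<in> Ps"
    and "\<And>p. (\<forall>q. \<not> p < q) \<Longrightarrow> p \<in> Ps"
    and "mono_on Ps lam"
  shows "z2_cochain_complex (marked_cochains Ps lam) (marked_coboundary Ps lam) \<and>
    z2_cochain_isomorphic (marked_cochains Ps lam) (marked_coboundary Ps lam)
      (subdivision_cochains (marked_order_polytope Ps lam) (marked_subdivision Ps lam))
      (subdivision_coboundary (marked_order_polytope Ps lam) (marked_subdivision Ps lam))"
proof
  interpret marked_poset Ps lam by unfold_locales (fact assms(1), fact assms(2))
  show "z2_cochain_complex (marked_cochains Ps lam) (marked_coboundary Ps lam)"
    unfolding z2_cochain_complex_def
  proof (intro conjI allI ballI)
    fix i
    show "z2_subspace (marked_cochains Ps lam i)"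
      by (rule z2_subspace_marked_cochains)
    show "z2_linear (marked_cochains Ps lam i) (marked_cochains Ps lam (Suc i)) (marked_coboundary Ps lam i)"
      unfolding z2_linear_def
    proof (intro conjI ballI allI)
      show "marked_coboundary Ps lam i \<in> marked_cochains Ps lam i \<rightarrow> marked_cochains Ps lam (Suc i)"
        by (rule funcsetI) (rule marked_coboundary_in)
    qed (simp_all only: marked_coboundary_linear)
    show "marked_coboundary Ps lam (Suc i) (marked_coboundary Ps lam i c) = (\<lambda>L. 0)"
      if "c \<in> marked_cochains Ps lam i" for c
      using that by (rule marked_coboundary_twice)
  qed
  show "z2_cochain_isomorphic (marked_cochains Ps lam) (marked_coboundary Ps lam)
      (subdivision_cochains (marked_order_polytope Ps lam) (marked_subdivision Ps lam))
      (subdivision_coboundary (marked_order_polytope Ps lam) (marked_subdivision Ps lam))"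
    unfolding z2_cochain_isomorphic_def z2_linear_def
  proof (intro exI[of _ realize_all] conjI allI ballI)
    show "realize_all i \<in> marked_cochains Ps lam i \<rightarrow> subdivision_cochains M K i" for i
      by (rule funcsetI) (rule realize_all_in)
  qed (simp_all only: realize_all_linear bij_realize_all realize_all_coboundary)
qed

end
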